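(* There exists a sequence of pairs $(G_n, H_n)_{n \geq 1}$, where $G_n$ is a finite group and $H_n$ is a subgroup of $G_n$, such that the ordinary depth satisfies $d(H_n, G_n) = 2n$ for every positive integer $n$.
   Context: Let $H$ be a subgroup of a finite group $G$. For $n \geq 1$, the inclusion $\mathbb{C}H \subseteq \mathbb{C}G$ is said to have depth $2n$ if $\mathbb{C}G \otimes_{\mathbb{C}H} \cdots \otimes_{\mathbb{C}H} \mathbb{C}G$ ($n+1$ factors $\mathbb{C}G$) is isomorphic, as a $\mathbb{C}G$-$\mathbb{C}H$-bimodule, to a direct summand of $\bigoplus_{i=1}^a \mathbb{C}G \otimes_{\mathbb{C}H} \cdots \otimes_{\mathbb{C}H} \mathbb{C}G$ ($n$ factors $\mathbb{C}G$ in each summand) for some positive integer $a$. For $n \geq 1$, it is said to have depth $2n+1$ if the same assertion holds for $\mathbb{C}H$-$\mathbb{C}H$-bimodules. It is said to have depth $1$ if $\mathbb{C}G$ is isomorphic, as a $\mathbb{C}H$-$\mathbb{C}H$-bimodule, to a direct summand of $\bigoplus_{i=1}^a \mathbb{C}H$ for some positive integer $a$. The ordinary depth $d(H,G)$ is the minimal positive integer $k$ such that $\mathbb{C}H \subseteq \mathbb{C}G$ has depth $k$. Equivalently: let $\chi_1, \ldots, \chi_s$ be the irreducible complex characters of $G$, let $\psi_1, \ldots, \psi_r$ be those of $H$, and let $M = (m_{i,j})$ be the $r \times s$ matrix with $m_{i,j} = (\psi_i^G, \chi_j)$, the multiplicity of $\chi_j$ in the induced character $\psi_i^G$. Put $M^0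 = I_r$, $M^1 = M$, $M^{2l} = M^{2l-1} M^T$ for $l \geq 1$, and $M^{2l+1} = M^{2l} M$. Then $d(H,G)$ is the smallest integer $k \geq 1$ such that $M^{k+1} \leq a M^{k-1}$ holds entrywise for some positive integer $a$. *)

theory Defs
  imports Complex_Main "HOL-Algebra.Ring" "HOL-Algebra.Free_Abelian_Groups"
begin

(* The group algebra of a finite group G; an element is its coefficient function,
   extended by 0 outside the carrier. *)

definition group_algebra :: "('g, 'x) monoid_scheme \<Rightarrow> ('g \<Rightarrow> complex) ring" where
  "group_algebra G =
     \<lparr>carrier = {f. \<forall>x. x \<notin> carrier G \<longrightarrow> f x = 0},
      monoid.mult = (\<lambda>f g x. \<Sum>(y, z) \<in> {(y, z). y \<in> carrier G \<and> z \<in> carrier G \<and> y \<otimes>\<^bsub>G\<^esub> z = x}. f y * g z),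
      one = (\<lambda>x. if x = \<one>\<^bsub>G\<^esub> then 1 else 0),
      ring.zero = (\<lambda>_. 0),
      ring.add = (\<lambda>f g x. f x + g x)\<rparr>"

(* Bimodules whose left and right scalars are elements of one ambient ring (type 'r).
   As in Free_Abelian_Groups and Product_Groups, the underlying abelian group is a monoid
   record, so its addition is the operation of the group.
   The rings acting on the left and on the right are given as sets L, R of scalars. *)

record ('r, 'm) bimodule = "'m monoid" +
  lact :: "'r \<Rightarrow> 'm \<Rightarrow> 'm"
  ract :: "'m \<Rightarrow> 'r \<Rightarrow> 'm"

definition bimodule_iso ::
  "'r set \<Rightarrow> 'r set \<Rightarrow> ('r, 'm, 'x) bimodule_scheme \<Rightarrow> ('r, 'n, 'y) bimodule_scheme \<Rightarrow> bool" where
  "bimodule_iso L R V W \<longleftrightarrow>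
     (\<exists>f \<in> iso V W. (\<forall>r \<in> L. \<forall>v \<in> carrier V. f (lact V r v) = lact W r (f v)) \<and>
                    (\<forall>r \<in> R. \<forall>v \<in> carrier V. f (ract V v r) = ract W (f v) r))"

definition sub_bimodule ::
  "'r set \<Rightarrow> 'r set \<Rightarrow> 'm set \<Rightarrow> ('r, 'm, 'x) bimodule_scheme \<Rightarrow> bool" where
  "sub_bimodule L R U W \<longleftrightarrow> subgroup U W \<and>
     (\<forall>r \<in> L. \<forall>u \<in> U. lact W r u \<in> U) \<and> (\<forall>r \<in> R. \<forall>u \<in> U. ract W u r \<in> U)"

definition iso_direct_summand ::
  "'r set \<Rightarrow> 'r set \<Rightarrow> ('r, 'm, 'x) bimodule_scheme \<Rightarrow> ('r, 'n, 'y) bimodule_scheme \<Rightarrow> bool" where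
  "iso_direct_summand L R V W \<longleftrightarrow>
     (\<exists>U U'. sub_bimodule L R U W \<and> sub_bimodule L R U' W \<and>
             U \<inter> U' = {\<one>\<^bsub>W\<^esub>} \<and> U <#>\<^bsub>W\<^esub> U' = carrier W \<and>
             bimodule_iso L R V (W\<lparr>carrier := U\<rparr>))"

definition direct_power :: "nat \<Rightarrow> ('r, 'm, 'x) bimodule_scheme \<Rightarrow> ('r, nat \<Rightarrow> 'm) bimodule" where
  "direct_power a W =
     monoid.extend (product_group {..<a} (\<lambda>_. W))
       \<lparr>lact = (\<lambda>r v. \<lambda>i\<in>{..<a}. lact W r (v i)),
        ract = (\<lambda>v r. \<lambda>i\<in>{..<a}. ract W (v i) r)\<rparr>"

definition regular_bimodule :: "('r, 'x) ring_scheme \<Rightarrow> ('r, 'r) bimodule" where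
  "regular_bimodule A =
     \<lparr>carrier = carrier A, monoid.mult = ring.add A, one = \<zero>\<^bsub>A\<^esub>,
      lact = monoid.mult A, ract = monoid.mult A\<rparr>"

(* For a subring B of A, the n-fold tensor product of A with itself over B (n > 0), in the
   unbracketed form: the free abelian group on the n-tuples over A (lists of length n)
   modulo additivity in each entry and
   (.., x b, y, ..) = (.., x, b y, ..) for b in B.  All n share one type,
   which iterating a binary tensor product would not allow.
   If B contains the scalars of an algebra A, the last relation makes the tensor
   product bilinear over the scalars. *)

definition tuples :: "('r, 'x) ring_scheme \<Rightarrow> nat \<Rightarrow> 'r list set" where
  "tuples A n = {xs. length xs = n \<and> set xs \<subseteq> carrier A}"

definition tensor_relators ::
  "('r, 'x) ring_scheme \<Rightarrow> 'r set \<Rightarrow> nat \<Rightarrow> ('r list \<Rightarrow>\<^sub>0 int) set" where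
  "tensor_relators A B n =
     {frag_of (us @ [x \<oplus>\<^bsub>A\<^esub> y] @ vs) - frag_of (us @ [x] @ vs) - frag_of (us @ [y] @ vs) | us vs x y.
        us @ [x] @ vs \<in> tuples A n \<and> y \<in> carrier A} \<union>
     {frag_of (us @ [x \<otimes>\<^bsub>A\<^esub> b, y] @ vs) - frag_of (us @ [x, b \<otimes>\<^bsub>A\<^esub> y] @ vs) | us vs x y b.
        us @ [x, y] @ vs \<in> tuples A n \<and> b \<in> B}"

definition tensor_kernel ::
  "('r, 'x) ring_scheme \<Rightarrow> 'r set \<Rightarrow> nat \<Rightarrow> ('r list \<Rightarrow>\<^sub>0 int) set" where
  "tensor_kernel A B n = generate (free_Abelian_group (tuples A n)) (tensor_relators A B n)"

(* The additive extension of left multiplication of the first entry (right multiplication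
   of the last entry) preserves the kernel; it sends the coset C to the coset containing
   the image of C, which is the sum of the kernel and that image. *)

definition tensor_power ::
  "('r, 'x) ring_scheme \<Rightarrow> 'r set \<Rightarrow> nat \<Rightarrow> ('r, ('r list \<Rightarrow>\<^sub>0 int) set) bimodule" where
  "tensor_power A B n =
     (let F = free_Abelian_group (tuples A n); K = tensor_kernel A B n in
      monoid.extend (F Mod K)
        \<lparr>lact = (\<lambda>r C. K <#>\<^bsub>F\<^esub> frag_extend (\<lambda>xs. frag_of ((r \<otimes>\<^bsub>A\<^esub> hd xs) # tl xs)) ` C),
         ract = (\<lambda>C r. K <#>\<^bsub>F\<^esub> frag_extend (\<lambda>xs. frag_of (butlast xs @ [last xs \<otimes>\<^bsub>A\<^esub> r])) ` C)\<rparr>)"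

definition has_depth :: "('r, 'x) ring_scheme \<Rightarrow> 'r set \<Rightarrow> nat \<Rightarrow> bool" where
  "has_depth A B k \<longleftrightarrow>
     (k = 1 \<and> (\<exists>a>0. iso_direct_summand B B
         (regular_bimodule A) (direct_power a (regular_bimodule (A\<lparr>carrier := B\<rparr>))))) \<or>
     (\<exists>n\<ge>1. k = 2 * n \<and> (\<exists>a>0. iso_direct_summand (carrier A) B
         (tensor_power A B (n + 1)) (direct_power a (tensor_power A B n)))) \<or>
     (\<exists>n\<ge>1. k = 2 * n + 1 \<and> (\<exists>a>0. iso_direct_summand B B
         (tensor_power A B (n + 1)) (direct_power a (tensor_power A B n))))"

definition ordinary_depth :: "'g set \<Rightarrow> ('g, 'x) monoid_scheme \<Rightarrow> nat" where
  "ordinary_depth H G =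
     (LEAST k. 1 \<le> k \<and>
        has_depth (group_algebra G) (carrier (group_algebra (G\<lparr>carrier := H\<rparr>))) k)"

end

theory Submission
  imports Defs "HOL-Combinatorics.Permutations"
begin

text \<open>
  Let \<open>G\<close> act transitively on \<open>\<Omega>\<close> with point stabilizer \<open>H\<close>. The \<open>m\<close>-fold tensor power of
  \<open>\<complex>G\<close> over \<open>\<complex>H\<close> is the permutation bimodule on \<open>G \<times>\<^sub>H \<dots> \<times>\<^sub>H G\<close>; passing to partial products
  turns this set into \<open>\<Omega>\<close>-valued sequences of length \<open>m - 1\<close> together with an element of \<open>G\<close>.

  If \<open>n - 1\<close> points have a stabilizer in \<open>H\<close> that acts trivially on \<open>\<Omega>\<close>, then every orbit of
  \<open>G \<times> H\<close> on the \<open>(n + 1)\<close>-fold set is a quotient of one fixed orbit on the \<open>n\<close>-fold set, which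
  gives depth \<open>2 n\<close>. Depth \<open>2 m + 1\<close> is excluded by linear characters \<open>\<psi>\<close>, \<open>\<psi>'\<close> of a subgroup of
  \<open>H\<close> whose idempotents satisfy \<open>e T\<^sub>m f = 0\<close> and \<open>e T\<^sub>m\<^sub>+\<^sub>1 f \<noteq> 0\<close>, where \<open>T\<^sub>m\<close> is the \<open>m\<close>-fold tensor
  power; depth \<open>2 m\<close> implies depth \<open>2 m + 1\<close>.

  Both conditions hold when \<open>G\<close> is the wreath product of the dihedral group of order 8 with the
  symmetric group of degree \<open>n\<close>, acting on the \<open>2 n\<close> blocks of size two. Fixing a half in each of
  the \<open>n\<close> blocks of size four fixes all blocks of size two. On the other hand \<open>\<psi>'\<close> detects the
  swaps of halves in \<open>m\<close> blocks of size four, and fixing fewer than \<open>m\<close> further points cannot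
  prevent all of them.
\<close>

section \<open>Bimodules\<close>

text \<open>Tensor powers are given as quotients of free abelian groups on tuples, where nothing can
  be computed directly. Functions on chains replace them; the price is a proof that the relators
  generate every formal sum of tuples whose associated function vanishes. The obstruction works
  without any decomposition into irreducibles: e T f = 0 passes from T to its powers and to whatever
  embeds in them. Since it starts at level 0, it also handles depth one. The dihedral group enters
  through its bottom layer. Swaps inside blocks of size two act trivially on \<Omega>, so the upper
  bound does not see them, but their signs tie \<open>g\<close> down: it must carry the other half
  of the block of size four around \<omega> to the half \<omega>. Otherwise \<open>g\<close> could
  carry one of the m tested blocks of size four onto the block around \<omega>, whose halves no
  element of H exchanges; the m - 1 free entries of a chain could then prevent all remaining
  exchanges, and e T f = 0 would fail at level m.\<close>

definition additive_biaction ::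
  "'r set \<Rightarrow> 'r set \<Rightarrow> ('r, 'm, 'x) bimodule_scheme \<Rightarrow> bool" where
  "additive_biaction L R V \<longleftrightarrow> group V \<and> (\<forall>r \<in> L. lact V r \<in> hom V V) \<and>
     (\<forall>r \<in> R. (\<lambda>v. ract V v r) \<in> hom V V)"

lemma direct_power_simps [simp]:
  "carrier (direct_power a W) = (\<Pi>\<^sub>E i\<in>{..<a}. carrier W)"
  "monoid.mult (direct_power a W) = (\<lambda>x y. \<lambda>i\<in>{..<a}. x i \<otimes>\<^bsub>W\<^esub> y i)"
  "\<one>\<^bsub>direct_power a W\<^esub> = (\<lambda>i\<in>{..<a}. \<one>\<^bsub>W\<^esub>)"
  "lact (direct_power a W) = (\<lambda>r v. \<lambda>i\<in>{..<a}. lact W r (v i))"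
  "ract (direct_power a W) = (\<lambda>v r. \<lambda>i\<in>{..<a}. ract W (v i) r)"
  by (simp_all add: direct_power_def monoid.defs product_group_def)

lemma group_direct_power:
  assumes "group W"
  shows "group (direct_power a W)"
proof -
  interpret W: group W by fact
  show ?thesis
  proof (rule groupI)
    fix x assume "x \<in> carrier (direct_power a W)"
    then show "\<exists>y\<in>carrier (direct_power a W). y \<otimes>\<^bsub>direct_power a W\<^esub> x = \<one>\<^bsub>direct_power a W\<^esub>"
      by (intro bexI[of _ "\<lambda>i\<in>{..<a}. inv\<^bsub>W\<^esub> x i"]) (auto simp: fun_eq_iff PiE_iff)
  qed (auto simp: fun_eq_iff PiE_iff W.m_assoc extensional_def)
qed

lemma additive_biactionI:
  assumes "group V"
    and "\<And>r v. r \<in> L \<Longrightarrow> v \<in> carrier V \<Longrightarrow> lact V r v \<in> carrier V"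
    and "\<And>r v w. r \<in> L \<Longrightarrow> v \<in> carrier V \<Longrightarrow> w \<in> carrier V \<Longrightarrow>
          lact V r (v \<otimes>\<^bsub>V\<^esub> w) = lact V r v \<otimes>\<^bsub>V\<^esub> lact V r w"
    and "\<And>r v. r \<in> R \<Longrightarrow> v \<in> carrier V \<Longrightarrow> ract V v r \<in> carrier V"
    and "\<And>r v w. r \<in> R \<Longrightarrow> v \<in> carrier V \<Longrightarrow> w \<in> carrier V \<Longrightarrow>
          ract V (v \<otimes>\<^bsub>V\<^esub> w) r = ract V v r \<otimes>\<^bsub>V\<^esub> ract V w r"
  shows "additive_biaction L R V"
  using assms by (auto simp: additive_biaction_def intro!: homI)

lemma additive_biactionD:
  assumes "additive_biaction L R V"
  shows "group V"
    and "\<And>r v. r \<in> L \<Longrightarrow> v \<in> carrier V \<Longrightarrow> lact V r v \<in> carrier V"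
    and "\<And>r v w. r \<in> L \<Longrightarrow> v \<in> carrier V \<Longrightarrow> w \<in> carrier V \<Longrightarrow>
          lact V r (v \<otimes>\<^bsub>V\<^esub> w) = lact V r v \<otimes>\<^bsub>V\<^esub> lact V r w"
    and "\<And>r v. r \<in> R \<Longrightarrow> v \<in> carrier V \<Longrightarrow> ract V v r \<in> carrier V"
    and "\<And>r v w. r \<in> R \<Longrightarrow> v \<in> carrier V \<Longrightarrow> w \<in> carrier V \<Longrightarrow>
          ract V (v \<otimes>\<^bsub>V\<^esub> w) r = ract V v r \<otimes>\<^bsub>V\<^esub> ract V w r"
    and "\<And>r. r \<in> L \<Longrightarrow> lact V r \<one>\<^bsub>V\<^esub> = \<one>\<^bsub>V\<^esub>"
    and "\<And>r. r \<in> R \<Longrightarrow> ract V \<one>\<^bsub>V\<^esub> r = \<one>\<^bsub>V\<^esub>"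
proof -
  note * = assms[unfolded additive_biaction_def]
  show "\<And>r. r \<in> L \<Longrightarrow> lact V r \<one>\<^bsub>V\<^esub> = \<one>\<^bsub>V\<^esub>" "\<And>r. r \<in> R \<Longrightarrow> ract V \<one>\<^bsub>V\<^esub> r = \<one>\<^bsub>V\<^esub>"
    using * hom_one[of _ V V] by blast+
qed (use assms in \<open>auto simp: additive_biaction_def hom_def\<close>)

lemma additive_biaction_direct_power:
  assumes "additive_biaction L R W"
  shows "additive_biaction L R (direct_power a W)"
proof (rule additive_biactionI)
  show "group (direct_power a W)"
    by (rule group_direct_power[OF additive_biactionD(1)[OF assms]])
qed (simp_all add: PiE_iff restrict_def extensional_def additive_biactionD[OF assms] cong: if_cong)

text \<open>Additivity of the coset actions on tensor powers is never computed; it is carried over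
  from functions on chains, where it is linearity of finite sums.\<close>

lemma additive_biaction_iso:
  assumes V: "additive_biaction L R V" and W: "group W" and iso: "bimodule_iso L R V W"
  shows "additive_biaction L R W"
proof -
  obtain f where f: "f \<in> iso V W"
    and fl: "\<And>r v. r \<in> L \<Longrightarrow> v \<in> carrier V \<Longrightarrow> f (lact V r v) = lact W r (f v)"
    and fr: "\<And>r v. r \<in> R \<Longrightarrow> v \<in> carrier V \<Longrightarrow> f (ract V v r) = ract W (f v) r"
    using iso unfolding bimodule_iso_def by blast
  have im: "carrier W = f ` carrier V" and hom: "\<And>v. v \<in> carrier V \<Longrightarrow> f v \<in> carrier W"
    and mult: "\<And>v w. v \<in> carrier V \<Longrightarrow> w \<in> carrier V \<Longrightarrow> f v \<otimes>\<^bsub>W\<^esub> f w = f (v \<otimes>\<^bsub>V\<^esub> w)"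
    using f by (auto simp: iso_def bij_betw_def hom_def)
  interpret V: group V using additive_biactionD(1)[OF V] .
  show ?thesis
  proof (rule additive_biactionI)
    show "lact W r v \<in> carrier W" if r: "r \<in> L" and v: "v \<in> carrier W" for r v
    proof -
      obtain v' where "v = f v'" "v' \<in> carrier V"
        using v im by blast
      then show ?thesis
        using additive_biactionD(2)[OF V r] by (simp add: hom r flip: fl)
    qed
    show "ract W v r \<in> carrier W" if r: "r \<in> R" and v: "v \<in> carrier W" for r v
    proof -
      obtain v' where "v = f v'" "v' \<in> carrier V"
        using v im by blast
      then show ?thesis
        using additive_biactionD(4)[OF V r] by (simp add: hom r flip: fr)
    qed
    show "lact W r (v \<otimes>\<^bsub>W\<^esub> w) = lact W r v \<otimes>\<^bsub>W\<^esub> lact W r w"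
      if r: "r \<in> L" and vw: "v \<in> carrier W" "w \<in> carrier W" for r v w
    proof -
      obtain v' w' where "v = f v'" "w = f w'" "v' \<in> carrier V" "w' \<in> carrier V"
        using vw im by blast
      then show ?thesis
        using additive_biactionD[OF V] r by (simp add: mult flip: fl)
    qed
    show "ract W (v \<otimes>\<^bsub>W\<^esub> w) r = ract W v r \<otimes>\<^bsub>W\<^esub> ract W w r"
      if r: "r \<in> R" and vw: "v \<in> carrier W" "w \<in> carrier W" for r v w
    proof -
      obtain v' w' where "v = f v'" "w = f w'" "v' \<in> carrier V" "w' \<in> carrier V"
        using vw im by blast
      then show ?thesis
        using additive_biactionD[OF V] r by (simp add: mult flip: fr)
    qed
  qed (rule W)
qed

text \<open>Injectivity pulls the vanishing of r V s back from the target to the source. The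
  additive groups are monoid records, so vanishing reads as being equal to the neutral
  element.\<close>

lemma bimodule_iso_annihilated:
  assumes V: "additive_biaction L R V" and W: "group W" and r: "r \<in> L" "s \<in> R"
    and iso: "bimodule_iso L R V W"
    and W0: "\<And>w. w \<in> carrier W \<Longrightarrow> ract W (lact W r w) s = \<one>\<^bsub>W\<^esub>"
    and v: "v \<in> carrier V"
  shows "ract V (lact V r v) s = \<one>\<^bsub>V\<^esub>"
proof -
  obtain f where f: "f \<in> iso V W"
    and fl: "\<And>r v. r \<in> L \<Longrightarrow> v \<in> carrier V \<Longrightarrow> f (lact V r v) = lact W r (f v)"
    and fr: "\<And>r v. r \<in> R \<Longrightarrow> v \<in> carrier V \<Longrightarrow> f (ract V v r) = ract W (f v) r"
    using iso unfolding bimodule_iso_def by blast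
  have lv: "lact V r v \<in> carrier V"
    by (rule additive_biactionD(2)[OF V r(1) v])
  have "f v \<in> carrier W"
    using f v by (auto simp: iso_def hom_def)
  then have "f (ract V (lact V r v) s) = \<one>\<^bsub>W\<^esub>"
    by (simp add: fl fr r v lv W0)
  also have "\<dots> = f \<one>\<^bsub>V\<^esub>"
    using f hom_one[of f V W] W additive_biactionD(1)[OF V] by (simp add: iso_def)
  finally have eq: "f (ract V (lact V r v) s) = f \<one>\<^bsub>V\<^esub>" .
  have "inj_on f (carrier V)"
    using f by (simp add: iso_def bij_betw_def)
  moreover have "\<one>\<^bsub>V\<^esub> \<in> carrier V"
    using additive_biactionD(1)[OF V] by (rule group.is_monoid[THEN monoid.one_closed])
  moreover have "ract V (lact V r v) s \<in> carrier V"
    by (rule additive_biactionD(4)[OF V r(2) lv])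
  ultimately show ?thesis
    using eq by (meson inj_onD)
qed

text \<open>The obstruction behind every lower bound: annihilation by a pair of scalars passes from
  \<open>W\<close> to its powers coordinatewise, and from a power to anything that embeds in
  it.\<close>

lemma direct_summand_power_annihilated:
  assumes V: "additive_biaction L R V" and W: "group W" and r: "r \<in> L" "s \<in> R"
    and summand: "iso_direct_summand L R V (direct_power a W)"
    and W0: "\<And>w. w \<in> carrier W \<Longrightarrow> ract W (lact W r w) s = \<one>\<^bsub>W\<^esub>"
    and v: "v \<in> carrier V"
  shows "ract V (lact V r v) s = \<one>\<^bsub>V\<^esub>"
proof -
  let ?P = "direct_power a W"
  interpret V: group V by (rule additive_biactionD(1)[OF V])
  interpret P: group ?P by (rule group_direct_power[OF W])
  obtain U j where U: "subgroup U ?P" and j: "j \<in> iso V (?P\<lparr>carrier := U\<rparr>)"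
    and jl: "\<And>r v. r \<in> L \<Longrightarrow> v \<in> carrier V \<Longrightarrow> j (lact V r v) = lact ?P r (j v)"
    and jr: "\<And>r v. r \<in> R \<Longrightarrow> v \<in> carrier V \<Longrightarrow> j (ract V v r) = ract ?P (j v) r"
    using summand unfolding iso_direct_summand_def sub_bimodule_def bimodule_iso_def by auto
  note V' = additive_biactionD[OF V]
  have lv: "lact V r v \<in> carrier V"
    by (rule V'(2)[OF r(1) v])
  have jv: "j v \<in> carrier ?P"
    using j v subgroup.subset[OF U] by (auto simp: iso_def hom_def)
  have "j (ract V (lact V r v) s) = ract ?P (lact ?P r (j v)) s"
    by (simp only: jl[OF r(1) v] jr[OF r(2) lv])
  also have "\<dots> = \<one>\<^bsub>?P\<^esub>"
    using jv W0 by (auto simp: fun_eq_iff PiE_iff)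
  also have "\<dots> = j \<one>\<^bsub>V\<^esub>"
    using j hom_one[of j V "?P\<lparr>carrier := U\<rparr>"] P.subgroup_imp_group[OF U] V.is_group
    by (simp add: iso_def)
  finally have eq: "j (ract V (lact V r v) s) = j \<one>\<^bsub>V\<^esub>" .
  have "inj_on j (carrier V)"
    using j by (simp add: iso_def bij_betw_def)
  then show ?thesis
    using eq V'(4)[OF r(2) lv] V.one_closed by (meson inj_onD)
qed

section \<open>Bimodule homomorphisms and split monomorphisms\<close>

definition bimodule_hom ::
  "'r set \<Rightarrow> 'r set \<Rightarrow> ('r, 'm, 'x) bimodule_scheme \<Rightarrow> ('r, 'n, 'y) bimodule_scheme \<Rightarrow> ('m \<Rightarrow> 'n) set" where
  "bimodule_hom L R V W =
     {f \<in> hom V W. (\<forall>r \<in> L. \<forall>v \<in> carrier V. f (lact V r v) = lact W r (f v)) \<and>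
                    (\<forall>r \<in> R. \<forall>v \<in> carrier V. f (ract V v r) = ract W (f v) r)}"

lemma bimodule_homI:
  assumes "\<And>v. v \<in> carrier V \<Longrightarrow> f v \<in> carrier W"
    and "\<And>v w. v \<in> carrier V \<Longrightarrow> w \<in> carrier V \<Longrightarrow> f (v \<otimes>\<^bsub>V\<^esub> w) = f v \<otimes>\<^bsub>W\<^esub> f w"
    and "\<And>r v. r \<in> L \<Longrightarrow> v \<in> carrier V \<Longrightarrow> f (lact V r v) = lact W r (f v)"
    and "\<And>r v. r \<in> R \<Longrightarrow> v \<in> carrier V \<Longrightarrow> f (ract V v r) = ract W (f v) r"
  shows "f \<in> bimodule_hom L R V W"
  using assms by (simp add: bimodule_hom_def hom_def)

lemma bimodule_homD:
  assumes "f \<in> bimodule_hom L R V W" and "v \<in> carrier V"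
  shows "f v \<in> carrier W"
    and "w \<in> carrier V \<Longrightarrow> f (v \<otimes>\<^bsub>V\<^esub> w) = f v \<otimes>\<^bsub>W\<^esub> f w"
    and "r \<in> L \<Longrightarrow> f (lact V r v) = lact W r (f v)"
    and "r \<in> R \<Longrightarrow> f (ract V v r) = ract W (f v) r"
  using assms by (auto simp: bimodule_hom_def hom_def)

lemma bimodule_hom_compose:
  assumes "f \<in> bimodule_hom L R V W" "g \<in> bimodule_hom L R W X"
  shows "(\<lambda>v. g (f v)) \<in> bimodule_hom L R V X"
  by (rule bimodule_homI) (simp_all add: bimodule_homD[OF assms(1)] bimodule_homD[OF assms(2)])

lemma bimodule_hom_direct_power:
  assumes "f \<in> bimodule_hom L R V W"
  shows "(\<lambda>v. \<lambda>i\<in>{..<a}. f (v i)) \<in> bimodule_hom L R (direct_power a V) (direct_power a W)"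
  by (rule bimodule_homI) (auto simp: PiE_iff fun_eq_iff bimodule_homD[OF assms])

lemma bimodule_iso_inverse_homs:
  assumes V: "additive_biaction L R V" and iso: "bimodule_iso L R V W"
  shows "\<exists>f g. f \<in> bimodule_hom L R V W \<and> g \<in> bimodule_hom L R W V \<and>
    (\<forall>v\<in>carrier V. g (f v) = v) \<and> (\<forall>w\<in>carrier W. f (g w) = w)"
proof -
  obtain f where f: "f \<in> iso V W"
    and fl: "\<And>r v. r \<in> L \<Longrightarrow> v \<in> carrier V \<Longrightarrow> f (lact V r v) = lact W r (f v)"
    and fr: "\<And>r v. r \<in> R \<Longrightarrow> v \<in> carrier V \<Longrightarrow> f (ract V v r) = ract W (f v) r"
    using iso unfolding bimodule_iso_def by blast
  let ?g = "inv_into (carrier V) f"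
  have inj: "inj_on f (carrier V)" and im: "carrier W = f ` carrier V"
    using f by (auto simp: iso_def bij_betw_def)
  have "f \<in> bimodule_hom L R V W"
    using f fl fr by (simp add: bimodule_hom_def iso_def)
  moreover have "?g \<in> bimodule_hom L R W V"
    unfolding bimodule_hom_def
  proof (intro CollectI conjI ballI)
    show "?g \<in> hom W V"
      using group.iso_set_sym[OF additive_biactionD(1)[OF V] f] by (simp add: iso_def)
    show "?g (lact W r w) = lact V r (?g w)" if r: "r \<in> L" and w: "w \<in> carrier W" for r w
    proof -
      obtain v where "w = f v" "v \<in> carrier V"
        using w im by blast
      then show ?thesis
        using additive_biactionD(2)[OF V r] by (simp add: inj r flip: fl)
    qed
    show "?g (ract W w r) = ract V (?g w) r" if r: "r \<in> R" and w: "w \<in> carrier W" for r w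
    proof -
      obtain v where "w = f v" "v \<in> carrier V"
        using w im by blast
      then show ?thesis
        using additive_biactionD(4)[OF V r] by (simp add: inj r flip: fr)
    qed
  qed
  moreover have "?g (f v) = v" if "v \<in> carrier V" for v
    by (rule inv_into_f_f[OF inj that])
  moreover have "f (?g w) = w" if "w \<in> carrier W" for w
    using f_inv_into_f[of w f] that im by blast
  ultimately show ?thesis
    by (intro exI[of _ f] exI[of _ ?g] conjI ballI)
qed

lemma bimodule_iso_sym:
  assumes V: "additive_biaction L R V" and iso: "bimodule_iso L R V W"
  shows "bimodule_iso L R W V"
proof -
  obtain f g where f: "f \<in> bimodule_hom L R V W" and g: "g \<in> bimodule_hom L R W V"
    and gf: "\<forall>v\<in>carrier V. g (f v) = v" and fg: "\<forall>w\<in>carrier W. f (g w) = w"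
    using bimodule_iso_inverse_homs[OF V iso] by (elim exE conjE)
  have "bij_betw g (carrier W) (carrier V)"
    using bimodule_homD(1)[OF f] bimodule_homD(1)[OF g]
    by (intro bij_betw_byWitness[OF fg gf]) auto
  then have "g \<in> iso W V"
    using g by (simp add: iso_def bimodule_hom_def)
  then show ?thesis
    using g unfolding bimodule_iso_def bimodule_hom_def by (intro bexI[of _ g]) simp_all
qed

lemma bimodule_iso_subset:
  assumes "bimodule_iso L R V W" "L' \<subseteq> L" "R' \<subseteq> R"
  shows "bimodule_iso L' R' V W"
  using assms unfolding bimodule_iso_def by blast

text \<open>The decomposition w = i (p w) + (w - i (p w)) makes the kernel of \<open>p\<close> a
  complement of the image of \<open>i\<close>.\<close>

lemma split_mono_direct_summand:
  assumes V: "additive_biaction L R V" and W: "additive_biaction L R W"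
    and i: "i \<in> bimodule_hom L R V W" and p: "p \<in> bimodule_hom L R W V"
    and pi: "\<And>v. v \<in> carrier V \<Longrightarrow> p (i v) = v"
  shows "iso_direct_summand L R V W"
proof -
  note il = bimodule_homD(3)[OF i] and ir = bimodule_homD(4)[OF i]
    and pl = bimodule_homD(3)[OF p] and pr = bimodule_homD(4)[OF p]
  note V' = additive_biactionD[OF V] and W' = additive_biactionD[OF W]
  interpret V: group V by (rule V')
  interpret W: group W by (rule W')
  interpret i: group_hom V W i by unfold_locales (use i in \<open>simp add: bimodule_hom_def\<close>)
  interpret p: group_hom W V p by unfold_locales (use p in \<open>simp add: bimodule_hom_def\<close>)
  let ?U = "i ` carrier V" and ?U' = "kernel W V p"
  have "sub_bimodule L R ?U W"
    unfolding sub_bimodule_def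
  proof (intro conjI ballI)
    show "lact W r u \<in> ?U" if "r \<in> L" "u \<in> ?U" for r u
      using that V'(2) by (auto simp flip: il)
    show "ract W u r \<in> ?U" if "r \<in> R" "u \<in> ?U" for r u
      using that V'(4) by (auto simp flip: ir)
  qed (rule i.img_is_subgroup)
  moreover have "sub_bimodule L R ?U' W"
    unfolding sub_bimodule_def
  proof (intro conjI ballI)
    show "lact W r u \<in> ?U'" if "r \<in> L" "u \<in> ?U'" for r u
      using that W'(2) V'(6) by (simp add: kernel_def pl)
    show "ract W u r \<in> ?U'" if "r \<in> R" "u \<in> ?U'" for r u
      using that W'(4) V'(7) by (simp add: kernel_def pr)
  qed (rule p.subgroup_kernel)
  moreover have "?U \<inter> ?U' = {\<one>\<^bsub>W\<^esub>}"
  proof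
    show "?U \<inter> ?U' \<subseteq> {\<one>\<^bsub>W\<^esub>}"
      by (auto simp: kernel_def pi)
    show "{\<one>\<^bsub>W\<^esub>} \<subseteq> ?U \<inter> ?U'"
      by (auto simp: kernel_def intro: image_eqI[of _ _ "\<one>\<^bsub>V\<^esub>"])
  qed
  moreover have "?U <#>\<^bsub>W\<^esub> ?U' = carrier W"
  proof
    show "carrier W \<subseteq> ?U <#>\<^bsub>W\<^esub> ?U'"
    proof
      fix w assume w: "w \<in> carrier W"
      let ?k = "inv\<^bsub>W\<^esub> i (p w) \<otimes>\<^bsub>W\<^esub> w"
      have "?k \<in> ?U'"
        using w by (simp add: kernel_def pi)
      moreover have "w = i (p w) \<otimes>\<^bsub>W\<^esub> ?k"
        using w by (simp flip: W.m_assoc)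
      ultimately show "w \<in> ?U <#>\<^bsub>W\<^esub> ?U'"
        using w by (auto simp: set_mult_def)
    qed
  qed (auto simp: set_mult_def kernel_def)
  moreover have "bimodule_iso L R V (W\<lparr>carrier := ?U\<rparr>)"
    unfolding bimodule_iso_def
  proof (intro bexI conjI ballI)
    have "inj_on i (carrier V)"
      by (rule inj_on_inverseI) (rule pi)
    then show "i \<in> iso V (W\<lparr>carrier := ?U\<rparr>)"
      using i by (simp add: iso_def hom_def bij_betw_def bimodule_hom_def)
  qed (simp_all add: il ir)
  ultimately show ?thesis
    unfolding iso_direct_summand_def by blast
qed

text \<open>Maps are built between spaces of chain functions, whereas depth speaks of tensor powers.
  Conjugating \<open>i\<close> and \<open>p\<close> by the isomorphisms, coordinatewise on the
  power, moves the splitting across.\<close>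

lemma split_mono_direct_summand_iso:
  assumes V: "additive_biaction L R V" and W: "additive_biaction L R W"
    and V': "group V'" and W': "group W'"
    and isoV: "bimodule_iso L R V V'" and isoW: "bimodule_iso L R W W'"
    and i: "i \<in> bimodule_hom L R V (direct_power a W)" and p: "p \<in> bimodule_hom L R (direct_power a W) V"
    and pi: "\<And>v. v \<in> carrier V \<Longrightarrow> p (i v) = v"
  shows "iso_direct_summand L R V' (direct_power a W')"
proof -
  obtain f f' where f: "f \<in> bimodule_hom L R V V'" "f' \<in> bimodule_hom L R V' V"
    and ff: "\<forall>v\<in>carrier V'. f (f' v) = v"
    using bimodule_iso_inverse_homs[OF V isoV] by (elim exE conjE)
  obtain g g' where g: "g \<in> bimodule_hom L R W W'" "g' \<in> bimodule_hom L R W' W"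
    and gg: "\<forall>w\<in>carrier W. g' (g w) = w"
    using bimodule_iso_inverse_homs[OF W isoW] by (elim exE conjE)
  let ?g = "\<lambda>v. \<lambda>k\<in>{..<a}. g (v k)" and ?g' = "\<lambda>v. \<lambda>k\<in>{..<a}. g' (v k)"
  have gg': "?g' (?g w) = w" if "w \<in> carrier (direct_power a W)" for w
    using that gg by (auto simp: PiE_iff intro!: extensionalityI[of _ "{..<a}"])
  show ?thesis
  proof (rule split_mono_direct_summand)
    show "(\<lambda>v. ?g (i (f' v))) \<in> bimodule_hom L R V' (direct_power a W')"
      by (rule bimodule_hom_compose[OF f(2) bimodule_hom_compose[OF i bimodule_hom_direct_power[OF g(1)]]])
    show "(\<lambda>w. f (p (?g' w))) \<in> bimodule_hom L R (direct_power a W') V'"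
      by (rule bimodule_hom_compose[OF bimodule_hom_compose[OF bimodule_hom_direct_power[OF g(2)] p] f(1)])
    show "f (p (?g' (?g (i (f' v))))) = v" if "v \<in> carrier V'" for v
    proof -
      have v: "f' v \<in> carrier V"
        by (rule bimodule_homD(1)[OF f(2) that])
      show ?thesis
        by (simp only: gg'[OF bimodule_homD(1)[OF i v]] pi[OF v] bspec[OF ff that])
    qed
  qed (rule additive_biaction_iso[OF V V' isoV]
      additive_biaction_direct_power[OF additive_biaction_iso[OF W W' isoW]])+
qed

text \<open>Cutting the left scalars down from the algebra of the group to that of the subgroup is
  the step from depth 2 m to depth 2 m + 1.\<close>

lemma iso_direct_summand_subset:
  assumes "iso_direct_summand L R V W" "L' \<subseteq> L" "R' \<subseteq> R"
  shows "iso_direct_summand L' R' V W"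
proof -
  obtain U U' where "sub_bimodule L R U W" "sub_bimodule L R U' W"
    and U: "U \<inter> U' = {\<one>\<^bsub>W\<^esub>}" "U <#>\<^bsub>W\<^esub> U' = carrier W"
    and iso: "bimodule_iso L R V (W\<lparr>carrier := U\<rparr>)"
    using assms(1) unfolding iso_direct_summand_def by blast
  then have "sub_bimodule L' R' U W" "sub_bimodule L' R' U' W"
    using assms(2,3) by (simp_all add: sub_bimodule_def subset_iff)
  moreover have "bimodule_iso L' R' V (W\<lparr>carrier := U\<rparr>)"
    by (rule bimodule_iso_subset[OF iso assms(2,3)])
  ultimately show ?thesis
    using U unfolding iso_direct_summand_def by blast
qed

section \<open>Functions on chains of points\<close>

locale finite_transitive_action = group G for G :: "('g, 'x) monoid_scheme" (structure) +
  fixes act :: "'g \<Rightarrow> 'c \<Rightarrow> 'c" (infixr "\<bullet>" 75) and \<Omega> :: "'c set" and \<omega> :: 'c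
  assumes finite_carrier: "finite (carrier G)"
    and point_in: "\<omega> \<in> \<Omega>"
    and act_closed: "x \<in> carrier G \<Longrightarrow> c \<in> \<Omega> \<Longrightarrow> x \<bullet> c \<in> \<Omega>"
    and one_act: "c \<in> \<Omega> \<Longrightarrow> \<one> \<bullet> c = c"
    and act_mult: "x \<in> carrier G \<Longrightarrow> y \<in> carrier G \<Longrightarrow> c \<in> \<Omega> \<Longrightarrow> (x \<otimes> y) \<bullet> c = x \<bullet> y \<bullet> c"
    and transitive: "c \<in> \<Omega> \<Longrightarrow> \<exists>x\<in>carrier G. x \<bullet> \<omega> = c"
begin

definition point_stabilizer :: "'g set" where
  "point_stabilizer = {x \<in> carrier G. x \<bullet> \<omega> = \<omega>}"

abbreviation A :: "('g \<Rightarrow> complex) ring" where "A \<equiv> group_algebra G"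

abbreviation B :: "('g \<Rightarrow> complex) set" where
  "B \<equiv> carrier (group_algebra (G\<lparr>carrier := point_stabilizer\<rparr>))"

text \<open>The action is unspecified off \<Omega>; the explicit zero there lets identities such as
  \<open>conv_mult\<close> hold as equations of functions without side conditions.\<close>

definition conv :: "('g \<Rightarrow> complex) \<Rightarrow> ('c list \<Rightarrow> 'g \<Rightarrow> complex) \<Rightarrow> 'c list \<Rightarrow> 'g \<Rightarrow> complex" where
  "conv r F = (\<lambda>cs g. if set cs \<subseteq> \<Omega> \<and> g \<in> carrier G
     then \<Sum>x\<in>carrier G. r x * F (map ((\<bullet>) (inv x)) cs) (inv x \<otimes> g) else 0)"

definition rconv :: "('c list \<Rightarrow> 'g \<Rightarrow> complex) \<Rightarrow> ('g \<Rightarrow> complex) \<Rightarrow> 'c list \<Rightarrow> 'g \<Rightarrow> complex" where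
  "rconv F r = (\<lambda>cs g. if g \<in> carrier G
     then \<Sum>x\<in>carrier G. F cs (g \<otimes> inv x) * r x else 0)"

text \<open>Under the correspondence with tensors this is t \<mapsto> 1 \<otimes> t: a new leading
  factor \<one> contributes the point \<omega> and leaves the other partial products alone.\<close>

definition lift :: "('c list \<Rightarrow> 'g \<Rightarrow> complex) \<Rightarrow> 'c list \<Rightarrow> 'g \<Rightarrow> complex" where
  "lift F = (\<lambda>cs g. case cs of [] \<Rightarrow> 0 | c # cs' \<Rightarrow> if c = \<omega> then F cs' g else 0)"

text \<open>
  The point \<open>(cs, g)\<close> for a tuple of group elements consists of the images of \<open>\<omega>\<close> under all
  partial products and of the full product \<open>g\<close>. The last entry of \<open>cs\<close> is thus \<open>g \<bullet> \<omega>\<close>; keeping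
  it makes the recursion uniform, and with the convention for the empty list the level \<open>m = 0\<close>
  is the algebra of \<open>H\<close> itself.
\<close>

primrec tensor_fun :: "('g \<Rightarrow> complex) list \<Rightarrow> 'c list \<Rightarrow> 'g \<Rightarrow> complex" where
  "tensor_fun [] = (\<lambda>cs g. if cs = [] \<and> g = \<one> then 1 else 0)"
| "tensor_fun (a # as) = conv a (lift (tensor_fun as))"

definition chains :: "nat \<Rightarrow> ('c list \<times> 'g) set" where
  "chains m = {(cs, g). length cs = m \<and> set cs \<subseteq> \<Omega> \<and> g \<in> carrier G \<and> last (\<omega> # cs) = g \<bullet> \<omega>}"

definition chain_funs :: "nat \<Rightarrow> ('c list \<Rightarrow> 'g \<Rightarrow> complex) set" where
  "chain_funs m = {F. \<forall>cs g. (cs, g) \<notin> chains m \<longrightarrow> F cs g = 0}"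

definition chain_bimodule :: "nat \<Rightarrow> ('g \<Rightarrow> complex, 'c list \<Rightarrow> 'g \<Rightarrow> complex) bimodule" where
  "chain_bimodule m =
     \<lparr>carrier = chain_funs m, monoid.mult = (\<lambda>F F' cs g. F cs g + F' cs g), one = (\<lambda>_ _. 0),
      lact = conv, ract = rconv\<rparr>"

lemma chain_bimodule_simps [simp]:
  "carrier (chain_bimodule m) = chain_funs m"
  "monoid.mult (chain_bimodule m) = (\<lambda>F F' cs g. F cs g + F' cs g)"
  "\<one>\<^bsub>chain_bimodule m\<^esub> = (\<lambda>_ _. 0)"
  "lact (chain_bimodule m) = conv"
  "ract (chain_bimodule m) = rconv"
  by (simp_all add: chain_bimodule_def)

section \<open>The stabilizer and the product of the group algebra\<close>

lemma stabilizer_subset: "point_stabilizer \<subseteq> carrier G"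
  by (auto simp: point_stabilizer_def)

lemma act_inv_iff:
  assumes "x \<in> carrier G" "c \<in> \<Omega>" "d \<in> \<Omega>"
  shows "inv x \<bullet> c = d \<longleftrightarrow> c = x \<bullet> d"
  using assms by (metis act_mult inv_closed l_inv one_act r_inv)

lemma subgroup_stabilizer: "subgroup point_stabilizer G"
proof
  show "inv x \<in> point_stabilizer" if "x \<in> point_stabilizer" for x
    using that by (simp add: point_stabilizer_def act_inv_iff point_in)
qed (auto simp: point_stabilizer_def one_act point_in act_mult)

lemma stabilizer_image_eq:
  assumes "x \<in> carrier G" "y \<in> carrier G"
  shows "x \<bullet> \<omega> = y \<bullet> \<omega> \<longleftrightarrow> inv x \<otimes> y \<in> point_stabilizer"
  using assms act_inv_iff[of x "y \<bullet> \<omega>" \<omega>]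
  by (auto simp: point_stabilizer_def act_mult point_in act_closed)

lemma carrier_A [simp]: "r \<in> carrier A \<longleftrightarrow> (\<forall>x. x \<notin> carrier G \<longrightarrow> r x = 0)"
  by (simp add: group_algebra_def)

lemma carrier_B [simp]: "r \<in> B \<longleftrightarrow> (\<forall>x. x \<notin> point_stabilizer \<longrightarrow> r x = 0)"
  by (simp add: group_algebra_def)

lemma add_A [simp]: "a \<oplus>\<^bsub>A\<^esub> b = (\<lambda>x. a x + b x)"
  by (simp add: group_algebra_def)

lemma zero_A [simp]: "\<zero>\<^bsub>A\<^esub> = (\<lambda>x. 0)"
  by (simp add: group_algebra_def)

lemma B_subset_A: "B \<subseteq> carrier A"
  using stabilizer_subset unfolding subset_iff carrier_A carrier_B by blast

lemma mult_A:
  "(a \<otimes>\<^bsub>A\<^esub> b) x = (\<Sum>(y, z) \<in> {(y, z). y \<in> carrier G \<and> z \<in> carrier G \<and> y \<otimes> z = x}. a y * b z)"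
  by (simp add: group_algebra_def)

lemma mult_A_in [simp]:
  "a \<otimes>\<^bsub>A\<^esub> b \<in> carrier A"
proof -
  have "(a \<otimes>\<^bsub>A\<^esub> b) x = 0" if "x \<notin> carrier G" for x
    unfolding mult_A by (rule sum.neutral) (use that in auto)
  then show ?thesis by simp
qed

text \<open>Grouping pairs by their product turns the convolution product, tested against any
  \<open>k\<close>, into a free double sum. \<open>conv\<close> is such a test, so its associativity
  follows.\<close>

lemma sum_mult_A:
  "(\<Sum>x\<in>carrier G. (a \<otimes>\<^bsub>A\<^esub> b) x * k x) = (\<Sum>y\<in>carrier G. \<Sum>z\<in>carrier G. a y * b z * k (y \<otimes> z))"
proof -
  let ?S = "carrier G \<times> carrier G"
  let ?h = "\<lambda>(y, z). a y * b z * k (y \<otimes> z)"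
  have "(\<Sum>x\<in>carrier G. (a \<otimes>\<^bsub>A\<^esub> b) x * k x)
      = (\<Sum>x\<in>carrier G. sum ?h {p \<in> ?S. (case p of (y, z) \<Rightarrow> y \<otimes> z) = x})"
  proof (rule sum.cong)
    fix x assume "x \<in> carrier G"
    have "{p \<in> ?S. (case p of (y, z) \<Rightarrow> y \<otimes> z) = x}
        = {(y, z). y \<in> carrier G \<and> z \<in> carrier G \<and> y \<otimes> z = x}" by auto
    then show "(a \<otimes>\<^bsub>A\<^esub> b) x * k x = sum ?h {p \<in> ?S. (case p of (y, z) \<Rightarrow> y \<otimes> z) = x}"
      by (auto simp: mult_A sum_distrib_right intro!: sum.cong)
  qed simp
  also have "\<dots> = sum ?h ?S"
    by (rule sum.group) (auto simp: finite_carrier)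
  also have "\<dots> = (\<Sum>y\<in>carrier G. \<Sum>z\<in>carrier G. a y * b z * k (y \<otimes> z))"
    by (simp add: sum.cartesian_product)
  finally show ?thesis .
qed

section \<open>Convolution and the functions attached to tuples\<close>

lemma set_map_act: "x \<in> carrier G \<Longrightarrow> set cs \<subseteq> \<Omega> \<Longrightarrow> set (map ((\<bullet>) x) cs) \<subseteq> \<Omega>"
  by (auto simp: act_closed)

lemma map_act_mult:
  "x \<in> carrier G \<Longrightarrow> y \<in> carrier G \<Longrightarrow> set cs \<subseteq> \<Omega> \<Longrightarrow>
    map ((\<bullet>) (x \<otimes> y)) cs = map ((\<bullet>) x) (map ((\<bullet>) y) cs)"
  by (auto simp: act_mult)

lemma map_act_one: "set cs \<subseteq> \<Omega> \<Longrightarrow> map ((\<bullet>) \<one>) cs = cs"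
  by (rule map_idI) (auto simp: one_act)

lemma map_act_inv_iff:
  assumes "x \<in> carrier G" "set cs \<subseteq> \<Omega>" "set ds \<subseteq> \<Omega>"
  shows "map ((\<bullet>) (inv x)) cs = ds \<longleftrightarrow> cs = map ((\<bullet>) x) ds"
proof
  assume "map ((\<bullet>) (inv x)) cs = ds"
  then have "map ((\<bullet>) x) ds = map ((\<bullet>) (x \<otimes> inv x)) cs"
    using assms map_act_mult[of x "inv x" cs] by simp
  then show "cs = map ((\<bullet>) x) ds"
    using assms by (simp add: map_act_one)
next
  assume "cs = map ((\<bullet>) x) ds"
  then have "map ((\<bullet>) (inv x)) cs = map ((\<bullet>) (inv x \<otimes> x)) ds"
    using assms map_act_mult[of "inv x" x ds] by simp
  then show "map ((\<bullet>) (inv x)) cs = ds"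
    using assms by (simp add: map_act_one)
qed

lemma conv_mult: "conv (a \<otimes>\<^bsub>A\<^esub> b) F = conv a (conv b F)"
proof (intro ext)
  fix cs g
  show "conv (a \<otimes>\<^bsub>A\<^esub> b) F cs g = conv a (conv b F) cs g"
  proof (cases "set cs \<subseteq> \<Omega> \<and> g \<in> carrier G")
    case True
    let ?t = "\<lambda>y z. b z * F (map ((\<bullet>) (inv z)) (map ((\<bullet>) (inv y)) cs)) (inv z \<otimes> (inv y \<otimes> g))"
    have "conv (a \<otimes>\<^bsub>A\<^esub> b) F cs g = (\<Sum>y\<in>carrier G. \<Sum>z\<in>carrier G.
        a y * b z * F (map ((\<bullet>) (inv (y \<otimes> z))) cs) (inv (y \<otimes> z) \<otimes> g))"
      using True by (simp only: conv_def sum_mult_A simp_thms if_True)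
    also have "\<dots> = (\<Sum>y\<in>carrier G. \<Sum>z\<in>carrier G. a y * ?t y z)"
      using True by (intro sum.cong refl)
        (simp only: inv_mult_group inv_closed map_act_mult m_assoc mult.assoc)
    also have "\<dots> = (\<Sum>y\<in>carrier G. a y * conv b F (map ((\<bullet>) (inv y)) cs) (inv y \<otimes> g))"
    proof (intro sum.cong refl)
      fix y assume "y \<in> carrier G"
      then have "set (map ((\<bullet>) (inv y)) cs) \<subseteq> \<Omega>" "inv y \<otimes> g \<in> carrier G"
        using True by (simp_all only: set_map_act inv_closed m_closed)
      then show "(\<Sum>z\<in>carrier G. a y * ?t y z)
          = a y * conv b F (map ((\<bullet>) (inv y)) cs) (inv y \<otimes> g)"
        by (simp only: conv_def simp_thms if_True sum_distrib_left)
    qed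
    also have "\<dots> = conv a (conv b F) cs g"
      using True by (simp only: conv_def[of a] simp_thms if_True)
    finally show ?thesis .
  qed (auto simp: conv_def)
qed

lemma conv_add_left:
  "conv (\<lambda>x. a x + b x) F = (\<lambda>cs g. conv a F cs g + conv b F cs g)"
  by (auto simp: conv_def fun_eq_iff algebra_simps sum.distrib)

lemma conv_add_right:
  "conv a (\<lambda>cs g. F cs g + F' cs g) = (\<lambda>cs g. conv a F cs g + conv a F' cs g)"
  by (auto simp: conv_def fun_eq_iff algebra_simps sum.distrib)

lemma rconv_add_left:
  "rconv (\<lambda>cs g. F cs g + F' cs g) a = (\<lambda>cs g. rconv F a cs g + rconv F' a cs g)"
  by (auto simp: rconv_def fun_eq_iff algebra_simps sum.distrib)

lemma lift_add: "lift (\<lambda>cs g. F cs g + F' cs g) = (\<lambda>cs g. lift F cs g + lift F' cs g)"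
  by (auto simp: lift_def fun_eq_iff split: list.split)

lemma rconv_conv: "rconv (conv a F) b = conv a (rconv F b)"
proof (intro ext)
  fix cs g
  show "rconv (conv a F) b cs g = conv a (rconv F b) cs g"
  proof (cases "set cs \<subseteq> \<Omega> \<and> g \<in> carrier G")
    case True
    have "(\<Sum>y\<in>carrier G. \<Sum>x\<in>carrier G. a x * F (map ((\<bullet>) (inv x)) cs) (inv x \<otimes> (g \<otimes> inv y)) * b y)
        = (\<Sum>x\<in>carrier G. \<Sum>y\<in>carrier G. a x * (F (map ((\<bullet>) (inv x)) cs) (inv x \<otimes> g \<otimes> inv y) * b y))"
      by (subst sum.swap, intro sum.cong refl) (use True in \<open>simp add: m_assoc\<close>)
    then show ?thesis
      using True by (simp add: conv_def rconv_def sum_distrib_left sum_distrib_right)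
  next
    case False
    then have "conv a F cs (g \<otimes> inv x) * b x = 0" if "g \<in> carrier G" for x
      using that by (auto simp: conv_def)
    then have "rconv (conv a F) b cs g = 0"
      by (auto simp: rconv_def simp del: mult_eq_0_iff)
    moreover have "conv a (rconv F b) cs g = 0"
      unfolding conv_def using False by (simp only: if_False)
    ultimately show ?thesis by (simp only:)
  qed
qed

lemma rconv_lift: "rconv (lift F) b = lift (rconv F b)"
  by (auto simp: rconv_def lift_def fun_eq_iff split: list.split)

text \<open>Elements of the stabilizer fix \<omega> and so move past the prepended base point. This
  is the source of the relation x b \<otimes> y = x \<otimes> b y.\<close>

lemma conv_lift:
  assumes "b \<in> B"
  shows "conv b (lift F) = lift (conv b F)"
proof (intro ext)
  fix cs g
  show "conv b (lift F) cs g = lift (conv b F) cs g"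
  proof (cases "set cs \<subseteq> \<Omega> \<and> g \<in> carrier G \<and> cs \<noteq> []")
    case True
    then obtain c cs' where cs: "cs = c # cs'" by (cases cs) auto
    have "b x * lift F (map ((\<bullet>) (inv x)) cs) (inv x \<otimes> g) =
        (if c = \<omega> then b x * F (map ((\<bullet>) (inv x)) cs') (inv x \<otimes> g) else 0)"
      if "x \<in> carrier G" for x
    proof (cases "x \<in> point_stabilizer")
      case True
      then have "inv x \<bullet> c = \<omega> \<longleftrightarrow> c = \<omega>"
        using that \<open>set cs \<subseteq> \<Omega> \<and> _\<close> by (auto simp: act_inv_iff point_in cs point_stabilizer_def)
      then show ?thesis by (simp add: lift_def cs)
    qed (use assms in auto)
    then show ?thesis
      using True by (simp add: conv_def) (auto simp: cs lift_def conv_def)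
  qed (auto simp: conv_def lift_def point_in split: list.split)
qed

text \<open>The empty tuple gives the unit point mass at \<one>, on which left and right
  multiplication agree. This is how the right action enters an induction that peels off factors from
  the left.\<close>

lemma rconv_tensor_fun_Nil:
  assumes "b \<in> carrier A"
  shows "rconv (tensor_fun []) b = conv b (tensor_fun [])"
proof (intro ext)
  fix cs g
  show "rconv (tensor_fun []) b cs g = conv b (tensor_fun []) cs g"
  proof (cases "g \<in> carrier G \<and> cs = []")
    case True
    then have "g \<otimes> inv x = \<one> \<longleftrightarrow> x = g" "inv x \<otimes> g = \<one> \<longleftrightarrow> x = g" if "x \<in> carrier G" for x
      using that by (metis inv_equality inv_inv inv_closed r_inv l_inv)+
    then show ?thesis
      using True finite_carrier
      by (simp add: rconv_def conv_def if_distrib[of "\<lambda>x. x * _"] if_distrib[of "\<lambda>x. _ * x"] cong: if_cong)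
  qed (auto simp: conv_def rconv_def)
qed

lemma tensor_fun_singleton:
  assumes "a \<in> carrier A"
  shows "tensor_fun [a] = (\<lambda>cs g. if g \<in> carrier G \<and> cs = [g \<bullet> \<omega>] then a g else 0)"
proof (intro ext)
  fix cs g
  show "tensor_fun [a] cs g = (if g \<in> carrier G \<and> cs = [g \<bullet> \<omega>] then a g else 0)"
  proof (cases "set cs \<subseteq> \<Omega> \<and> g \<in> carrier G")
    case True
    have "a x * lift (tensor_fun []) (map ((\<bullet>) (inv x)) cs) (inv x \<otimes> g)
        = (if x = g then if cs = [g \<bullet> \<omega>] then a g else 0 else 0)" if x: "x \<in> carrier G" for x
    proof -
      have "inv x \<otimes> g = \<one> \<longleftrightarrow> x = g"
        using True x by (metis inv_equality inv_inv inv_closed l_inv)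
      moreover have "map ((\<bullet>) (inv x)) cs = [\<omega>] \<longleftrightarrow> cs = [x \<bullet> \<omega>]"
        using True x map_act_inv_iff[of x cs "[\<omega>]"] by (simp add: point_in)
      moreover have "lift (tensor_fun []) ds h = (if ds = [\<omega>] \<and> h = \<one> then 1 else 0)" for ds h
        by (auto simp: lift_def split: list.split)
      ultimately show ?thesis
        by auto
    qed
    then show ?thesis
      using True finite_carrier by (simp add: conv_def)
  qed (auto simp: conv_def act_closed point_in)
qed

lemma tensor_fun_ract:
  assumes "a \<in> carrier A" "b \<in> B"
  shows "tensor_fun (as @ [a \<otimes>\<^bsub>A\<^esub> b]) = rconv (tensor_fun (as @ [a])) b"
proof (induction as)
  case Nil
  \<comment> \<open>The factor \<open>b\<close> stands to the left of \<open>lift\<close> and must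
    cross it before it can become a right action, which is where membership in \<open>B\<close> is
    used.\<close>
  have "conv b (lift (tensor_fun [])) = lift (rconv (tensor_fun []) b)"
    using conv_lift[OF assms(2)] rconv_tensor_fun_Nil[OF subsetD[OF B_subset_A assms(2)]]
    by (simp only:)
  then show ?case
    by (simp only: append_Nil tensor_fun.simps conv_mult rconv_conv rconv_lift)
qed (simp add: rconv_conv rconv_lift)

lemma tensor_fun_balanced:
  assumes "b \<in> B"
  shows "tensor_fun (us @ [a \<otimes>\<^bsub>A\<^esub> b, a'] @ vs) = tensor_fun (us @ [a, b \<otimes>\<^bsub>A\<^esub> a'] @ vs)"
proof (induction us)
  case Nil
  show ?case
    using assms by (simp only: append.simps tensor_fun.simps conv_mult flip: conv_lift)
qed simp

lemma tensor_fun_add: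
  "tensor_fun (us @ [\<lambda>x. a x + b x] @ vs) =
     (\<lambda>cs g. tensor_fun (us @ [a] @ vs) cs g + tensor_fun (us @ [b] @ vs) cs g)"
  by (induction us) (simp_all add: conv_add_left conv_add_right lift_add)

section \<open>The bimodules of functions on chains\<close>

lemma chains_act:
  assumes "x \<in> carrier G" "(cs, g) \<in> chains m" "m > 0 \<or> x \<in> point_stabilizer"
  shows "(map ((\<bullet>) x) cs, x \<otimes> g) \<in> chains m"
proof -
  have cs: "set cs \<subseteq> \<Omega>" and g: "g \<in> carrier G" and l: "last (\<omega> # cs) = g \<bullet> \<omega>"
    using assms by (auto simp: chains_def)
  have "last (\<omega> # map ((\<bullet>) x) cs) = (x \<otimes> g) \<bullet> \<omega>"
  \<comment> \<open>For the empty chain the endpoint condition says that \<open>g\<close> lies in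
    the stabilizer, and only \<open>x\<close> in the stabilizer preserves this; hence the
    alternative in the assumptions.\<close>
  proof (cases "cs = []")
    case True
    then show ?thesis
      using assms l g by (auto simp: chains_def act_mult point_in point_stabilizer_def)
  next
    case False
    then show ?thesis
      using assms l g by (simp add: last_map act_mult point_in)
  qed
  then show ?thesis
    using assms by (auto simp: chains_def act_closed)
qed

lemma chains_ract:
  assumes "h \<in> point_stabilizer" "(cs, g) \<in> chains m"
  shows "(cs, g \<otimes> h) \<in> chains m"
  using assms by (auto simp: chains_def point_stabilizer_def act_mult point_in)

lemma chain_funsD: "F \<in> chain_funs m \<Longrightarrow> (cs, g) \<notin> chains m \<Longrightarrow> F cs g = 0"
  by (simp add: chain_funs_def)

lemma conv_chain_funs:
  assumes r: "r \<in> carrier A" and F: "F \<in> chain_funs m" and m: "m > 0 \<or> r \<in> B"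
  shows "conv r F \<in> chain_funs m"
  unfolding chain_funs_def
proof (clarify)
  fix cs g assume ng: "(cs, g) \<notin> chains m"
  have "r x * F (map ((\<bullet>) (inv x)) cs) (inv x \<otimes> g) = 0"
    if x: "x \<in> carrier G" and v: "set cs \<subseteq> \<Omega>" "g \<in> carrier G" for x
  proof (cases "r x = 0")
    case False
    then have "m > 0 \<or> x \<in> point_stabilizer"
      using m by auto
    then have "(map ((\<bullet>) (inv x)) cs, inv x \<otimes> g) \<notin> chains m"
      using chains_act[of x "map ((\<bullet>) (inv x)) cs" "inv x \<otimes> g" m] ng x v
        map_act_inv_iff[of x cs "map ((\<bullet>) (inv x)) cs"] set_map_act[of "inv x" cs]
      by (auto simp flip: m_assoc)
    then show ?thesis
      using chain_funsD[OF F] by simp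
  qed simp
  then show "conv r F cs g = 0"
    by (auto simp: conv_def simp del: mult_eq_0_iff)
qed

lemma rconv_chain_funs:
  assumes r: "r \<in> B" and F: "F \<in> chain_funs m"
  shows "rconv F r \<in> chain_funs m"
  unfolding chain_funs_def
proof (clarify)
  fix cs g assume ng: "(cs, g) \<notin> chains m"
  have "F cs (g \<otimes> inv x) * r x = 0"
    if x: "x \<in> carrier G" and v: "g \<in> carrier G" for x
  proof (cases "r x = 0")
    case False
    then have "x \<in> point_stabilizer"
      using r by auto
    then have "(cs, g \<otimes> inv x) \<notin> chains m"
      using chains_ract[of x cs "g \<otimes> inv x" m] ng x v by (auto simp: m_assoc)
    then show ?thesis
      using chain_funsD[OF F] by simp
  qed simp
  then show "rconv F r cs g = 0"
    by (auto simp: rconv_def simp del: mult_eq_0_iff)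
qed

lemma lift_chain_funs:
  assumes F: "F \<in> chain_funs m"
  shows "lift F \<in> chain_funs (Suc m)"
  using F by (auto simp: chain_funs_def chains_def lift_def point_in split: list.split)

lemma tensor_fun_in:
  "set as \<subseteq> carrier A \<Longrightarrow> tensor_fun as \<in> chain_funs (length as)"
proof (induction as)
  case Nil
  show ?case by (auto simp: chain_funs_def chains_def one_act point_in)
next
  case (Cons a as)
  then show ?case by (auto intro!: conv_chain_funs lift_chain_funs)
qed

lemma group_chain_bimodule: "group (chain_bimodule m)"
proof (rule groupI)
  fix F assume "F \<in> carrier (chain_bimodule m)"
  then show "\<exists>F'\<in>carrier (chain_bimodule m). F' \<otimes>\<^bsub>chain_bimodule m\<^esub> F = \<one>\<^bsub>chain_bimodule m\<^esub>"
    by (intro bexI[of _ "\<lambda>cs g. - F cs g"]) (auto simp: chain_funs_def)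
qed (auto simp: chain_funs_def add.assoc)

lemma additive_biaction_chain_bimodule:
  assumes "L \<subseteq> carrier A" "m > 0 \<or> L \<subseteq> B"
  shows "additive_biaction L B (chain_bimodule m)"
proof (rule additive_biactionI)
  show "lact (chain_bimodule m) r v \<in> carrier (chain_bimodule m)"
    if "r \<in> L" "v \<in> carrier (chain_bimodule m)" for r v
    using that assms conv_chain_funs[of r v m] by (simp add: subset_iff) blast
qed (simp_all only: group_chain_bimodule chain_bimodule_simps conv_add_right rconv_add_left
    rconv_chain_funs)

section \<open>Levels zero and one as regular bimodules\<close>

lemma regular_bimodule_simps [simp]:
  "carrier (regular_bimodule R) = carrier R"
  "monoid.mult (regular_bimodule R) = ring.add R"
  "\<one>\<^bsub>regular_bimodule R\<^esub> = \<zero>\<^bsub>R\<^esub>"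
  "lact (regular_bimodule R) = monoid.mult R"
  "ract (regular_bimodule R) = monoid.mult R"
  by (simp_all add: regular_bimodule_def)

lemma group_regular_A: "group (regular_bimodule A)"
proof (rule groupI)
  fix a assume "a \<in> carrier (regular_bimodule A)"
  then show "\<exists>b\<in>carrier (regular_bimodule A). b \<otimes>\<^bsub>regular_bimodule A\<^esub> a = \<one>\<^bsub>regular_bimodule A\<^esub>"
    by (intro bexI[of _ "\<lambda>x. - a x"]) auto
qed auto

lemma group_regular_B: "group (regular_bimodule (A\<lparr>carrier := B\<rparr>))"
proof (rule groupI)
  fix a assume "a \<in> carrier (regular_bimodule (A\<lparr>carrier := B\<rparr>))"
  then show "\<exists>b\<in>carrier (regular_bimodule (A\<lparr>carrier := B\<rparr>)).
      b \<otimes>\<^bsub>regular_bimodule (A\<lparr>carrier := B\<rparr>)\<^esub> a = \<one>\<^bsub>regular_bimodule (A\<lparr>carrier := B\<rparr>)\<^esub>"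
    by (intro bexI[of _ "\<lambda>x. - a x"]) (auto simp: group_algebra_def)
qed (auto simp: group_algebra_def)

text \<open>At level one the single entry of a chain is determined by \<open>g\<close>, so a chain
  function is just a function of \<open>g\<close>.\<close>

lemma regular_A_iso: "bimodule_iso B B (regular_bimodule A) (chain_bimodule 1)"
  unfolding bimodule_iso_def
proof (intro bexI conjI ballI)
  let ?f = "\<lambda>a. tensor_fun [a]"
  have "bij_betw ?f (carrier A) (chain_funs 1)"
  proof (rule bij_betw_byWitness[where f' = "\<lambda>F g. if g \<in> carrier G then F [g \<bullet> \<omega>] g else 0"])
    show "\<forall>F\<in>chain_funs 1. ?f (\<lambda>g. if g \<in> carrier G then F [g \<bullet> \<omega>] g else 0) = F"
    proof
      fix F assume F: "F \<in> chain_funs 1"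
      have "F cs g = 0" if "\<not> (g \<in> carrier G \<and> cs = [g \<bullet> \<omega>])" for cs g
        using that by (intro chain_funsD[OF F]) (auto simp: chains_def length_Suc_conv)
      then show "?f (\<lambda>g. if g \<in> carrier G then F [g \<bullet> \<omega>] g else 0) = F"
        by (auto simp: tensor_fun_singleton fun_eq_iff simp del: tensor_fun.simps)
    qed
    show "?f ` carrier A \<subseteq> chain_funs 1"
      using tensor_fun_in[of "[_]"] by (auto simp del: tensor_fun.simps carrier_A)
  qed (auto simp: tensor_fun_singleton simp del: tensor_fun.simps)
  then show "?f \<in> iso (regular_bimodule A) (chain_bimodule 1)"
    using tensor_fun_add[of "[]" _ _ "[]"]
    by (auto simp: iso_def hom_def bij_betw_def simp del: tensor_fun.simps carrier_A)
  show "?f (lact (regular_bimodule A) r v) = lact (chain_bimodule 1) r (?f v)" for r v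
    by (simp add: conv_mult)
  show "?f (ract (regular_bimodule A) v r) = ract (chain_bimodule 1) (?f v) r"
    if "r \<in> B" "v \<in> carrier (regular_bimodule A)" for r v
    using that tensor_fun_ract[of v r "[]"] by (simp del: tensor_fun.simps carrier_A carrier_B)
qed

text \<open>At level zero the endpoint condition confines \<open>g\<close> to the stabilizer.
  Together with level one this makes depth one the case m = 0 of the comparison of consecutive
  levels.\<close>

lemma regular_B_iso:
  "bimodule_iso B B (regular_bimodule (A\<lparr>carrier := B\<rparr>)) (chain_bimodule 0)"
  unfolding bimodule_iso_def
proof (intro bexI conjI ballI)
  let ?f = "\<lambda>b. conv b (tensor_fun [])"
  have f: "?f b = (\<lambda>cs g. if cs = [] then b g else 0)" if "b \<in> B" for b
  proof (intro ext)
    fix cs g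
    have inv: "inv x \<otimes> g = \<one> \<longleftrightarrow> x = g" if "g \<in> carrier G" "x \<in> carrier G" for x
      using that by (metis inv_equality inv_inv inv_closed l_inv)
    have "b x * tensor_fun [] [] (inv x \<otimes> g) = (if x = g then b g else 0)"
      if "g \<in> carrier G" "x \<in> carrier G" for x
      by (simp add: inv[OF that])
    moreover have "b g = 0" if "g \<notin> carrier G"
      using that \<open>b \<in> B\<close> stabilizer_subset by auto
    ultimately show "?f b cs g = (if cs = [] then b g else 0)"
      using finite_carrier by (simp add: conv_def)
  qed
  have nil: "F [] \<in> B" if "F \<in> chain_funs 0" for F
    unfolding carrier_B using that by (auto simp: chain_funs_def chains_def point_stabilizer_def)
  have "bij_betw ?f B (chain_funs 0)"
  proof (rule bij_betw_byWitness[where f' = "\<lambda>F. F []"])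
    show "\<forall>F\<in>chain_funs 0. ?f (F []) = F"
    proof
      fix F assume F: "F \<in> chain_funs 0"
      then have "F cs g = 0" if "cs \<noteq> []" for cs g
        using that by (auto simp: chain_funs_def chains_def)
      with nil[OF F] show "?f (F []) = F"
        by (auto simp: f fun_eq_iff simp del: tensor_fun.simps carrier_B)
    qed
    show "?f ` B \<subseteq> chain_funs 0"
    proof (rule image_subsetI)
      fix b assume b: "b \<in> B"
      then have "b g = 0" if "g \<notin> point_stabilizer" for g
        using that unfolding carrier_B by blast
      then show "?f b \<in> chain_funs 0"
        unfolding f[OF b] by (auto simp: chain_funs_def chains_def point_stabilizer_def)
    qed
  qed (auto simp: f nil simp del: tensor_fun.simps carrier_B)
  then show "?f \<in> iso (regular_bimodule (A\<lparr>carrier := B\<rparr>)) (chain_bimodule 0)"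
    by (auto simp: iso_def hom_def bij_betw_def conv_add_left group_algebra_def
        simp del: tensor_fun.simps carrier_B)
  show "?f (lact (regular_bimodule (A\<lparr>carrier := B\<rparr>)) r v) = lact (chain_bimodule 0) r (?f v)" for r v
    by (simp add: conv_mult)
  show "?f (ract (regular_bimodule (A\<lparr>carrier := B\<rparr>)) v r) = ract (chain_bimodule 0) (?f v) r"
    if "r \<in> B" for r v
  proof -
    have "r \<in> carrier A" using that B_subset_A by blast
    then show ?thesis
      by (simp add: conv_mult rconv_conv rconv_tensor_fun_Nil del: tensor_fun.simps carrier_A)
  qed
qed

end

section \<open>Tensor powers of the group algebra\<close>

lemma group_same_operations:
  assumes "group M" "carrier N = carrier M" "monoid.mult N = monoid.mult M" "\<one>\<^bsub>N\<^esub> = \<one>\<^bsub>M\<^esub>"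
  shows "group N"
proof -
  interpret M: group M by fact
  show ?thesis
    by (rule groupI) (auto simp: assms(2-4) M.m_assoc intro: M.l_inv_ex)
qed

lemma tensor_power_simps:
  "carrier (tensor_power R S n) = carrier (free_Abelian_group (tuples R n) Mod tensor_kernel R S n)"
  "monoid.mult (tensor_power R S n) = monoid.mult (free_Abelian_group (tuples R n) Mod tensor_kernel R S n)"
  "\<one>\<^bsub>tensor_power R S n\<^esub> = \<one>\<^bsub>free_Abelian_group (tuples R n) Mod tensor_kernel R S n\<^esub>"
  "lact (tensor_power R S n) r C = tensor_kernel R S n <#>\<^bsub>free_Abelian_group (tuples R n)\<^esub>
     frag_extend (\<lambda>xs. frag_of ((r \<otimes>\<^bsub>R\<^esub> hd xs) # tl xs)) ` C"
  "ract (tensor_power R S n) C r = tensor_kernel R S n <#>\<^bsub>free_Abelian_group (tuples R n)\<^esub>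
     frag_extend (\<lambda>xs. frag_of (butlast xs @ [last xs \<otimes>\<^bsub>R\<^esub> r])) ` C"
  by (simp_all add: tensor_power_def monoid.defs Let_def)

definition point_fun :: "complex \<Rightarrow> 'g \<Rightarrow> 'g \<Rightarrow> complex" where
  "point_fun c x = (\<lambda>y. if y = x then c else 0)"

text \<open>A basis tensor with a complex coefficient. The tensor product is built as a mere abelian
  group, so the scalar has to be stored in an entry; the first one is chosen.\<close>

definition pure_tensor :: "complex \<Rightarrow> 'g list \<Rightarrow> ('g \<Rightarrow> complex) list" where
  "pure_tensor c xs = point_fun c (hd xs) # map (point_fun 1) (tl xs)"

context finite_transitive_action
begin

abbreviation Free where "Free m \<equiv> free_Abelian_group (tuples A m)"
abbreviation Ker where "Ker m \<equiv> tensor_kernel A B m"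

definition frag_fun :: "(('g \<Rightarrow> complex) list \<Rightarrow>\<^sub>0 int) \<Rightarrow> 'c list \<Rightarrow> 'g \<Rightarrow> complex" where
  "frag_fun z cs g = (\<Sum>as\<in>Poly_Mapping.keys z. of_int (Poly_Mapping.lookup z as) * tensor_fun as cs g)"

lemma frag_fun_superset:
  assumes "finite T" "Poly_Mapping.keys z \<subseteq> T"
  shows "frag_fun z cs g = (\<Sum>as\<in>T. of_int (Poly_Mapping.lookup z as) * tensor_fun as cs g)"
  unfolding frag_fun_def
  by (rule sum.mono_neutral_left) (use assms in \<open>auto simp: in_keys_iff\<close>)

lemma frag_fun_zero [simp]: "frag_fun 0 = (\<lambda>cs g. 0)"
  by (simp add: frag_fun_def fun_eq_iff)

lemma frag_fun_frag_of [simp]: "frag_fun (frag_of as) = tensor_fun as"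
  by (simp add: frag_fun_def fun_eq_iff)

lemma frag_fun_diff: "frag_fun (y - z) = (\<lambda>cs g. frag_fun y cs g - frag_fun z cs g)"
proof (intro ext)
  fix cs g
  let ?T = "Poly_Mapping.keys y \<union> Poly_Mapping.keys z"
  have "Poly_Mapping.keys (y - z) \<subseteq> ?T"
    by (rule keys_diff)
  then show "frag_fun (y - z) cs g = frag_fun y cs g - frag_fun z cs g"
    by (simp add: frag_fun_superset[of ?T] lookup_minus algebra_simps sum_subtractf)
qed

lemma frag_fun_add: "frag_fun (y + z) = (\<lambda>cs g. frag_fun y cs g + frag_fun z cs g)"
  using frag_fun_diff[of y "0 - z"] frag_fun_diff[of 0 z] by simp

lemma frag_fun_sum: "frag_fun (sum f T) cs g = (\<Sum>i\<in>T. frag_fun (f i) cs g)"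
  by (induction T rule: infinite_finite_induct) (simp_all add: frag_fun_add)

lemma frag_fun_in:
  assumes "z \<in> carrier (Free m)"
  shows "frag_fun z \<in> chain_funs m"
  unfolding chain_funs_def
proof (clarify)
  fix cs g assume "(cs, g) \<notin> chains m"
  then have "tensor_fun as cs g = 0" if "as \<in> Poly_Mapping.keys z" for as
    using that assms tensor_fun_in[of as] by (auto simp: tuples_def chain_funs_def simp del: carrier_A)
  then show "frag_fun z cs g = 0"
    by (simp add: frag_fun_def)
qed

section \<open>The subgroup generated by the relators\<close>

lemma relators_in_Free: "tensor_relators A B m \<subseteq> carrier (Free m)"
proof -
  have *: "Poly_Mapping.keys (frag_of a - frag_of b) \<subseteq> tuples A m"
    if "a \<in> tuples A m" "b \<in> tuples A m" for a b
    using that keys_diff[of "frag_of a" "frag_of b"] by auto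
  have **: "Poly_Mapping.keys (frag_of a - frag_of b - frag_of c) \<subseteq> tuples A m"
    if "a \<in> tuples A m" "b \<in> tuples A m" "c \<in> tuples A m" for a b c
    using that *[of a b] keys_diff[of "frag_of a - frag_of b" "frag_of c"] by auto
  show ?thesis
  proof
    fix z assume "z \<in> tensor_relators A B m"
    then show "z \<in> carrier (Free m)"
      unfolding tensor_relators_def
    proof (elim UnE CollectE exE conjE)
      fix us vs x y b
      assume "z = frag_of (us @ [x \<otimes>\<^bsub>A\<^esub> b, y] @ vs) - frag_of (us @ [x, b \<otimes>\<^bsub>A\<^esub> y] @ vs)"
        and "us @ [x, y] @ vs \<in> tuples A m"
      then show ?thesis
        using *[of "us @ [x \<otimes>\<^bsub>A\<^esub> b, y] @ vs" "us @ [x, b \<otimes>\<^bsub>A\<^esub> y] @ vs"]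
        by (simp add: tuples_def del: carrier_A)
    next
      fix us vs x y
      assume "z = frag_of (us @ [x \<oplus>\<^bsub>A\<^esub> y] @ vs) - frag_of (us @ [x] @ vs) - frag_of (us @ [y] @ vs)"
        and "us @ [x] @ vs \<in> tuples A m" "y \<in> carrier A"
      moreover from this have "x \<oplus>\<^bsub>A\<^esub> y \<in> carrier A"
        by (simp add: tuples_def)
      ultimately show ?thesis
        using **[of "us @ [x \<oplus>\<^bsub>A\<^esub> y] @ vs" "us @ [x] @ vs" "us @ [y] @ vs"]
        by (simp add: tuples_def del: carrier_A add_A)
    qed
  qed
qed

lemma subgroup_Ker: "subgroup (Ker m) (Free m)"
  unfolding tensor_kernel_def
  by (rule group.generate_is_subgroup[OF group_free_Abelian_group relators_in_Free])

lemma Ker_in_Free: "z \<in> Ker m \<Longrightarrow> z \<in> carrier (Free m)"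
  by (rule subsetD[OF subgroup.subset[OF subgroup_Ker]])

lemma Ker_zero: "0 \<in> Ker m"
  using subgroup.one_closed[OF subgroup_Ker, of m] by simp

lemma Ker_add: "y \<in> Ker m \<Longrightarrow> z \<in> Ker m \<Longrightarrow> y + z \<in> Ker m"
  using subgroup.m_closed[OF subgroup_Ker, of y m z] by simp

lemma Ker_minus: "z \<in> Ker m \<Longrightarrow> - z \<in> Ker m"
  using subgroup.m_inv_closed[OF subgroup_Ker, of z m] Ker_in_Free[of z m] by simp

lemma Ker_diff: "y \<in> Ker m \<Longrightarrow> z \<in> Ker m \<Longrightarrow> y - z \<in> Ker m"
  using Ker_add[of y m "- z"] Ker_minus[of z m] by simp

lemma Ker_sum: "(\<And>i. i \<in> I \<Longrightarrow> f i \<in> Ker m) \<Longrightarrow> sum f I \<in> Ker m"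
  by (induction I rule: infinite_finite_induct) (auto simp: Ker_zero Ker_add)

lemma relator_in_Ker: "z \<in> tensor_relators A B m \<Longrightarrow> z \<in> Ker m"
  unfolding tensor_kernel_def by (rule generate.incl)

lemma Ker_additive:
  assumes "us @ [a] @ vs \<in> tuples A m" "b \<in> carrier A"
  shows "frag_of (us @ [\<lambda>x. a x + b x] @ vs) - frag_of (us @ [a] @ vs) - frag_of (us @ [b] @ vs) \<in> Ker m"
  unfolding add_A[symmetric]
  by (rule relator_in_Ker, unfold tensor_relators_def) (use assms in \<open>blast\<close>)

lemma Ker_balanced:
  assumes "us @ [x, y] @ vs \<in> tuples A m" "b \<in> B"
  shows "frag_of (us @ [x \<otimes>\<^bsub>A\<^esub> b, y] @ vs) - frag_of (us @ [x, b \<otimes>\<^bsub>A\<^esub> y] @ vs) \<in> Ker m"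
  by (rule relator_in_Ker, unfold tensor_relators_def)
    (use assms in \<open>blast\<close>)

text \<open>Both kinds of relators have vanishing function, and the elements with this property form
  a subgroup. The converse inclusion, \<open>frag_fun_zero_imp_Ker\<close>, needs a normal form for
  tensors.\<close>

lemma frag_fun_Ker:
  assumes "z \<in> Ker m"
  shows "frag_fun z = (\<lambda>cs g. 0)"
proof -
  let ?N = "{z \<in> carrier (Free m). frag_fun z = (\<lambda>cs g. 0)}"
  have "subgroup ?N (Free m)"
  proof (rule group.subgroupI[OF group_free_Abelian_group])
    show "inv\<^bsub>Free m\<^esub> y \<in> ?N" if "y \<in> ?N" for y
      using that frag_fun_diff[of 0 y] by simp
    show "y \<otimes>\<^bsub>Free m\<^esub> z \<in> ?N" if "y \<in> ?N" "z \<in> ?N" for y z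
      using that keys_add[of y z] by (auto simp: frag_fun_add)
  qed (auto intro: exI[of _ 0])
  moreover have "tensor_relators A B m \<subseteq> ?N"
  proof
    fix z assume z: "z \<in> tensor_relators A B m"
    moreover have "frag_fun z = (\<lambda>cs g. 0)"
      using z unfolding tensor_relators_def
    proof (elim UnE CollectE exE conjE)
      fix us vs x y b
      assume "z = frag_of (us @ [x \<otimes>\<^bsub>A\<^esub> b, y] @ vs) - frag_of (us @ [x, b \<otimes>\<^bsub>A\<^esub> y] @ vs)" "b \<in> B"
      then show ?thesis
        using tensor_fun_balanced[of b us x y vs] by (simp only: frag_fun_diff frag_fun_frag_of diff_self)
    next
      fix us vs x y
      assume "z = frag_of (us @ [x \<oplus>\<^bsub>A\<^esub> y] @ vs) - frag_of (us @ [x] @ vs) - frag_of (us @ [y] @ vs)"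
      then show ?thesis
        by (simp only: frag_fun_diff frag_fun_frag_of add_A tensor_fun_add) simp
    qed
    ultimately show "z \<in> ?N"
      using relators_in_Free by blast
  qed
  ultimately have "Ker m \<subseteq> ?N"
    unfolding tensor_kernel_def
    by (intro group.generate_subgroup_incl[OF group_free_Abelian_group])
  then show ?thesis
    using assms by blast
qed

lemma point_fun_in_A [simp]: "x \<in> carrier G \<Longrightarrow> point_fun c x \<in> carrier A"
  by (auto simp: point_fun_def)

lemma point_fun_in_B [simp]: "x \<in> point_stabilizer \<Longrightarrow> point_fun c x \<in> B"
  unfolding carrier_B by (auto simp: point_fun_def)

lemma point_fun_mult:
  assumes "x \<in> carrier G" "y \<in> carrier G"
  shows "point_fun c x \<otimes>\<^bsub>A\<^esub> point_fun d y = point_fun (c * d) (x \<otimes> y)"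
proof
  fix w
  let ?T = "{(y, z). y \<in> carrier G \<and> z \<in> carrier G \<and> y \<otimes> z = w}"
  have fin: "finite ?T"
    by (rule finite_subset[of _ "carrier G \<times> carrier G"]) (auto simp: finite_carrier)
  have "(point_fun c x \<otimes>\<^bsub>A\<^esub> point_fun d y) w = (\<Sum>p\<in>?T. if p = (x, y) then c * d else 0)"
    unfolding mult_A by (rule sum.cong) (auto simp: point_fun_def split: if_splits)
  also have "\<dots> = point_fun (c * d) (x \<otimes> y) w"
    using fin assms by (simp add: point_fun_def)
  finally show "(point_fun c x \<otimes>\<^bsub>A\<^esub> point_fun d y) w = point_fun (c * d) (x \<otimes> y) w" .
qed

text \<open>The additivity relator with both summands zero is minus the tuple with a zero
  entry.\<close>

lemma Ker_zero_entry:
  assumes "us @ [a] @ vs \<in> tuples A m"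
  shows "frag_of (us @ [\<lambda>x. 0] @ vs) \<in> Ker m"
proof -
  have "us @ [\<lambda>x. 0] @ vs \<in> tuples A m"
    using assms by (auto simp: tuples_def)
  then have "- frag_of (us @ [\<lambda>x. 0] @ vs) \<in> Ker m"
    using Ker_additive[of us "\<lambda>x. 0" vs m "\<lambda>x. 0"] by simp
  then show ?thesis
    using Ker_minus by fastforce
qed

text \<open>\<open>D\<close> stands for a subgroup above the kernel. Modulo the kernel an entry is
  the sum of its finitely many point functions, which are split off one at a time.\<close>

lemma frag_of_entry_span:
  assumes D0: "0 \<in> D" and Dd: "\<And>y z. y \<in> D \<Longrightarrow> z \<in> D \<Longrightarrow> y - z \<in> D" and KD: "Ker m \<subseteq> D"
    and as: "us @ [a] @ vs \<in> tuples A m"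
    and pt: "\<And>c x. x \<in> carrier G \<Longrightarrow> frag_of (us @ [point_fun c x] @ vs) \<in> D"
  shows "frag_of (us @ [a] @ vs) \<in> D"
proof -
  have Da: "y + z \<in> D" if "y \<in> D" "z \<in> D" for y z
    using Dd[OF that(1) Dd[OF D0 that(2)]] by simp
  have "frag_of (us @ [\<lambda>y. if y \<in> T then a y else 0] @ vs) \<in> D" if "T \<subseteq> carrier G" for T
    using finite_subset[OF that finite_carrier] that
  proof (induction T rule: finite_induct)
    case empty
    show ?case
      using Ker_zero_entry[OF as] KD by auto
  next
    case (insert x T)
    let ?b = "\<lambda>y. if y \<in> T then a y else 0"
    have eq: "(\<lambda>y. if y \<in> insert x T then a y else 0) = (\<lambda>y. point_fun (a x) x y + ?b y)"
      using insert by (auto simp: point_fun_def fun_eq_iff)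
    have "frag_of (us @ [\<lambda>y. point_fun (a x) x y + ?b y] @ vs)
        - frag_of (us @ [point_fun (a x) x] @ vs) - frag_of (us @ [?b] @ vs) \<in> D"
    proof (intro subsetD[OF KD] Ker_additive)
      show "us @ [point_fun (a x) x] @ vs \<in> tuples A m"
        using as insert(4) by (simp add: tuples_def del: carrier_A)
      show "?b \<in> carrier A"
        using insert(4) by auto
    qed
    moreover have "frag_of (us @ [point_fun (a x) x] @ vs) \<in> D" "frag_of (us @ [?b] @ vs) \<in> D"
      using insert pt by auto
    ultimately have "(frag_of (us @ [\<lambda>y. point_fun (a x) x y + ?b y] @ vs)
        - frag_of (us @ [point_fun (a x) x] @ vs) - frag_of (us @ [?b] @ vs))
        + (frag_of (us @ [?b] @ vs) + frag_of (us @ [point_fun (a x) x] @ vs)) \<in> D"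
      by (intro Da)
    then have "frag_of (us @ [\<lambda>y. point_fun (a x) x y + ?b y] @ vs) \<in> D"
      by (simp add: algebra_simps)
    then show ?case
      by (simp only: eq)
  qed
  from this[of "carrier G"] have "frag_of (us @ [\<lambda>y. if y \<in> carrier G then a y else 0] @ vs) \<in> D"
    by simp
  moreover have "(\<lambda>y. if y \<in> carrier G then a y else 0) = a"
    using as by (auto simp: tuples_def fun_eq_iff)
  ultimately show ?thesis
    by (simp only:)
qed

text \<open>Entries are expanded from the right. The coefficient of a point function is passed to
  its left neighbour as a multiple of the neutral element, which lies in the stabilizer; the
  surviving coefficient thus ends up in the first entry, as in \<open>pure_tensor\<close>.\<close>

lemma tuples_span:
  assumes D0: "0 \<in> D" and Dd: "\<And>y z. y \<in> D \<Longrightarrow> z \<in> D \<Longrightarrow> y - z \<in> D" and KD: "Ker m \<subseteq> D"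
    and pure: "\<And>c xs. length xs = m \<Longrightarrow> set xs \<subseteq> carrier G \<Longrightarrow> frag_of (pure_tensor c xs) \<in> D"
    and m: "m > 0" and as: "as \<in> tuples A m"
  shows "frag_of as \<in> D"
proof -
  have Da: "y + z \<in> D" if "y \<in> D" "z \<in> D" for y z
    using Dd[OF that(1) Dd[OF D0 that(2)]] by simp
  \<comment> \<open>Generalized for the induction: \<open>ys\<close> is the tail already reduced,
    \<open>a\<close> the rightmost entry still arbitrary.\<close>
  have "frag_of (us @ [a] @ map (point_fun 1) ys) \<in> D"
    if "us @ [a] @ map (point_fun 1) ys \<in> tuples A m" "set ys \<subseteq> carrier G" for us a ys
    using that
  proof (induction us arbitrary: a ys rule: rev_induct)
    case Nil
    show ?case
    proof (rule frag_of_entry_span[OF D0 Dd KD Nil(1)])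
      fix c x assume "x \<in> carrier G"
      then show "frag_of ([] @ [point_fun c x] @ map (point_fun 1) ys) \<in> D"
        using pure[of "x # ys" c] Nil by (simp add: pure_tensor_def tuples_def)
    qed
  next
    case (snoc a' us)
    show ?case
    proof (rule frag_of_entry_span[OF D0 Dd KD snoc(2)])
      fix c x assume x: "x \<in> carrier G"
      let ?vs = "map (point_fun 1) ys"
      have t: "us @ [a', point_fun 1 x] @ ?vs \<in> tuples A m"
        using snoc(2) x by (simp add: tuples_def del: carrier_A)
      then have "frag_of (us @ [a' \<otimes>\<^bsub>A\<^esub> point_fun c \<one>, point_fun 1 x] @ ?vs)
          - frag_of (us @ [a', point_fun c \<one> \<otimes>\<^bsub>A\<^esub> point_fun 1 x] @ ?vs) \<in> D"
        by (intro subsetD[OF KD] Ker_balanced)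
          (auto simp del: carrier_B intro!: point_fun_in_B subgroup.one_closed[OF subgroup_stabilizer])
      moreover have "frag_of (us @ [a' \<otimes>\<^bsub>A\<^esub> point_fun c \<one>] @ map (point_fun 1) (x # ys)) \<in> D"
        using snoc(2,3) x by (intro snoc(1)) (auto simp: tuples_def simp del: carrier_A)
      then have "frag_of (us @ [a' \<otimes>\<^bsub>A\<^esub> point_fun c \<one>, point_fun 1 x] @ ?vs) \<in> D"
        by simp
      ultimately have "frag_of (us @ [a' \<otimes>\<^bsub>A\<^esub> point_fun c \<one>, point_fun 1 x] @ ?vs)
          - (frag_of (us @ [a' \<otimes>\<^bsub>A\<^esub> point_fun c \<one>, point_fun 1 x] @ ?vs)
            - frag_of (us @ [a', point_fun c \<one> \<otimes>\<^bsub>A\<^esub> point_fun 1 x] @ ?vs)) \<in> D"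
        by (rule Dd[rotated])
      then have "frag_of (us @ [a', point_fun c \<one> \<otimes>\<^bsub>A\<^esub> point_fun 1 x] @ ?vs) \<in> D"
        by (simp add: algebra_simps)
      then show "frag_of ((us @ [a']) @ [point_fun c x] @ ?vs) \<in> D"
        using x by (simp add: point_fun_mult)
    qed
  qed
  from this[of "butlast as" "last as" "[]"] show ?thesis
    using m as by (cases as rule: rev_cases) (auto simp: tuples_def simp del: carrier_A)
qed

section \<open>Chains of tuples of group elements\<close>

definition chain_act :: "'g \<Rightarrow> 'c list \<times> 'g \<Rightarrow> 'c list \<times> 'g" where
  "chain_act x = (\<lambda>(cs, g). (map ((\<bullet>) x) cs, x \<otimes> g))"

primrec chain_of :: "'g list \<Rightarrow> 'c list \<times> 'g" where
  "chain_of [] = ([], \<one>)"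
| "chain_of (x # xs) = chain_act x (\<omega> # fst (chain_of xs), snd (chain_of xs))"

lemma chain_of_valid:
  "set xs \<subseteq> carrier G \<Longrightarrow> set (fst (chain_of xs)) \<subseteq> \<Omega> \<and> snd (chain_of xs) \<in> carrier G"
  by (induction xs) (auto simp: chain_act_def act_closed point_in)

lemma chain_of_in_chains:
  assumes "set xs \<subseteq> carrier G"
  shows "chain_of xs \<in> chains (length xs)"
  using assms
proof (induction xs)
  case Nil
  show ?case by (simp add: chains_def one_act point_in)
next
  case (Cons x xs)
  obtain cs g where P: "chain_of xs = (cs, g)"
    by (cases "chain_of xs")
  have "(cs, g) \<in> chains (length xs)"
    using Cons.IH Cons.prems by (simp add: P)
  then have "(\<omega> # cs, g) \<in> chains (Suc (length xs))"
    by (auto simp: chains_def point_in)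
  moreover have "x \<in> carrier G"
    using Cons.prems by simp
  ultimately have "(map ((\<bullet>) x) (\<omega> # cs), x \<otimes> g) \<in> chains (Suc (length xs))"
    by (intro chains_act) auto
  then show ?case
    by (simp add: P chain_act_def)
qed

lemma chain_act_mult:
  assumes "x \<in> carrier G" "y \<in> carrier G" "set (fst P) \<subseteq> \<Omega>" "snd P \<in> carrier G"
  shows "chain_act (x \<otimes> y) P = chain_act x (chain_act y P)"
  using assms map_act_mult[of x y "fst P"] by (cases P) (simp add: chain_act_def m_assoc)

lemma chain_act_cancel:
  assumes "x \<in> carrier G" "set (fst P) \<subseteq> \<Omega>" "snd P \<in> carrier G" "set (fst Q) \<subseteq> \<Omega>" "snd Q \<in> carrier G"
    and "chain_act x P = chain_act x Q"
  shows "P = Q"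
proof -
  have "chain_act (inv x) (chain_act x P) = chain_act (inv x) (chain_act x Q)"
    using assms by simp
  then have "chain_act \<one> P = chain_act \<one> Q"
    using assms chain_act_mult[of "inv x" x] by simp
  then show ?thesis
    using assms by (cases P, cases Q) (simp add: chain_act_def map_act_one)
qed

text \<open>The first factor may be any element carrying \<omega> to the first point; translating
  the rest by its inverse leaves a shorter chain. Once a single point remains, the factor must be
  the remaining group element itself.\<close>

lemma chain_of_surj:
  assumes "(cs, g) \<in> chains m" "m > 0"
  shows "\<exists>xs. length xs = m \<and> set xs \<subseteq> carrier G \<and> chain_of xs = (cs, g)"
  using assms
proof (induction m arbitrary: cs g)
  case (Suc n)
  then obtain c ds where c: "cs = c # ds"
    by (cases cs) (auto simp: chains_def)
  show ?case
  proof (cases "ds = []")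
    case True
    then show ?thesis
      using Suc(2) c by (intro exI[of _ "[g]"]) (auto simp: chains_def chain_act_def)
  next
    case False
    obtain x where x: "x \<in> carrier G" "x \<bullet> \<omega> = c"
      using Suc(2) transitive[of c] c by (auto simp: chains_def)
    have ds: "(ds, g) \<in> chains n" and n: "n > 0"
      using Suc(2) False c by (auto simp: chains_def)
    have "(map ((\<bullet>) (inv x)) ds, inv x \<otimes> g) \<in> chains n"
      using chains_act[of "inv x" ds g n] ds n x by simp
    then obtain xs where xs: "length xs = n" "set xs \<subseteq> carrier G"
        "chain_of xs = (map ((\<bullet>) (inv x)) ds, inv x \<otimes> g)"
      using Suc(1) n by blast
    have "map ((\<bullet>) x) (map ((\<bullet>) (inv x)) ds) = ds"
      using x ds map_act_inv_iff[of x ds "map ((\<bullet>) (inv x)) ds"] set_map_act[of "inv x" ds]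
      by (auto simp: chains_def)
    then have "chain_of (x # xs) = (cs, g)"
      using x ds xs c by (simp add: chain_act_def chains_def flip: m_assoc)
    then show ?thesis
      using xs x by (intro exI[of _ "x # xs"]) auto
  qed
qed simp

lemma conv_point_fun:
  assumes "x \<in> carrier G"
  shows "conv (point_fun c x) F = (\<lambda>cs g. if set cs \<subseteq> \<Omega> \<and> g \<in> carrier G
    then c * F (map ((\<bullet>) (inv x)) cs) (inv x \<otimes> g) else 0)"
  using assms finite_carrier
  by (simp add: conv_def point_fun_def fun_eq_iff if_distrib[of "\<lambda>x. x * _"] cong: if_cong)

lemma conv_point_fun_chain:
  assumes "x \<in> carrier G" "set (fst P) \<subseteq> \<Omega>" "snd P \<in> carrier G"
  shows "conv (point_fun c x) (\<lambda>cs g. if (cs, g) = P then 1 else 0)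
    = (\<lambda>cs g. if (cs, g) = chain_act x P then c else 0)"
proof (intro ext)
  fix cs g
  obtain ds h where P: "P = (ds, h)" by fastforce
  show "conv (point_fun c x) (\<lambda>cs g. if (cs, g) = P then 1 else 0) cs g
    = (if (cs, g) = chain_act x P then c else 0)"
  proof (cases "set cs \<subseteq> \<Omega> \<and> g \<in> carrier G")
    case True
    then have "map ((\<bullet>) (inv x)) cs = ds \<longleftrightarrow> cs = map ((\<bullet>) x) ds"
      using assms by (intro map_act_inv_iff) (auto simp: P)
    moreover have "inv x \<otimes> g = h \<longleftrightarrow> g = x \<otimes> h"
      using True assms by (auto simp: P inv_solve_left')
    ultimately show ?thesis
      using True assms(1) by (auto simp: conv_point_fun P chain_act_def)
  next
    case False
    have "(cs, g) \<noteq> chain_act x P"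
    proof
      assume "(cs, g) = chain_act x P"
      then have "cs = map ((\<bullet>) x) ds" "g = x \<otimes> h"
        by (auto simp: P chain_act_def)
      then show False
        using False assms set_map_act[of x ds] by (simp add: P)
    qed
    then show ?thesis
      using False by (simp only: conv_point_fun[OF assms(1)] if_False)
  qed
qed

lemma lift_chain:
  "lift (\<lambda>cs g. if (cs, g) = P then 1 else 0) = (\<lambda>cs g. if (cs, g) = (\<omega> # fst P, snd P) then 1 else 0)"
  by (auto simp: lift_def fun_eq_iff split: list.split)

lemma tensor_fun_point_funs:
  assumes "set xs \<subseteq> carrier G"
  shows "tensor_fun (map (point_fun 1) xs) = (\<lambda>cs g. if (cs, g) = chain_of xs then 1 else 0)"
  using assms
proof (induction xs)
  case (Cons x xs)
  have "set (fst (chain_of xs)) \<subseteq> \<Omega>" "snd (chain_of xs) \<in> carrier G"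
    using chain_of_valid[of xs] Cons by auto
  then show ?case
    using Cons conv_point_fun_chain[of x "(\<omega> # fst (chain_of xs), snd (chain_of xs))" 1]
    by (simp add: lift_chain point_in)
qed (simp add: fun_eq_iff)

lemma tensor_fun_pure:
  assumes "set xs \<subseteq> carrier G" "xs \<noteq> []"
  shows "tensor_fun (pure_tensor c xs) = (\<lambda>cs g. if (cs, g) = chain_of xs then c else 0)"
proof -
  obtain x ys where xs: "xs = x # ys"
    using assms by (cases xs) auto
  have "set (fst (chain_of ys)) \<subseteq> \<Omega>" "snd (chain_of ys) \<in> carrier G"
    using chain_of_valid[of ys] assms xs by auto
  then show ?thesis
    using assms conv_point_fun_chain[of x "(\<omega> # fst (chain_of ys), snd (chain_of ys))" c]
    by (simp add: lift_chain point_in tensor_fun_point_funs xs pure_tensor_def)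
qed

lemma pure_tensor_tuple:
  "set xs \<subseteq> carrier G \<Longrightarrow> xs \<noteq> [] \<Longrightarrow> pure_tensor c xs \<in> tuples A (length xs)"
  by (cases xs) (auto simp: pure_tensor_def tuples_def simp del: carrier_A)

text \<open>
  Tuples with the same partial products modulo \<open>H\<close> differ by moving elements of \<open>H\<close> across
  the tensor signs.
\<close>

lemma chain_of_eq_Ker:
  assumes "chain_of (x # xs) = chain_of (y # ys)" "length xs = length ys"
    and "x \<in> carrier G" "y \<in> carrier G" "set xs \<subseteq> carrier G" "set ys \<subseteq> carrier G"
    and "set us \<subseteq> carrier A"
    and "m = length us + Suc (length xs)"
  shows "frag_of (us @ pure_tensor c (x # xs)) - frag_of (us @ pure_tensor c (y # ys)) \<in> Ker m"
  using assms
proof (induction xs arbitrary: x y ys us c)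
  case Nil
  then have "x = y" by (simp add: chain_act_def)
  then show ?case
    using Nil by (simp add: Ker_zero)
next
  case (Cons x2 xs)
  obtain y2 ys' where ys: "ys = y2 # ys'"
    using Cons(3) by (cases ys) auto
  let ?P = "chain_of (x2 # xs)" and ?Q = "chain_of (y2 # ys')"
  \<comment> \<open>The first points agree, so \<open>h\<close> lies in the stabilizer and (y, y2,
    ...) equals (x, h y2, ...) modulo the kernel. The tails are then compared by induction, with
    \<open>x\<close> moved into \<open>us\<close>.\<close>
  define h where "h = inv x \<otimes> y"
  have eq: "chain_act x (\<omega> # fst ?P, snd ?P) = chain_act y (\<omega> # fst ?Q, snd ?Q)"
    using Cons(2) ys by (simp only: chain_of.simps)
  have carr: "x \<in> carrier G" "y \<in> carrier G" "x2 \<in> carrier G" "y2 \<in> carrier G"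
    using Cons.prems ys by auto
  have "x \<bullet> \<omega> = y \<bullet> \<omega>"
    using eq by (simp add: chain_act_def split: prod.splits)
  then have h: "h \<in> point_stabilizer" and hc: "h \<in> carrier G"
    using carr by (auto simp: h_def stabilizer_image_eq)
  have xh: "x \<otimes> h = y"
    using carr by (simp add: h_def flip: m_assoc)
  have vP: "set (fst ?P) \<subseteq> \<Omega>" "snd ?P \<in> carrier G"
    and vQ: "set (fst ?Q) \<subseteq> \<Omega>" "snd ?Q \<in> carrier G"
    using chain_of_valid[of "x2 # xs"] chain_of_valid[of "y2 # ys'"] Cons.prems ys by auto
  have "chain_act x ?P = chain_act y ?Q"
    using eq by (auto simp: chain_act_def split: prod.splits simp del: chain_of.simps)
  then have "chain_act x ?P = chain_act x (chain_act h ?Q)"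
    using chain_act_mult[of x h ?Q] carr hc vQ xh by simp
  moreover have "set (fst (chain_act h ?Q)) \<subseteq> \<Omega>" "snd (chain_act h ?Q) \<in> carrier G"
    using vQ hc by (auto simp: chain_act_def act_closed split: prod.splits)
  ultimately have "?P = chain_act h ?Q"
    using chain_act_cancel[of x ?P "chain_act h ?Q"] carr vP by blast
  also have "\<dots> = chain_of (h \<otimes> y2 # ys')"
    using chain_act_mult[of h y2 "(\<omega> # fst (chain_of ys'), snd (chain_of ys'))"] hc carr
      chain_of_valid[of ys'] Cons.prems ys point_in by simp
  finally have PQ: "?P = chain_of (h \<otimes> y2 # ys')" .
  let ?us = "us @ [point_fun c x]" and ?vs = "map (point_fun 1) ys'"
  have "frag_of (?us @ pure_tensor 1 (x2 # xs)) - frag_of (?us @ pure_tensor 1 (h \<otimes> y2 # ys')) \<in> Ker m"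
    by (rule Cons.IH[OF PQ]) (use Cons.prems ys hc carr in \<open>auto simp del: carrier_A\<close>)
  moreover have "frag_of (us @ [point_fun c x \<otimes>\<^bsub>A\<^esub> point_fun 1 h, point_fun 1 y2] @ ?vs)
      - frag_of (us @ [point_fun c x, point_fun 1 h \<otimes>\<^bsub>A\<^esub> point_fun 1 y2] @ ?vs) \<in> Ker m"
    using Cons.prems ys carr h
    by (intro Ker_balanced point_fun_in_B) (auto simp: tuples_def simp del: carrier_A)
  then have "frag_of (us @ pure_tensor c (y # ys)) - frag_of (?us @ pure_tensor 1 (h \<otimes> y2 # ys')) \<in> Ker m"
    using carr hc by (simp add: point_fun_mult xh ys pure_tensor_def)
  ultimately have "(frag_of (?us @ pure_tensor 1 (x2 # xs)) - frag_of (?us @ pure_tensor 1 (h \<otimes> y2 # ys')))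
      - (frag_of (us @ pure_tensor c (y # ys)) - frag_of (?us @ pure_tensor 1 (h \<otimes> y2 # ys'))) \<in> Ker m"
    by (rule Ker_diff)
  then show ?case
    by (simp add: pure_tensor_def)
qed

section \<open>Formal sums with vanishing function lie in the kernel\<close>

lemma finite_points: "finite \<Omega>"
proof (rule finite_subset)
  show "\<Omega> \<subseteq> (\<lambda>x. x \<bullet> \<omega>) ` carrier G"
    using transitive by blast
qed (simp add: finite_carrier)

lemma finite_chains: "finite (chains m)"
proof (rule finite_subset)
  show "chains m \<subseteq> {cs. set cs \<subseteq> \<Omega> \<and> length cs = m} \<times> carrier G"
    by (auto simp: chains_def)
qed (simp add: finite_lists_length_eq finite_points finite_carrier)

definition chain_rep :: "nat \<Rightarrow> 'c list \<times> 'g \<Rightarrow> 'g list" where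
  "chain_rep m P = (SOME xs. length xs = m \<and> set xs \<subseteq> carrier G \<and> chain_of xs = P)"

lemma chain_rep:
  assumes "P \<in> chains m" "m > 0"
  shows "length (chain_rep m P) = m" "set (chain_rep m P) \<subseteq> carrier G" "chain_of (chain_rep m P) = P"
  using someI_ex[OF chain_of_surj[of "fst P" "snd P" m]] assms by (auto simp: chain_rep_def)

text \<open>A section of \<open>frag_fun\<close>: one chosen basis tensor for each chain, carrying
  the value there as coefficient. It is additive only modulo the kernel.\<close>

definition chain_frag :: "nat \<Rightarrow> ('c list \<Rightarrow> 'g \<Rightarrow> complex) \<Rightarrow> ('g \<Rightarrow> complex) list \<Rightarrow>\<^sub>0 int" where
  "chain_frag m F = (\<Sum>P\<in>chains m. frag_of (pure_tensor (F (fst P) (snd P)) (chain_rep m P)))"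

lemma chain_frag_in: "m > 0 \<Longrightarrow> chain_frag m F \<in> carrier (Free m)"
  unfolding chain_frag_def
  using chain_rep[of _ m] pure_tensor_tuple
  by (intro sum_closed_free_Abelian_group) (metis frag_of_in_free_Abelian_group length_0_conv less_numeral_extra(3))

lemma frag_fun_chain_frag:
  assumes "m > 0" "F \<in> chain_funs m"
  shows "frag_fun (chain_frag m F) = F"
proof (intro ext)
  fix cs g
  have "frag_fun (chain_frag m F) cs g = (\<Sum>P\<in>chains m. tensor_fun (pure_tensor (F (fst P) (snd P)) (chain_rep m P)) cs g)"
    by (simp add: chain_frag_def frag_fun_sum)
  also have "\<dots> = (\<Sum>P\<in>chains m. if (cs, g) = P then F cs g else 0)"
  proof (intro sum.cong refl)
    fix P assume P: "P \<in> chains m"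
    then have "chain_rep m P \<noteq> []"
      using chain_rep(1)[OF P] assms(1) by auto
    then show "tensor_fun (pure_tensor (F (fst P) (snd P)) (chain_rep m P)) cs g = (if (cs, g) = P then F cs g else 0)"
      using chain_rep[OF P assms(1)] by (auto simp: tensor_fun_pure)
  qed
  also have "\<dots> = F cs g"
    using finite_chains[of m] chain_funsD[OF assms(2), of cs g] by simp
  finally show "frag_fun (chain_frag m F) cs g = F cs g" .
qed

lemma pure_tensor_zero_Ker:
  assumes "set xs \<subseteq> carrier G" "xs \<noteq> []"
  shows "frag_of (pure_tensor 0 xs) \<in> Ker (length xs)"
  using Ker_zero_entry[of "[]" "point_fun 0 (hd xs)" "map (point_fun 1) (tl xs)" "length xs"]
    pure_tensor_tuple[OF assms, of 0]
  by (simp add: pure_tensor_def point_fun_def)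

lemma pure_tensor_diff_Ker:
  assumes "set xs \<subseteq> carrier G" "xs \<noteq> []"
  shows "frag_of (pure_tensor (c - d) xs) - (frag_of (pure_tensor c xs) - frag_of (pure_tensor d xs))
    \<in> Ker (length xs)"
proof -
  let ?x = "hd xs" and ?vs = "map (point_fun 1) (tl xs)"
  have "(\<lambda>y. point_fun (c - d) ?x y + point_fun d ?x y) = point_fun c ?x"
    by (auto simp: point_fun_def)
  moreover have "frag_of ([] @ [\<lambda>y. point_fun (c - d) ?x y + point_fun d ?x y] @ ?vs)
     - frag_of ([] @ [point_fun (c - d) ?x] @ ?vs) - frag_of ([] @ [point_fun d ?x] @ ?vs) \<in> Ker (length xs)"
    using pure_tensor_tuple[OF assms, of "c - d"] assms
    by (intro Ker_additive) (auto simp: pure_tensor_def intro!: point_fun_in_A simp del: carrier_A)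
  ultimately have "frag_of (pure_tensor c xs) - frag_of (pure_tensor (c - d) xs) - frag_of (pure_tensor d xs) \<in> Ker (length xs)"
    by (simp add: pure_tensor_def)
  then show ?thesis
    using Ker_minus by (fastforce simp: algebra_simps)
qed

lemma chain_rep_Ker:
  assumes "P \<in> chains m" "m > 0"
  shows "frag_of (pure_tensor 0 (chain_rep m P)) \<in> Ker m"
    and "frag_of (pure_tensor (c - d) (chain_rep m P))
      - (frag_of (pure_tensor c (chain_rep m P)) - frag_of (pure_tensor d (chain_rep m P))) \<in> Ker m"
proof -
  have rep: "set (chain_rep m P) \<subseteq> carrier G" "chain_rep m P \<noteq> []" "length (chain_rep m P) = m"
    using chain_rep[OF assms] assms(2) by auto
  show "frag_of (pure_tensor 0 (chain_rep m P)) \<in> Ker m"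
    using pure_tensor_zero_Ker[OF rep(1,2)] by (simp only: rep(3))
  show "frag_of (pure_tensor (c - d) (chain_rep m P))
      - (frag_of (pure_tensor c (chain_rep m P)) - frag_of (pure_tensor d (chain_rep m P))) \<in> Ker m"
    using pure_tensor_diff_Ker[OF rep(1,2), of c d] by (simp only: rep(3))
qed

text \<open>The elements congruent to the section of their own function form a subgroup
  \<open>D\<close> that contains the kernel and all basis tensors, hence everything. For the zero
  function the section itself lies in the kernel.\<close>

lemma frag_fun_zero_imp_Ker:
  assumes m: "m > 0" and z: "z \<in> carrier (Free m)" and z0: "frag_fun z = (\<lambda>cs g. 0)"
  shows "z \<in> Ker m"
proof -
  define D where "D = {z \<in> carrier (Free m). z - chain_frag m (frag_fun z) \<in> Ker m}"
  have zero: "chain_frag m (\<lambda>cs g. 0) \<in> Ker m"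
    unfolding chain_frag_def by (intro Ker_sum chain_rep_Ker m)
  have D0: "0 \<in> D"
    using Ker_minus[OF zero] by (simp add: D_def)
  have Dd: "y - z \<in> D" if "y \<in> D" "z \<in> D" for y z
  proof -
    let ?f = "chain_frag m (frag_fun (y - z)) - (chain_frag m (frag_fun y) - chain_frag m (frag_fun z))"
    have "?f \<in> Ker m"
      unfolding chain_frag_def frag_fun_diff sum_subtractf[symmetric]
      by (intro Ker_sum chain_rep_Ker m)
    moreover have "(y - chain_frag m (frag_fun y)) - (z - chain_frag m (frag_fun z)) \<in> Ker m"
      using that Ker_diff[of "y - chain_frag m (frag_fun y)" m "z - chain_frag m (frag_fun z)"]
      by (simp only: D_def mem_Collect_eq)
    ultimately have "((y - chain_frag m (frag_fun y)) - (z - chain_frag m (frag_fun z))) - ?f \<in> Ker m"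
      by (rule Ker_diff[rotated])
    moreover have "y - z \<in> carrier (Free m)"
      using that keys_diff[of y z] by (auto simp: D_def)
    ultimately show ?thesis
      by (simp add: D_def)
  qed
  have KD: "Ker m \<subseteq> D"
  proof
    fix z assume z: "z \<in> Ker m"
    then show "z \<in> D"
      using Ker_in_Free[OF z] Ker_diff[OF z zero] by (simp only: D_def frag_fun_Ker mem_Collect_eq)
  qed
  have pure: "frag_of (pure_tensor c xs) \<in> D" if xs: "length xs = m" "set xs \<subseteq> carrier G" for c xs
  proof -
    have ne: "xs \<noteq> []" using xs m by auto
    let ?P = "chain_of xs" and ?F = "\<lambda>cs g. if (cs, g) = chain_of xs then c else 0"
    let ?t = "\<lambda>P. frag_of (pure_tensor (?F (fst P) (snd P)) (chain_rep m P))"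
    have P: "?P \<in> chains m"
      using chain_of_in_chains[of xs] xs by simp
    have sum: "chain_frag m ?F = ?t ?P + sum ?t (chains m - {?P})"
      unfolding chain_frag_def by (rule sum.remove[OF finite_chains P])
    \<comment> \<open>The other chains contribute basis tensors with coefficient zero. These are
      generators of the free group, not its zero, so they have to be discarded through the
      kernel.\<close>
    have rest: "sum ?t (chains m - {?P}) \<in> Ker m"
    proof (rule Ker_sum)
      fix Q assume Q: "Q \<in> chains m - {?P}"
      then have "?F (fst Q) (snd Q) = 0"
        by simp
      then show "?t Q \<in> Ker m"
        using chain_rep_Ker(1)[of Q m] m Q by (simp only: Diff_iff)
    qed
    \<comment> \<open>The representative chosen for the chain of \<open>xs\<close> need not be
      \<open>xs\<close>, but it has the same chain.\<close>
    have main: "frag_of (pure_tensor c xs) - ?t ?P \<in> Ker m"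
    proof -
      obtain x xs' where x: "xs = x # xs'"
        using ne by (cases xs) auto
      have "chain_rep m ?P \<noteq> []"
        using chain_rep(1)[OF P m] m by auto
      then obtain y ys where y: "chain_rep m ?P = y # ys"
        by (cases "chain_rep m ?P") auto
      have len: "length (y # ys) = m" and ys: "set (y # ys) \<subseteq> carrier G"
        and eq: "chain_of (x # xs') = chain_of (y # ys)"
        using chain_rep[OF P m] unfolding y by (simp_all only: x[symmetric])
      have "frag_of ([] @ pure_tensor c (x # xs')) - frag_of ([] @ pure_tensor c (y # ys)) \<in> Ker m"
        by (rule chain_of_eq_Ker[OF eq]) (use len ys xs x in simp_all)
      then show ?thesis
        by (simp only: x[symmetric] y[symmetric] append_Nil prod.collapse simp_thms if_True)
    qed
    have "frag_of (pure_tensor c xs) - chain_frag m ?F \<in> Ker m"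
      using Ker_diff[OF main rest] by (simp only: sum diff_diff_add)
    moreover have "frag_of (pure_tensor c xs) \<in> carrier (Free m)"
      using pure_tensor_tuple[OF xs(2) ne, of c] xs(1) by simp
    ultimately show ?thesis
      by (simp only: D_def mem_Collect_eq frag_fun_frag_of tensor_fun_pure[OF xs(2) ne] simp_thms)
  qed
  have "z \<in> D"
  proof (rule free_Abelian_group_induct[where P = "\<lambda>z. z \<in> D"])
    show "Poly_Mapping.keys z \<subseteq> tuples A m"
      using z by simp
    show "frag_of as \<in> D" if "as \<in> tuples A m" for as
      by (rule tuples_span[OF D0 Dd KD pure m that])
  qed (fact D0, rule Dd)
  then have "z - chain_frag m (\<lambda>cs g. 0) \<in> Ker m"
    by (simp add: D_def z0)
  from Ker_add[OF this zero] show ?thesis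
    by simp
qed

section \<open>Cosets of the kernel and the isomorphism with chain functions\<close>

definition fiber :: "nat \<Rightarrow> ('c list \<Rightarrow> 'g \<Rightarrow> complex) \<Rightarrow> (('g \<Rightarrow> complex) list \<Rightarrow>\<^sub>0 int) set" where
  "fiber m F = {z \<in> carrier (Free m). frag_fun z = F}"

lemma Ker_iff:
  "m > 0 \<Longrightarrow> z \<in> Ker m \<longleftrightarrow> z \<in> carrier (Free m) \<and> frag_fun z = (\<lambda>cs g. 0)"
  using frag_fun_zero_imp_Ker[of m z] frag_fun_Ker[of z m] Ker_in_Free[of z m] by blast

lemma Free_diff: "y \<in> carrier (Free m) \<Longrightarrow> z \<in> carrier (Free m) \<Longrightarrow> y - z \<in> carrier (Free m)"
  using keys_diff[of y z] by auto

lemma Free_add: "y \<in> carrier (Free m) \<Longrightarrow> z \<in> carrier (Free m) \<Longrightarrow> y + z \<in> carrier (Free m)"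
  using keys_add[of y z] by auto

text \<open>The actions on cosets add the kernel to the image of a coset. That image may be only
  part of a coset, but adding the kernel to a nonempty part fills up the whole.\<close>

lemma Ker_set_mult:
  assumes m: "m > 0" and z: "z \<in> Z" and Z: "Z \<subseteq> fiber m F"
  shows "Ker m <#>\<^bsub>Free m\<^esub> Z = fiber m F"
proof
  show "Ker m <#>\<^bsub>Free m\<^esub> Z \<subseteq> fiber m F"
  proof
    fix w assume "w \<in> Ker m <#>\<^bsub>Free m\<^esub> Z"
    then obtain k y where w: "w = k + y" and k: "k \<in> Ker m" and y: "y \<in> Z"
      by (auto simp: set_mult_def)
    have "k \<in> carrier (Free m)" "frag_fun k = (\<lambda>cs g. 0)" "y \<in> carrier (Free m)" "frag_fun y = F"
      using Ker_iff[OF m] k y Z by (auto simp: fiber_def)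
    then show "w \<in> fiber m F"
      using Free_add[of k m y] by (simp add: w fiber_def frag_fun_add)
  qed
  show "fiber m F \<subseteq> Ker m <#>\<^bsub>Free m\<^esub> Z"
  proof
    fix w assume w: "w \<in> fiber m F"
    have "w - z \<in> Ker m"
      unfolding Ker_iff[OF m] using w z Z Free_diff[of w m z] by (auto simp: fiber_def frag_fun_diff)
    moreover have "w = (w - z) \<otimes>\<^bsub>Free m\<^esub> z"
      by simp
    ultimately show "w \<in> Ker m <#>\<^bsub>Free m\<^esub> Z"
      using z unfolding set_mult_def by blast
  qed
qed

lemma fiber_nonempty: "m > 0 \<Longrightarrow> F \<in> chain_funs m \<Longrightarrow> chain_frag m F \<in> fiber m F"
  using chain_frag_in[of m F] by (simp add: fiber_def frag_fun_chain_frag)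

lemma Ker_coset:
  assumes "m > 0" "z \<in> carrier (Free m)"
  shows "Ker m #>\<^bsub>Free m\<^esub> z = fiber m (frag_fun z)"
proof -
  have "Ker m #>\<^bsub>Free m\<^esub> z = Ker m <#>\<^bsub>Free m\<^esub> {z}"
    by (simp add: r_coset_def set_mult_def)
  also have "\<dots> = fiber m (frag_fun z)"
    by (rule Ker_set_mult) (use assms in \<open>auto simp: fiber_def\<close>)
  finally show ?thesis .
qed

lemma carrier_tensor_power:
  assumes "m > 0"
  shows "carrier (tensor_power A B m) = fiber m ` chain_funs m"
proof -
  have "carrier (tensor_power A B m) = (\<lambda>z. fiber m (frag_fun z)) ` carrier (Free m)"
    using Ker_coset[OF assms] by (auto simp: tensor_power_simps FactGroup_def RCOSETS_def)
  also have "\<dots> = fiber m ` frag_fun ` carrier (Free m)"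
    by auto
  also have "frag_fun ` carrier (Free m) = chain_funs m"
  proof
    show "frag_fun ` carrier (Free m) \<subseteq> chain_funs m"
      using frag_fun_in by blast
    show "chain_funs m \<subseteq> frag_fun ` carrier (Free m)"
      using frag_fun_chain_frag[OF assms] chain_frag_in[OF assms] by (metis imageI subsetI)
  qed
  finally show ?thesis .
qed

lemma group_tensor_power: "group (tensor_power A B m)"
proof (rule group_same_operations[OF _ tensor_power_simps(1-3)])
  show "group (Free m Mod Ker m)"
    using comm_group.subgroup_imp_normal[OF abelian_free_Abelian_group subgroup_Ker]
    by (rule normal.factorgroup_is_group)
qed

lemma conv_diff_right:
  "conv a (\<lambda>cs g. F cs g - F' cs g) = (\<lambda>cs g. conv a F cs g - conv a F' cs g)"
  by (auto simp: conv_def fun_eq_iff algebra_simps sum_subtractf)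

lemma rconv_diff_left:
  "rconv (\<lambda>cs g. F cs g - F' cs g) a = (\<lambda>cs g. rconv F a cs g - rconv F' a cs g)"
  by (auto simp: rconv_def fun_eq_iff algebra_simps sum_subtractf)

lemma frag_fun_lact:
  assumes m: "m > 0" and r: "r \<in> carrier A" and z: "z \<in> carrier (Free m)"
  defines "l \<equiv> frag_extend (\<lambda>xs. frag_of ((r \<otimes>\<^bsub>A\<^esub> hd xs) # tl xs))"
  shows "l z \<in> carrier (Free m) \<and> frag_fun (l z) = conv r (frag_fun z)"
proof (rule free_Abelian_group_induct[where P = "\<lambda>z. l z \<in> carrier (Free m) \<and> frag_fun (l z) = conv r (frag_fun z)"])
  show "Poly_Mapping.keys z \<subseteq> tuples A m"
    using z by simp
  show "l 0 \<in> carrier (Free m) \<and> frag_fun (l 0) = conv r (frag_fun 0)"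
    by (simp add: l_def conv_def fun_eq_iff)
  show "l (y - z) \<in> carrier (Free m) \<and> frag_fun (l (y - z)) = conv r (frag_fun (y - z))"
    if "l y \<in> carrier (Free m) \<and> frag_fun (l y) = conv r (frag_fun y)"
      "l z \<in> carrier (Free m) \<and> frag_fun (l z) = conv r (frag_fun z)" for y z
    using that Free_diff[of "l y" m "l z"]
    by (simp only: l_def frag_extend_diff frag_fun_diff conv_diff_right simp_thms)
  show "l (frag_of as) \<in> carrier (Free m) \<and> frag_fun (l (frag_of as)) = conv r (frag_fun (frag_of as))"
    if as: "as \<in> tuples A m" for as
  proof -
    obtain a as' where "as = a # as'"
      using as m by (cases as) (auto simp: tuples_def)
    then show ?thesis
      using as by (simp add: l_def conv_mult tuples_def del: carrier_A)
  qed
qed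

lemma frag_fun_ract:
  assumes m: "m > 0" and r: "r \<in> B" and z: "z \<in> carrier (Free m)"
  defines "l \<equiv> frag_extend (\<lambda>xs. frag_of (butlast xs @ [last xs \<otimes>\<^bsub>A\<^esub> r]))"
  shows "l z \<in> carrier (Free m) \<and> frag_fun (l z) = rconv (frag_fun z) r"
proof (rule free_Abelian_group_induct[where P = "\<lambda>z. l z \<in> carrier (Free m) \<and> frag_fun (l z) = rconv (frag_fun z) r"])
  show "Poly_Mapping.keys z \<subseteq> tuples A m"
    using z by simp
  show "l 0 \<in> carrier (Free m) \<and> frag_fun (l 0) = rconv (frag_fun 0) r"
    by (simp add: l_def rconv_def fun_eq_iff)
  show "l (y - z) \<in> carrier (Free m) \<and> frag_fun (l (y - z)) = rconv (frag_fun (y - z)) r"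
    if "l y \<in> carrier (Free m) \<and> frag_fun (l y) = rconv (frag_fun y) r"
      "l z \<in> carrier (Free m) \<and> frag_fun (l z) = rconv (frag_fun z) r" for y z
    using that Free_diff[of "l y" m "l z"]
    by (simp only: l_def frag_extend_diff frag_fun_diff rconv_diff_left simp_thms)
  show "l (frag_of as) \<in> carrier (Free m) \<and> frag_fun (l (frag_of as)) = rconv (frag_fun (frag_of as)) r"
    if as: "as \<in> tuples A m" for as
  proof -
    obtain as' a where eq: "as = as' @ [a]"
      using as m by (cases as rule: rev_cases) (auto simp: tuples_def)
    then have "a \<in> carrier A"
      using as by (simp add: tuples_def)
    then show ?thesis
      using as eq tensor_fun_ract[OF _ r, of a as'] by (simp add: l_def tuples_def del: carrier_A carrier_B)
  qed
qed

theorem tensor_power_iso: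
  assumes m: "m > 0"
  shows "bimodule_iso (carrier A) B (chain_bimodule m) (tensor_power A B m)"
  unfolding bimodule_iso_def
proof (intro bexI conjI ballI)
  let ?T = "tensor_power A B m"
  have inj: "inj_on (fiber m) (chain_funs m)"
  proof (rule inj_onI)
    fix F F' assume "F \<in> chain_funs m" "F' \<in> chain_funs m" "fiber m F = fiber m F'"
    then have "chain_frag m F \<in> fiber m F'"
      using fiber_nonempty[OF m] by blast
    then show "F = F'"
      using frag_fun_chain_frag[OF m \<open>F \<in> chain_funs m\<close>] by (simp add: fiber_def)
  qed
  show "fiber m \<in> iso (chain_bimodule m) ?T"
  proof (rule isoI)
    show "bij_betw (fiber m) (carrier (chain_bimodule m)) (carrier ?T)"
      using inj by (simp add: bij_betw_def carrier_tensor_power[OF m])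
    show "fiber m \<in> hom (chain_bimodule m) ?T"
    proof (rule homI)
      fix F F' assume F: "F \<in> carrier (chain_bimodule m)" "F' \<in> carrier (chain_bimodule m)"
      let ?z = "chain_frag m F" and ?z' = "chain_frag m F'"
      have z: "?z \<in> fiber m F" "?z' \<in> fiber m F'"
        using F fiber_nonempty[OF m] by simp_all
      then have zc: "?z \<in> carrier (Free m)" "?z' \<in> carrier (Free m)"
        and f: "frag_fun ?z = F" "frag_fun ?z' = F'"
        by (simp_all only: fiber_def mem_Collect_eq)
      have "fiber m F \<otimes>\<^bsub>?T\<^esub> fiber m F' = (Ker m #>\<^bsub>Free m\<^esub> ?z) <#>\<^bsub>Free m\<^esub> (Ker m #>\<^bsub>Free m\<^esub> ?z')"
        by (simp only: tensor_power_simps FactGroup_def monoid.simps Ker_coset[OF m zc(1)] Ker_coset[OF m zc(2)] f)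
      also have "\<dots> = Ker m #>\<^bsub>Free m\<^esub> (?z \<otimes>\<^bsub>Free m\<^esub> ?z')"
        by (rule normal.rcos_sum[OF comm_group.subgroup_imp_normal[OF abelian_free_Abelian_group subgroup_Ker] zc])
      also have "\<dots> = fiber m (frag_fun (?z + ?z'))"
        using Ker_coset[OF m Free_add[OF zc]] by simp
      also have "frag_fun (?z + ?z') = F \<otimes>\<^bsub>chain_bimodule m\<^esub> F'"
        by (simp only: frag_fun_add f chain_bimodule_simps)
      finally show "fiber m (F \<otimes>\<^bsub>chain_bimodule m\<^esub> F') = fiber m F \<otimes>\<^bsub>?T\<^esub> fiber m F'"
        by simp
    qed (simp add: carrier_tensor_power[OF m])
  qed
  show "fiber m (lact (chain_bimodule m) r F) = lact ?T r (fiber m F)"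
    if r: "r \<in> carrier A" and F: "F \<in> carrier (chain_bimodule m)" for r F
    unfolding tensor_power_simps chain_bimodule_simps
    using fiber_nonempty[OF m] F frag_fun_lact[OF m r]
    by (intro Ker_set_mult[OF m, symmetric] imageI) (auto simp: fiber_def simp del: carrier_A carrier_free_Abelian_group_iff)
  show "fiber m (ract (chain_bimodule m) F r) = ract ?T (fiber m F) r"
    if r: "r \<in> B" and F: "F \<in> carrier (chain_bimodule m)" for r F
    unfolding tensor_power_simps chain_bimodule_simps
    using fiber_nonempty[OF m] F frag_fun_ract[OF m r]
    by (intro Ker_set_mult[OF m, symmetric] imageI) (auto simp: fiber_def simp del: carrier_A carrier_B carrier_free_Abelian_group_iff)
qed

end

section \<open>Bounds for the depth\<close>

context finite_transitive_action
begin

section \<open>Linear characters and the lower bound\<close>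

definition linear_character :: "'g set \<Rightarrow> ('g \<Rightarrow> complex) \<Rightarrow> bool" where
  "linear_character U \<psi> \<longleftrightarrow> subgroup U G \<and> (\<forall>x\<in>U. \<forall>y\<in>U. \<psi> (x \<otimes> y) = \<psi> x * \<psi> y) \<and> \<psi> \<one> = 1"

text \<open>For a linear character this is its idempotent up to the factor \<open>card U\<close>,
  which is omitted because only vanishing of products matters.\<close>

definition character_sum :: "'g set \<Rightarrow> ('g \<Rightarrow> complex) \<Rightarrow> 'g \<Rightarrow> complex" where
  "character_sum U \<psi> = (\<lambda>x. if x \<in> U then inverse (\<psi> x) else 0)"

lemma linear_characterD:
  assumes "linear_character U \<psi>"
  shows "subgroup U G" "x \<in> U \<Longrightarrow> y \<in> U \<Longrightarrow> \<psi> (x \<otimes> y) = \<psi> x * \<psi> y" "\<psi> \<one> = 1"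
  using assms by (auto simp: linear_character_def)

lemma linear_character_inv:
  assumes "linear_character U \<psi>" "x \<in> U"
  shows "\<psi> x * \<psi> (inv x) = 1"
proof -
  note U = linear_characterD[OF assms(1)]
  have "x \<in> carrier G" "inv x \<in> U"
    using assms(2) U(1) by (auto simp: subgroup.mem_carrier subgroup.m_inv_closed)
  then show ?thesis
    using U(2)[OF assms(2), of "inv x"] U(3) by simp
qed

lemma sum_character_sum:
  assumes "U \<subseteq> carrier G"
  shows "(\<Sum>x\<in>carrier G. k x * character_sum U \<psi> x) = (\<Sum>x\<in>U. k x * inverse (\<psi> x))"
  unfolding character_sum_def
  by (rule sum.mono_neutral_cong_right) (use assms finite_carrier in auto)

lemma sum_character_shift:
  assumes \<psi>: "linear_character U \<psi>" and u: "u \<in> U"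
  shows "(\<Sum>x\<in>U. k (u \<otimes> x) * inverse (\<psi> x)) = \<psi> u * (\<Sum>x\<in>U. k x * inverse (\<psi> x))"
    and "(\<Sum>x\<in>U. k (x \<otimes> u) * inverse (\<psi> x)) = \<psi> u * (\<Sum>x\<in>U. k x * inverse (\<psi> x))"
proof -
  note U = linear_characterD[OF \<psi>]
  note closed = subgroup.m_closed[OF U(1)] subgroup.m_inv_closed[OF U(1)] subgroup.mem_carrier[OF U(1)]
  have ne: "\<psi> x \<noteq> 0" if "x \<in> U" for x
    using linear_character_inv[OF \<psi> that] by auto
  have "(\<Sum>x\<in>U. k (u \<otimes> x) * inverse (\<psi> x)) = (\<Sum>x\<in>U. \<psi> u * (k x * inverse (\<psi> x)))"
    by (rule sum.reindex_bij_witness[of _ "\<lambda>x. inv u \<otimes> x" "\<lambda>x. u \<otimes> x"])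
      (use u in \<open>simp_all add: closed U(2) ne flip: m_assoc\<close>)
  then show "(\<Sum>x\<in>U. k (u \<otimes> x) * inverse (\<psi> x)) = \<psi> u * (\<Sum>x\<in>U. k x * inverse (\<psi> x))"
    by (simp add: sum_distrib_left)
  have "(\<Sum>x\<in>U. k (x \<otimes> u) * inverse (\<psi> x)) = (\<Sum>x\<in>U. \<psi> u * (k x * inverse (\<psi> x)))"
    by (rule sum.reindex_bij_witness[of _ "\<lambda>x. x \<otimes> inv u" "\<lambda>x. x \<otimes> u"])
      (use u in \<open>simp_all add: closed U(2) ne m_assoc\<close>)
  then show "(\<Sum>x\<in>U. k (x \<otimes> u) * inverse (\<psi> x)) = \<psi> u * (\<Sum>x\<in>U. k x * inverse (\<psi> x))"
    by (simp add: sum_distrib_left)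
qed

text \<open>Reindexing the sum over \<open>U\<close> by \<open>u\<close> pulls out one factor, so
  every function e F is an eigenvector for left translation by \<open>U\<close>.\<close>

lemma conv_character_sum:
  assumes \<psi>: "linear_character U \<psi>" and u: "u \<in> U" and cs: "set cs \<subseteq> \<Omega>" and g: "g \<in> carrier G"
  shows "conv (character_sum U \<psi>) F (map ((\<bullet>) (inv u)) cs) (inv u \<otimes> g)
    = \<psi> u * conv (character_sum U \<psi>) F cs g"
proof -
  note U = linear_characterD[OF \<psi>]
  have Uc: "U \<subseteq> carrier G"
    by (rule subgroup.subset[OF U(1)])
  have uc: "u \<in> carrier G"
    using u Uc by blast
  let ?k = "\<lambda>x. F (map ((\<bullet>) (inv x)) cs) (inv x \<otimes> g)"
  have k: "?k (u \<otimes> x) = F (map ((\<bullet>) (inv x)) (map ((\<bullet>) (inv u)) cs)) (inv x \<otimes> (inv u \<otimes> g))"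
    if "x \<in> carrier G" for x
    using that uc cs g by (simp only: inv_mult_group inv_closed map_act_mult m_assoc)
  have "conv (character_sum U \<psi>) F (map ((\<bullet>) (inv u)) cs) (inv u \<otimes> g)
      = (\<Sum>x\<in>carrier G. ?k (u \<otimes> x) * character_sum U \<psi> x)"
    unfolding conv_def using cs g uc set_map_act[of "inv u" cs]
    by (simp add: k mult.commute)
  also have "\<dots> = \<psi> u * (\<Sum>x\<in>carrier G. ?k x * character_sum U \<psi> x)"
    by (simp only: sum_character_sum[OF Uc] sum_character_shift(1)[OF \<psi> u, of ?k])
  also have "(\<Sum>x\<in>carrier G. ?k x * character_sum U \<psi> x) = conv (character_sum U \<psi>) F cs g"
    unfolding conv_def using cs g by (simp add: mult.commute)
  finally show ?thesis .
qed

lemma rconv_character_sum: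
  assumes \<psi>: "linear_character U \<psi>" and u: "u \<in> U" and g: "g \<in> carrier G"
  shows "rconv F (character_sum U \<psi>) cs (g \<otimes> inv u) = \<psi> u * rconv F (character_sum U \<psi>) cs g"
proof -
  note U = linear_characterD[OF \<psi>]
  have Uc: "U \<subseteq> carrier G"
    by (rule subgroup.subset[OF U(1)])
  have uc: "u \<in> carrier G"
    using u Uc by blast
  let ?k = "\<lambda>x. F cs (g \<otimes> inv x)"
  have k: "?k (x \<otimes> u) = F cs (g \<otimes> inv u \<otimes> inv x)" if "x \<in> carrier G" for x
    using that uc g by (simp add: inv_mult_group m_assoc)
  have "rconv F (character_sum U \<psi>) cs (g \<otimes> inv u) = (\<Sum>x\<in>carrier G. ?k (x \<otimes> u) * character_sum U \<psi> x)"
    unfolding rconv_def using g uc by (simp add: k)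
  also have "\<dots> = \<psi> u * (\<Sum>x\<in>carrier G. ?k x * character_sum U \<psi> x)"
    by (simp only: sum_character_sum[OF Uc] sum_character_shift(2)[OF \<psi> u, of ?k])
  also have "(\<Sum>x\<in>carrier G. ?k x * character_sum U \<psi> x) = rconv F (character_sum U \<psi>) cs g"
    unfolding rconv_def using g by simp
  finally show ?thesis .
qed

text \<open>Pairs of \<open>u\<close> fixing \<open>cs\<close> and its conjugate by \<open>g\<close>
  make up the stabilizer of the basis point \<open>(cs, g)\<close> under \<open>U\<close> on the
  left and \<open>U\<close> on the right. The condition says that on no such stabilizer do the two
  characters agree throughout; as in Mackey's criterion this amounts to e T f = 0.\<close>

definition separates :: "nat \<Rightarrow> 'g set \<Rightarrow> ('g \<Rightarrow> complex) \<Rightarrow> ('g \<Rightarrow> complex) \<Rightarrow> bool" where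
  "separates m U \<psi> \<psi>' \<longleftrightarrow> (\<forall>(cs, g) \<in> chains m. \<exists>u\<in>U. map ((\<bullet>) u) cs = cs \<and>
     inv g \<otimes> u \<otimes> g \<in> U \<and> \<psi> u \<noteq> \<psi>' (inv g \<otimes> u \<otimes> g))"

lemma character_sum_in_B: "U \<subseteq> point_stabilizer \<Longrightarrow> character_sum U \<psi> \<in> B"
  unfolding carrier_B by (auto simp: character_sum_def)

text \<open>Translating \<open>g\<close> by \<open>inv u\<close> on the left equals translating it
  by the inverse of the conjugate on the right, while \<open>cs\<close> stays fixed. The value of e
  F f is thereby multiplied by two different numbers, so it is zero.\<close>

lemma separates_annihilates:
  assumes \<psi>: "linear_character U \<psi>" and \<psi>': "linear_character U \<psi>'"
    and sep: "separates m U \<psi> \<psi>'" and U: "U \<subseteq> point_stabilizer" and F: "F \<in> chain_funs m"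
  shows "rconv (conv (character_sum U \<psi>) F) (character_sum U \<psi>') = (\<lambda>cs g. 0)"
proof (intro ext)
  fix cs g
  let ?e = "character_sum U \<psi>" and ?f = "character_sum U \<psi>'"
  let ?E = "rconv (conv ?e F) ?f"
  have e: "?e \<in> B" "?f \<in> B"
    using U by (simp_all only: character_sum_in_B)
  have E: "?E \<in> chain_funs m"
    by (rule rconv_chain_funs[OF e(2) conv_chain_funs[OF subsetD[OF B_subset_A e(1)] F disjI2[OF e(1)]]])
  show "?E cs g = 0"
  proof (cases "(cs, g) \<in> chains m")
    case True
    then have cs: "set cs \<subseteq> \<Omega>" and g: "g \<in> carrier G"
      by (auto simp: chains_def)
    obtain u where u: "u \<in> U" "map ((\<bullet>) u) cs = cs" and v: "inv g \<otimes> u \<otimes> g \<in> U"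
      and ne: "\<psi> u \<noteq> \<psi>' (inv g \<otimes> u \<otimes> g)"
      using sep True unfolding separates_def by blast
    have uc: "u \<in> carrier G"
      using u U stabilizer_subset by blast
    have "map ((\<bullet>) (inv u)) cs = cs"
      using map_act_inv_iff[OF uc cs cs] u(2) by simp
    then have "?E cs (inv u \<otimes> g) = \<psi> u * ?E cs g"
      using conv_character_sum[OF \<psi> u(1) cs g, of "rconv F ?f"] by (simp add: rconv_conv)
    moreover have "inv u \<otimes> g = g \<otimes> inv (inv g \<otimes> u \<otimes> g)"
      using uc g by (simp add: inv_mult_group m_assoc flip: m_assoc[of g "inv g"])
    then have "?E cs (inv u \<otimes> g) = \<psi>' (inv g \<otimes> u \<otimes> g) * ?E cs g"
      using rconv_character_sum[OF \<psi>' v g] by simp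
    ultimately show ?thesis
      using ne by (metis mult_cancel_right)
  qed (rule chain_funsD[OF E])
qed

text \<open>For the point mass at an unseparated chain, the value of e F f there counts the pairs of
  \<open>U\<close> that stabilize the chain, since each contributes 1; the neutral pair is among
  them.\<close>

lemma not_separates_nonzero:
  assumes \<psi>: "linear_character U \<psi>" and \<psi>': "linear_character U \<psi>'"
    and nsep: "\<not> separates m U \<psi> \<psi>'"
  obtains F where "F \<in> chain_funs m" "rconv (conv (character_sum U \<psi>) F) (character_sum U \<psi>') \<noteq> (\<lambda>cs g. 0)"
proof -
  let ?e = "character_sum U \<psi>" and ?f = "character_sum U \<psi>'"
  note U = linear_characterD(1)[OF \<psi>]
  have Uc: "U \<subseteq> carrier G"
    by (rule subgroup.subset[OF U])
  obtain cs g where cg: "(cs, g) \<in> chains m" and eq: "\<And>u. u \<in> U \<Longrightarrow> map ((\<bullet>) u) cs = cs \<Longrightarrow>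
      inv g \<otimes> u \<otimes> g \<in> U \<Longrightarrow> \<psi> u = \<psi>' (inv g \<otimes> u \<otimes> g)"
    using nsep unfolding separates_def by blast
  have cs: "set cs \<subseteq> \<Omega>" and g: "g \<in> carrier G"
    using cg by (auto simp: chains_def)
  let ?F = "\<lambda>ds h. if (ds, h) = (cs, g) then 1 else 0"
  let ?P = "\<lambda>k x. x \<in> U \<and> k \<in> U \<and> map ((\<bullet>) (inv x)) cs = cs \<and> inv x \<otimes> (g \<otimes> inv k) = g"
  have entry: "?e x * ?F (map ((\<bullet>) (inv x)) cs) (inv x \<otimes> (g \<otimes> inv k)) * ?f k = (if ?P k x then 1 else 0)"
    if x: "x \<in> carrier G" and k: "k \<in> carrier G" for x k
  proof (cases "?P k x")
    case True
    then have "map ((\<bullet>) x) cs = cs"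
      using map_act_inv_iff[OF x cs cs] by simp
    moreover have k_eq: "inv k = inv g \<otimes> x \<otimes> g"
    proof -
      have "x \<otimes> (inv x \<otimes> (g \<otimes> inv k)) = x \<otimes> g"
        using True by simp
      then have "g \<otimes> inv k = x \<otimes> g"
        using x k g by (simp add: m_assoc[symmetric])
      then have "inv g \<otimes> (g \<otimes> inv k) = inv g \<otimes> (x \<otimes> g)"
        by simp
      then show ?thesis
        using x k g by (simp add: m_assoc[symmetric])
    qed
    moreover have "inv k \<in> U"
      using True by (simp add: subgroup.m_inv_closed[OF U])
    ultimately have "\<psi> x = \<psi>' (inv k)"
      using eq[of x] True by simp
    then have "\<psi> x * \<psi>' k = 1"
      using linear_character_inv[OF \<psi>', of k] True by (simp add: mult.commute)
    then have "inverse (\<psi> x * \<psi>' k) = 1"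
      by simp
    then have "inverse (\<psi> x) * inverse (\<psi>' k) = 1"
      by (simp only: inverse_mult_distrib)
    then show ?thesis
      using True by (simp add: character_sum_def)
  qed (auto simp: character_sum_def)
  let ?S = "{(k, x). k \<in> carrier G \<and> x \<in> carrier G \<and> ?P k x}"
  have fin: "finite ?S"
    by (rule finite_subset[of _ "carrier G \<times> carrier G"]) (auto simp: finite_carrier)
  have "rconv (conv ?e ?F) ?f cs g
      = (\<Sum>k\<in>carrier G. \<Sum>x\<in>carrier G. ?e x * ?F (map ((\<bullet>) (inv x)) cs) (inv x \<otimes> (g \<otimes> inv k)) * ?f k)"
    unfolding rconv_def conv_def using cs g by (simp add: sum_distrib_right)
  also have "\<dots> = (\<Sum>k\<in>carrier G. \<Sum>x\<in>carrier G. if ?P k x then 1 else 0)"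
    by (intro sum.cong refl) (simp only: entry)
  also have "\<dots> = (\<Sum>p\<in>carrier G \<times> carrier G. if ?P (fst p) (snd p) then 1 else 0)"
    by (simp add: sum.cartesian_product case_prod_unfold)
  also have "\<dots> = (\<Sum>p\<in>{p \<in> carrier G \<times> carrier G. ?P (fst p) (snd p)}. 1)"
    by (rule sum.inter_filter[symmetric]) (simp add: finite_carrier)
  also have "{p \<in> carrier G \<times> carrier G. ?P (fst p) (snd p)} = ?S"
    by auto
  also have "(\<Sum>p\<in>?S. 1) = of_nat (card ?S)"
    by simp
  finally have val: "rconv (conv ?e ?F) ?f cs g = of_nat (card ?S)" .
  have "(\<one>, \<one>) \<in> ?S"
    using g cs subgroup.one_closed[OF U] by (simp add: map_act_one)
  then have "card ?S \<noteq> 0"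
    using card_eq_0_iff[of ?S] fin by blast
  then have "rconv (conv ?e ?F) ?f cs g \<noteq> 0"
    by (simp only: val of_nat_eq_0_iff not_False_eq_True)
  then have "rconv (conv ?e ?F) ?f \<noteq> (\<lambda>cs g. 0)"
    by (auto simp: fun_eq_iff)
  moreover have "?F \<in> chain_funs m"
    using cg by (auto simp: chain_funs_def)
  ultimately show ?thesis
    using that by blast
qed

text \<open>\<open>V\<close> and \<open>W\<close> are arbitrary models of levels
  \<open>Suc m\<close> and \<open>m\<close>, to cover the tensor powers and, at m = 0, the regular
  bimodules. The isomorphisms point in the directions in which annihilation is pulled back.\<close>

lemma not_direct_summand_power:
  assumes \<psi>: "linear_character U \<psi>" and \<psi>': "linear_character U \<psi>'" and U: "U \<subseteq> point_stabilizer"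
    and sep: "separates m U \<psi> \<psi>'" and nsep: "\<not> separates (Suc m) U \<psi> \<psi>'"
    and V: "group V" and W: "group W"
    and isoV: "bimodule_iso B B (chain_bimodule (Suc m)) V" and isoW: "bimodule_iso B B W (chain_bimodule m)"
    and actW: "additive_biaction B B W"
  shows "\<not> iso_direct_summand B B V (direct_power a W)"
proof
  assume summand: "iso_direct_summand B B V (direct_power a W)"
  let ?e = "character_sum U \<psi>" and ?f = "character_sum U \<psi>'"
  have e: "?e \<in> B" "?f \<in> B"
    using U by (simp_all only: character_sum_in_B)
  have actC: "additive_biaction B B (chain_bimodule (Suc m))"
    by (rule additive_biaction_chain_bimodule[OF B_subset_A]) simp
  have actV: "additive_biaction B B V"
    by (rule additive_biaction_iso[OF actC V isoV])
  obtain F where F: "F \<in> chain_funs (Suc m)" and ne: "rconv (conv ?e F) ?f \<noteq> (\<lambda>cs g. 0)"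
    using not_separates_nonzero[OF \<psi> \<psi>' nsep] .
  have "ract W (lact W ?e w) ?f = \<one>\<^bsub>W\<^esub>" if "w \<in> carrier W" for w
    by (rule bimodule_iso_annihilated[OF actW group_chain_bimodule e isoW _ that])
      (simp add: separates_annihilates[OF \<psi> \<psi>' sep U])
  then have "ract V (lact V ?e v) ?f = \<one>\<^bsub>V\<^esub>" if "v \<in> carrier V" for v
    using that by (rule direct_summand_power_annihilated[OF actV W e summand])
  then have "rconv (conv ?e F) ?f = (\<lambda>cs g. 0)"
    using bimodule_iso_annihilated[OF actC V e isoV _, of F] F by simp
  then show False
    using ne by contradiction
qed

section \<open>Transfer maps and the upper bound\<close>

text \<open>
  The bimodule map sending the orbit of \<open>(y, \<one>)\<close> to the orbit of \<open>(z, \<one>)\<close>, with multiplicities.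
\<close>

definition transfer ::
  "'c list \<Rightarrow> 'c list \<Rightarrow> ('c list \<Rightarrow> 'g \<Rightarrow> complex) \<Rightarrow> 'c list \<Rightarrow> 'g \<Rightarrow> complex" where
  "transfer z y F = (\<lambda>cs g. if g \<in> carrier G then
     \<Sum>h\<in>point_stabilizer. if cs = map ((\<bullet>) (g \<otimes> h)) z then F (map ((\<bullet>) (g \<otimes> h)) y) g else 0 else 0)"

lemma transfer_conv:
  assumes z: "set z \<subseteq> \<Omega>" and y: "set y \<subseteq> \<Omega>"
  shows "transfer z y (conv r F) = conv r (transfer z y F)"
proof (intro ext)
  fix cs g
  show "transfer z y (conv r F) cs g = conv r (transfer z y F) cs g"
  proof (cases "set cs \<subseteq> \<Omega> \<and> g \<in> carrier G")
    case True
    have hc: "h \<in> carrier G" if "h \<in> point_stabilizer" for h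
      using that stabilizer_subset by blast
    have "transfer z y (conv r F) cs g = (\<Sum>h\<in>point_stabilizer. \<Sum>x\<in>carrier G.
        r x * (if cs = map ((\<bullet>) (g \<otimes> h)) z
          then F (map ((\<bullet>) (inv x)) (map ((\<bullet>) (g \<otimes> h)) y)) (inv x \<otimes> g) else 0))"
      unfolding transfer_def using True
    proof (simp only: simp_thms if_True, intro sum.cong refl)
      fix h assume h: "h \<in> point_stabilizer"
      have "set (map ((\<bullet>) (g \<otimes> h)) y) \<subseteq> \<Omega>"
        using True hc[OF h] y by (intro set_map_act) auto
      then show "(if cs = map ((\<bullet>) (g \<otimes> h)) z then conv r F (map ((\<bullet>) (g \<otimes> h)) y) g else 0) =
        (\<Sum>x\<in>carrier G. r x * (if cs = map ((\<bullet>) (g \<otimes> h)) z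
          then F (map ((\<bullet>) (inv x)) (map ((\<bullet>) (g \<otimes> h)) y)) (inv x \<otimes> g) else 0))"
        using True by (simp only: conv_def simp_thms if_True) (simp del: map_map)
    qed
    also have "\<dots> = (\<Sum>x\<in>carrier G. \<Sum>h\<in>point_stabilizer.
        r x * (if cs = map ((\<bullet>) (g \<otimes> h)) z
          then F (map ((\<bullet>) (inv x)) (map ((\<bullet>) (g \<otimes> h)) y)) (inv x \<otimes> g) else 0))"
      by (rule sum.swap)
    also have "\<dots> = (\<Sum>x\<in>carrier G. r x * transfer z y F (map ((\<bullet>) (inv x)) cs) (inv x \<otimes> g))"
    proof (intro sum.cong refl)
      fix x assume x: "x \<in> carrier G"
      have "(if cs = map ((\<bullet>) (g \<otimes> h)) z
          then F (map ((\<bullet>) (inv x)) (map ((\<bullet>) (g \<otimes> h)) y)) (inv x \<otimes> g) else 0) =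
        (if map ((\<bullet>) (inv x)) cs = map ((\<bullet>) (inv x \<otimes> g \<otimes> h)) z
          then F (map ((\<bullet>) (inv x \<otimes> g \<otimes> h)) y) (inv x \<otimes> g) else 0)"
        if h: "h \<in> point_stabilizer" for h
      proof -
        have gh: "g \<otimes> h \<in> carrier G" "inv x \<otimes> g \<otimes> h = inv x \<otimes> (g \<otimes> h)"
          using True hc[OF h] x by (auto simp: m_assoc)
        have zz: "set (map ((\<bullet>) (g \<otimes> h)) z) \<subseteq> \<Omega>" "set (map ((\<bullet>) (inv x)) (map ((\<bullet>) (g \<otimes> h)) z)) \<subseteq> \<Omega>"
          using gh z x by (simp_all only: set_map_act inv_closed)
        have "cs = map ((\<bullet>) x) (map ((\<bullet>) (inv x)) (map ((\<bullet>) (g \<otimes> h)) z)) \<longleftrightarrow>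
            map ((\<bullet>) (inv x)) cs = map ((\<bullet>) (inv x)) (map ((\<bullet>) (g \<otimes> h)) z)"
          using map_act_inv_iff[OF x _ zz(2)] True by blast
        moreover have "map ((\<bullet>) x) (map ((\<bullet>) (inv x)) (map ((\<bullet>) (g \<otimes> h)) z)) = map ((\<bullet>) (g \<otimes> h)) z"
          by (rule map_act_inv_iff[OF x zz(1) zz(2), THEN iffD1, OF refl, symmetric])
        ultimately show ?thesis
          using x gh z y by (simp only: gh(2) map_act_mult inv_closed)
      qed
      then show "(\<Sum>h\<in>point_stabilizer. r x * (if cs = map ((\<bullet>) (g \<otimes> h)) z
          then F (map ((\<bullet>) (inv x)) (map ((\<bullet>) (g \<otimes> h)) y)) (inv x \<otimes> g) else 0)) =
        r x * transfer z y F (map ((\<bullet>) (inv x)) cs) (inv x \<otimes> g)"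
        unfolding transfer_def sum_distrib_left[symmetric] using True x by simp
    qed
    also have "\<dots> = conv r (transfer z y F) cs g"
      unfolding conv_def using True by (simp only: simp_thms if_True)
    finally show ?thesis .
  next
    case False
    have "cs \<noteq> map ((\<bullet>) (g \<otimes> h)) z" if "g \<in> carrier G" "h \<in> point_stabilizer" for h
      using False that(1) set_map_act[OF m_closed[OF that(1) subsetD[OF stabilizer_subset that(2)]] z] by blast
    then have "transfer z y (conv r F) cs g = 0"
      by (simp add: transfer_def)
    then show ?thesis
      using False by (simp only: conv_def if_False)
  qed
qed

text \<open>Right translation by an element k of the stabilizer is absorbed by the substitution of k
  h for h; this is the purpose of the sum over the stabilizer in \<open>transfer\<close>.\<close>

lemma transfer_rconv:
  assumes b: "b \<in> B"
  shows "transfer z y (rconv F b) = rconv (transfer z y F) b"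
proof (intro ext)
  fix cs g
  show "transfer z y (rconv F b) cs g = rconv (transfer z y F) b cs g"
  proof (cases "g \<in> carrier G")
    case g: True
    let ?t = "\<lambda>k h. (if cs = map ((\<bullet>) (g \<otimes> h)) z then F (map ((\<bullet>) (g \<otimes> h)) y) (g \<otimes> inv k) else 0)"
    have "transfer z y (rconv F b) cs g = (\<Sum>h\<in>point_stabilizer. \<Sum>k\<in>carrier G. ?t k h * b k)"
      unfolding transfer_def rconv_def using g by (auto intro!: sum.cong)
    also have "\<dots> = (\<Sum>k\<in>carrier G. \<Sum>h\<in>point_stabilizer. ?t k h * b k)"
      by (rule sum.swap)
    also have "\<dots> = (\<Sum>k\<in>carrier G. transfer z y F cs (g \<otimes> inv k) * b k)"
    proof (intro sum.cong refl)
      fix k assume kc: "k \<in> carrier G"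
      show "(\<Sum>h\<in>point_stabilizer. ?t k h * b k) = transfer z y F cs (g \<otimes> inv k) * b k"
      proof (cases "k \<in> point_stabilizer")
        case k: True
        note closed = subgroup.m_closed[OF subgroup_stabilizer] subgroup.m_inv_closed[OF subgroup_stabilizer]
          subgroup.mem_carrier[OF subgroup_stabilizer]
        have "(\<Sum>h\<in>point_stabilizer. ?t k h) = (\<Sum>h\<in>point_stabilizer.
            if cs = map ((\<bullet>) (g \<otimes> inv k \<otimes> h)) z then F (map ((\<bullet>) (g \<otimes> inv k \<otimes> h)) y) (g \<otimes> inv k) else 0)"
          by (rule sum.reindex_bij_witness[of _ "\<lambda>h. inv k \<otimes> h" "\<lambda>h. k \<otimes> h"])
            (use k kc g in \<open>simp_all add: closed m_assoc flip: m_assoc[of k "inv k"] m_assoc[of "inv k" k]\<close>)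
        then show ?thesis
          using g kc by (simp add: transfer_def flip: sum_distrib_right)
      next
        case False
        then have "b k = 0"
          using b unfolding carrier_B by blast
        then show ?thesis by simp
      qed
    qed
    also have "\<dots> = rconv (transfer z y F) b cs g"
      unfolding rconv_def using g by simp
    finally show ?thesis .
  qed (simp add: transfer_def rconv_def)
qed

text \<open>The pair is \<open>(z, \<one>)\<close> moved by \<open>g \<otimes> h\<close> on the left
  and by \<open>inv h\<close> on the right. Such pairs make up the orbit of
  \<open>(z, \<one>)\<close>.\<close>

lemma chain_translate:
  assumes "(z, \<one>) \<in> chains m" "m > 0" "g \<in> carrier G" "h \<in> point_stabilizer"
  shows "(map ((\<bullet>) (g \<otimes> h)) z, g) \<in> chains m"
proof -
  have h: "h \<in> carrier G"
    using assms stabilizer_subset by blast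
  have "(map ((\<bullet>) (g \<otimes> h)) z, g \<otimes> h \<otimes> \<one>) \<in> chains m"
    using assms h by (intro chains_act) auto
  then have "(map ((\<bullet>) (g \<otimes> h)) z, g \<otimes> h \<otimes> \<one> \<otimes> inv h) \<in> chains m"
    by (rule chains_ract[OF subgroup.m_inv_closed[OF subgroup_stabilizer assms(4)]])
  then show ?thesis
    using assms(3) h by (simp add: m_assoc)
qed

lemma transfer_hom:
  assumes z: "(z, \<one>) \<in> chains m" and y: "(y, \<one>) \<in> chains m'" and m: "m > 0" "m' > 0"
  shows "transfer z y \<in> bimodule_hom (carrier A) B (chain_bimodule m') (chain_bimodule m)"
proof (rule bimodule_homI)
  have zy: "set z \<subseteq> \<Omega>" "set y \<subseteq> \<Omega>"
    using z y by (auto simp: chains_def)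
  show "transfer z y F \<in> carrier (chain_bimodule m)" for F
    using chain_translate[OF z m(1)] by (auto simp: chain_funs_def transfer_def intro!: sum.neutral)
  show "transfer z y (F \<otimes>\<^bsub>chain_bimodule m'\<^esub> F') = transfer z y F \<otimes>\<^bsub>chain_bimodule m\<^esub> transfer z y F'" for F F'
    by (auto simp: transfer_def fun_eq_iff simp flip: sum.distrib intro!: sum.cong)
  show "transfer z y (lact (chain_bimodule m') r F) = lact (chain_bimodule m) r (transfer z y F)" for r F
    using transfer_conv[OF zy] by simp
  show "transfer z y (ract (chain_bimodule m') F r) = ract (chain_bimodule m) (transfer z y F) r" if "r \<in> B" for r F
    using transfer_rconv[OF that] by (simp del: carrier_B)
qed

text \<open>Going to the orbit of \<xi> and back. The surviving terms of the inner sum are indexed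
  by the stabilizer of \<xi>, and by \<open>triv\<close> it fixes \<open>y\<close> as well, so they
  all carry the same value of \<open>F\<close> instead of mixing values at several points.\<close>

lemma transfer_transfer:
  assumes x: "set \<xi> \<subseteq> \<Omega>" and y: "set y \<subseteq> \<Omega>" and g: "g \<in> carrier G"
    and triv: "\<And>h. h \<in> point_stabilizer \<Longrightarrow> map ((\<bullet>) h) \<xi> = \<xi> \<Longrightarrow> map ((\<bullet>) h) y = y"
  shows "transfer y \<xi> (transfer \<xi> y F) ds g = (\<Sum>h\<in>point_stabilizer.
    if ds = map ((\<bullet>) (g \<otimes> h)) y then of_nat (card {h \<in> point_stabilizer. map ((\<bullet>) h) \<xi> = \<xi>}) * F ds g else 0)"
proof -
  note closed = subgroup.m_closed[OF subgroup_stabilizer] subgroup.m_inv_closed[OF subgroup_stabilizer]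
    subgroup.mem_carrier[OF subgroup_stabilizer]
  let ?N = "{h \<in> point_stabilizer. map ((\<bullet>) h) \<xi> = \<xi>}"
  have fin: "finite point_stabilizer"
    by (rule finite_subset[OF stabilizer_subset finite_carrier])
  have inner: "transfer \<xi> y F (map ((\<bullet>) (g \<otimes> h)) \<xi>) g = of_nat (card ?N) * F (map ((\<bullet>) (g \<otimes> h)) y) g"
    if h: "h \<in> point_stabilizer" for h
  proof -
    have gh: "g \<otimes> h \<in> carrier G"
      using g h closed by blast
    have "transfer \<xi> y F (map ((\<bullet>) (g \<otimes> h)) \<xi>) g = (\<Sum>k\<in>point_stabilizer.
        if map ((\<bullet>) (g \<otimes> h)) \<xi> = map ((\<bullet>) (g \<otimes> h \<otimes> k)) \<xi> then F (map ((\<bullet>) (g \<otimes> h \<otimes> k)) y) g else 0)"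
      unfolding transfer_def if_P[OF g]
      by (rule sum.reindex_bij_witness[of _ "\<lambda>k. h \<otimes> k" "\<lambda>k. inv h \<otimes> k"])
        (use g h in \<open>simp_all add: closed m_assoc flip: m_assoc[of h "inv h"] m_assoc[of "inv h" h]\<close>)
    also have "\<dots> = (\<Sum>k\<in>point_stabilizer. if map ((\<bullet>) k) \<xi> = \<xi> then F (map ((\<bullet>) (g \<otimes> h)) y) g else 0)"
    proof (intro sum.cong refl)
      fix k assume k: "k \<in> point_stabilizer"
      have kx: "set (map ((\<bullet>) k) \<xi>) \<subseteq> \<Omega>"
        by (rule set_map_act[OF closed(3)[OF k] x])
      have ghx: "set (map ((\<bullet>) (g \<otimes> h)) \<xi>) \<subseteq> \<Omega>"
        by (rule set_map_act[OF gh x])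
      have "map ((\<bullet>) (g \<otimes> h)) \<xi> = map ((\<bullet>) (g \<otimes> h)) (map ((\<bullet>) k) \<xi>) \<longleftrightarrow> map ((\<bullet>) k) \<xi> = \<xi>"
        using map_act_inv_iff[OF gh ghx x] map_act_inv_iff[OF gh ghx kx] by metis
      moreover have "map ((\<bullet>) (g \<otimes> h \<otimes> k)) \<xi> = map ((\<bullet>) (g \<otimes> h)) (map ((\<bullet>) k) \<xi>)"
        "map ((\<bullet>) (g \<otimes> h \<otimes> k)) y = map ((\<bullet>) (g \<otimes> h)) (map ((\<bullet>) k) y)"
        by (rule map_act_mult[OF gh closed(3)[OF k] x], rule map_act_mult[OF gh closed(3)[OF k] y])
      ultimately show "(if map ((\<bullet>) (g \<otimes> h)) \<xi> = map ((\<bullet>) (g \<otimes> h \<otimes> k)) \<xi> then F (map ((\<bullet>) (g \<otimes> h \<otimes> k)) y) g else 0)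
        = (if map ((\<bullet>) k) \<xi> = \<xi> then F (map ((\<bullet>) (g \<otimes> h)) y) g else 0)"
        using triv[OF k] by (simp only: split: if_split) simp
    qed
    also have "\<dots> = (\<Sum>k\<in>?N. F (map ((\<bullet>) (g \<otimes> h)) y) g)"
      by (rule sum.inter_filter[OF fin, symmetric])
    finally show ?thesis
      by simp
  qed
  show ?thesis
    unfolding transfer_def[of y] if_P[OF g] by (intro sum.cong refl) (simp only: inner split: if_split, simp)
qed

text \<open>For a chain \<open>(ds, g)\<close> each h has exactly one \<open>y\<close> with ds = (g
  h) y. Summing over all \<open>y\<close>, rather than over orbit representatives, therefore
  produces the same constant at every chain.\<close>

lemma sum_transfer_transfer:
  assumes F: "F \<in> chain_funs m" and x: "set \<xi> \<subseteq> \<Omega>"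
    and triv: "\<And>h. h \<in> point_stabilizer \<Longrightarrow> map ((\<bullet>) h) \<xi> = \<xi> \<Longrightarrow> (\<forall>c\<in>\<Omega>. h \<bullet> c = c)"
    and m: "m > 0"
  shows "(\<Sum>y | (y, \<one>) \<in> chains m. transfer y \<xi> (transfer \<xi> y F) ds g)
    = of_nat (card point_stabilizer * card {h \<in> point_stabilizer. map ((\<bullet>) h) \<xi> = \<xi>}) * F ds g"
proof (cases "(ds, g) \<in> chains m")
  case True
  let ?Y = "{y. (y, \<one>) \<in> chains m}" and ?N = "{h \<in> point_stabilizer. map ((\<bullet>) h) \<xi> = \<xi>}"
  have g: "g \<in> carrier G" and ds: "set ds \<subseteq> \<Omega>"
    using True by (auto simp: chains_def)
  have finY: "finite ?Y"
    using finite_imageI[OF finite_chains[of m], of fst] by (rule finite_subset[rotated]) force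
  have "(\<Sum>y\<in>?Y. transfer y \<xi> (transfer \<xi> y F) ds g) = (\<Sum>y\<in>?Y. \<Sum>h\<in>point_stabilizer.
      if ds = map ((\<bullet>) (g \<otimes> h)) y then of_nat (card ?N) * F ds g else 0)"
  proof (intro sum.cong refl transfer_transfer x g)
    fix y assume y: "y \<in> ?Y"
    then show y': "set y \<subseteq> \<Omega>"
      by (auto simp: chains_def)
    show "map ((\<bullet>) h) y = y" if "h \<in> point_stabilizer" "map ((\<bullet>) h) \<xi> = \<xi>" for h
      using triv[OF that] y' by (intro map_idI) auto
  qed
  also have "\<dots> = (\<Sum>h\<in>point_stabilizer. \<Sum>y\<in>?Y. if ds = map ((\<bullet>) (g \<otimes> h)) y then of_nat (card ?N) * F ds g else 0)"
    by (rule sum.swap)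
  also have "\<dots> = (\<Sum>h\<in>point_stabilizer. of_nat (card ?N) * F ds g)"
  proof (intro sum.cong refl)
    fix h assume h: "h \<in> point_stabilizer"
    have hc: "h \<in> carrier G"
      using h stabilizer_subset by blast
    let ?y = "map ((\<bullet>) (inv (g \<otimes> h))) ds"
    have "(?y, inv (g \<otimes> h) \<otimes> g) \<in> chains m"
      using True m g hc by (intro chains_act) auto
    then have "(?y, inv (g \<otimes> h) \<otimes> g \<otimes> h) \<in> chains m"
      by (rule chains_ract[OF h])
    then have yY: "?y \<in> ?Y"
      using g hc by (simp add: m_assoc)
    have "ds = map ((\<bullet>) (g \<otimes> h)) y \<longleftrightarrow> ?y = y" if "y \<in> ?Y" for y
      using that g hc ds by (intro map_act_inv_iff[symmetric]) (auto simp: chains_def)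
    then have "(\<Sum>y\<in>?Y. if ds = map ((\<bullet>) (g \<otimes> h)) y then of_nat (card ?N) * F ds g else 0)
        = (\<Sum>y\<in>?Y. if ?y = y then of_nat (card ?N) * F ds g else 0)"
      by (intro sum.cong refl) simp
    also have "\<dots> = of_nat (card ?N) * F ds g"
      using yY by (subst sum.delta'[OF finY]) (rule if_P)
    finally show "(\<Sum>y\<in>?Y. if ds = map ((\<bullet>) (g \<otimes> h)) y then of_nat (card ?N) * F ds g else 0)
        = of_nat (card ?N) * F ds g" .
  qed
  finally show ?thesis
    by (simp add: mult.assoc)
next
  case False
  have "transfer y \<xi> (transfer \<xi> y F) ds g = 0" if "(y, \<one>) \<in> chains m" for y
    using chain_translate[OF that m] False by (auto simp: transfer_def intro!: sum.neutral)
  then show ?thesis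
    using chain_funsD[OF F False] by simp
qed

lemma conv_sum:
  "conv r (\<lambda>cs g. c * (\<Sum>k\<in>K. F k cs g)) = (\<lambda>cs g. c * (\<Sum>k\<in>K. conv r (F k) cs g))"
proof (intro ext)
  fix cs g
  show "conv r (\<lambda>cs g. c * (\<Sum>k\<in>K. F k cs g)) cs g = c * (\<Sum>k\<in>K. conv r (F k) cs g)"
  proof (cases "set cs \<subseteq> \<Omega> \<and> g \<in> carrier G")
    case True
    then show ?thesis
      unfolding conv_def if_P[OF True] sum_distrib_left
      by (subst sum.swap) (simp add: mult.left_commute)
  next
    case False
    then show ?thesis
      unfolding conv_def if_not_P[OF False] by simp
  qed
qed

lemma rconv_sum:
  "rconv (\<lambda>cs g. c * (\<Sum>k\<in>K. F k cs g)) r = (\<lambda>cs g. c * (\<Sum>k\<in>K. rconv (F k) r cs g))"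
proof (intro ext)
  fix cs g
  show "rconv (\<lambda>cs g. c * (\<Sum>k\<in>K. F k cs g)) r cs g = c * (\<Sum>k\<in>K. rconv (F k) r cs g)"
  proof (cases "g \<in> carrier G")
    case True
    then show ?thesis
      unfolding rconv_def if_P[OF True] sum_distrib_left sum_distrib_right
      by (subst sum.swap) (simp add: mult.assoc)
  qed (auto simp: rconv_def)
qed

theorem has_depth_even:
  assumes n: "n \<ge> 1" and cs: "length cs = n - 1" "set cs \<subseteq> \<Omega>"
    and triv: "\<And>h c. h \<in> point_stabilizer \<Longrightarrow> \<forall>c\<in>set cs. h \<bullet> c = c \<Longrightarrow> c \<in> \<Omega> \<Longrightarrow> h \<bullet> c = c"
  shows "has_depth A B (2 * n)"
proof -
  \<comment> \<open>Appending \<omega> brings the length to n and meets the endpoint condition for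
    the group element \<one>.\<close>
  define \<xi> where "\<xi> = cs @ [\<omega>]"
  let ?Y = "{y. (y, \<one>) \<in> chains (n + 1)}"
  have xi: "(\<xi>, \<one>) \<in> chains n"
    using cs n by (auto simp: \<xi>_def chains_def one_act point_in)
  have xi': "set \<xi> \<subseteq> \<Omega>"
    using cs by (auto simp: \<xi>_def point_in)
  have triv': "\<forall>c\<in>\<Omega>. h \<bullet> c = c" if "h \<in> point_stabilizer" "map ((\<bullet>) h) \<xi> = \<xi>" for h
  proof -
    have "\<forall>c\<in>set \<xi>. h \<bullet> c = c"
      using that(2) by (metis map_eq_conv map_ident)
    then show ?thesis
      using triv that(1) by (auto simp: \<xi>_def)
  qed
  have "finite ?Y"
    using finite_imageI[OF finite_chains[of "n + 1"], of fst] by (rule finite_subset[rotated]) force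
  then obtain e where e: "bij_betw e {..<card ?Y} ?Y"
    using ex_bij_betw_nat_finite atLeast0LessThan by metis
  \<comment> \<open>One copy for each \<open>y\<close>, not for each orbit: depth allows any
    positive number of copies.\<close>
  define a where "a = card ?Y"
  have "replicate (n + 1) \<omega> \<in> ?Y"
    by (auto simp: chains_def point_in one_act simp del: replicate_Suc)
  then have a: "a > 0"
    using \<open>finite ?Y\<close> by (auto simp: a_def card_gt_0_iff)
  have eY: "(e k, \<one>) \<in> chains (n + 1)" if "k < a" for k
    using e that unfolding a_def bij_betw_def by blast
  define C where "C = complex_of_nat (card point_stabilizer * card {h \<in> point_stabilizer. map ((\<bullet>) h) \<xi> = \<xi>})"
  have "C \<noteq> 0"
  proof -
    have fin: "finite point_stabilizer"
      by (rule finite_subset[OF stabilizer_subset finite_carrier])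
    have "\<one> \<in> {h \<in> point_stabilizer. map ((\<bullet>) h) \<xi> = \<xi>}"
      using subgroup.one_closed[OF subgroup_stabilizer] map_act_one[OF xi'] by simp
    then show ?thesis
      using fin by (auto simp: C_def)
  qed
  let ?V = "chain_bimodule (n + 1)" and ?W = "chain_bimodule n"
  let ?i = "\<lambda>F. \<lambda>k\<in>{..<a}. transfer \<xi> (e k) F"
  let ?p = "\<lambda>w ds g. inverse C * (\<Sum>k<a. transfer (e k) \<xi> (w k) ds g)"
  have i: "transfer \<xi> (e k) \<in> bimodule_hom (carrier A) B ?V ?W" if "k < a" for k
    using transfer_hom[OF xi eY[OF that]] n by simp
  have p: "transfer (e k) \<xi> \<in> bimodule_hom (carrier A) B ?W ?V" if "k < a" for k
    using transfer_hom[OF eY[OF that] xi] n by simp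
  have "iso_direct_summand (carrier A) B (tensor_power A B (n + 1)) (direct_power a (tensor_power A B n))"
  proof (rule split_mono_direct_summand_iso)
    show "additive_biaction (carrier A) B ?V" "additive_biaction (carrier A) B ?W"
      using n by (simp_all add: additive_biaction_chain_bimodule del: carrier_A carrier_B)
    show "bimodule_iso (carrier A) B ?V (tensor_power A B (n + 1))"
      "bimodule_iso (carrier A) B ?W (tensor_power A B n)"
      using n by (simp_all only: tensor_power_iso)
    show "?i \<in> bimodule_hom (carrier A) B ?V (direct_power a ?W)"
    proof (rule bimodule_homI)
      show "?i F \<in> carrier (direct_power a ?W)" if "F \<in> carrier ?V" for F
        using bimodule_homD(1)[OF i that] by simp
      show "?i (F \<otimes>\<^bsub>?V\<^esub> F') = ?i F \<otimes>\<^bsub>direct_power a ?W\<^esub> ?i F'"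
        if "F \<in> carrier ?V" "F' \<in> carrier ?V" for F F'
        using bimodule_homD(2)[OF i that] by (auto simp: restrict_def fun_eq_iff)
      show "?i (lact ?V r F) = lact (direct_power a ?W) r (?i F)"
        if "r \<in> carrier A" "F \<in> carrier ?V" for r F
        using bimodule_homD(3)[OF i that(2,1)] by (auto simp: restrict_def fun_eq_iff simp del: carrier_A)
      show "?i (ract ?V F r) = ract (direct_power a ?W) (?i F) r"
        if "r \<in> B" "F \<in> carrier ?V" for r F
        using bimodule_homD(4)[OF i that(2,1)] by (auto simp: restrict_def fun_eq_iff simp del: carrier_B)
    qed
    show "?p \<in> bimodule_hom (carrier A) B (direct_power a ?W) ?V"
    proof (rule bimodule_homI)
      have wk: "w k \<in> carrier ?W" if "w \<in> carrier (direct_power a ?W)" "k < a" for w k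
        using that by (auto simp: PiE_iff)
      show "?p w \<in> carrier ?V" if w: "w \<in> carrier (direct_power a ?W)" for w
        using bimodule_homD(1)[OF p wk[OF w]] by (auto simp: chain_funs_def intro!: sum.neutral)
      show "?p (w \<otimes>\<^bsub>direct_power a ?W\<^esub> w') = ?p w \<otimes>\<^bsub>?V\<^esub> ?p w'"
        if w: "w \<in> carrier (direct_power a ?W)" and w': "w' \<in> carrier (direct_power a ?W)" for w w'
        using bimodule_homD(2)[OF p wk[OF w] wk[OF w']]
        by (simp add: fun_eq_iff sum.distrib distrib_left)
      show "?p (lact (direct_power a ?W) r w) = lact ?V r (?p w)"
        if r: "r \<in> carrier A" and w: "w \<in> carrier (direct_power a ?W)" for r w
        using bimodule_homD(3)[OF p wk[OF w] r]
        by (simp add: fun_eq_iff conv_sum del: carrier_A)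
      show "?p (ract (direct_power a ?W) w r) = ract ?V (?p w) r"
        if r: "r \<in> B" and w: "w \<in> carrier (direct_power a ?W)" for r w
        using bimodule_homD(4)[OF p wk[OF w] r]
        by (simp add: fun_eq_iff rconv_sum del: carrier_B)
    qed
    show "?p (?i F) = F" if F: "F \<in> carrier ?V" for F
    proof (intro ext)
      fix ds g
      have "(\<Sum>k<a. transfer (e k) \<xi> (?i F k) ds g) = (\<Sum>k<a. transfer (e k) \<xi> (transfer \<xi> (e k) F) ds g)"
        by (intro sum.cong) simp_all
      also have "\<dots> = (\<Sum>y\<in>?Y. transfer y \<xi> (transfer \<xi> y F) ds g)"
        using e unfolding a_def by (rule sum.reindex_bij_betw)
      also have "\<dots> = C * F ds g"
        unfolding C_def by (rule sum_transfer_transfer[OF _ xi' triv']) (use F in simp_all)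
      finally show "?p (?i F) ds g = F ds g"
        using \<open>C \<noteq> 0\<close> by simp
    qed
  qed (rule group_tensor_power)+
  then show ?thesis
    unfolding has_depth_def using n a by blast
qed

section \<open>The exact depth\<close>

lemma additive_biaction_regular_A: "additive_biaction B B (regular_bimodule A)"
proof (rule additive_biactionI)
  show "lact (regular_bimodule A) r (v \<otimes>\<^bsub>regular_bimodule A\<^esub> w) =
    lact (regular_bimodule A) r v \<otimes>\<^bsub>regular_bimodule A\<^esub> lact (regular_bimodule A) r w" for r v w
    by (simp add: fun_eq_iff mult_A algebra_simps case_prod_unfold sum.distrib)
  show "ract (regular_bimodule A) (v \<otimes>\<^bsub>regular_bimodule A\<^esub> w) r =
    ract (regular_bimodule A) v r \<otimes>\<^bsub>regular_bimodule A\<^esub> ract (regular_bimodule A) w r" for r v w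
    by (simp add: fun_eq_iff mult_A algebra_simps case_prod_unfold sum.distrib)
qed (simp_all add: group_regular_A del: carrier_A)

lemma mult_B_in:
  assumes "a \<in> B" "b \<in> B"
  shows "a \<otimes>\<^bsub>A\<^esub> b \<in> B"
  unfolding carrier_B
proof (intro allI impI)
  fix x assume x: "x \<notin> point_stabilizer"
  have "a y * b z = 0" if "y \<otimes> z = x" for y z
  proof (cases "y \<in> point_stabilizer")
    case True
    then have "z \<notin> point_stabilizer"
      using x that subgroup.m_closed[OF subgroup_stabilizer] by blast
    then show ?thesis
      using assms(2) unfolding carrier_B by simp
  next
    case False
    then show ?thesis
      using assms(1) unfolding carrier_B by simp
  qed
  then show "(a \<otimes>\<^bsub>A\<^esub> b) x = 0"
    unfolding mult_A by (intro sum.neutral) auto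
qed

lemma additive_biaction_regular_B:
  "additive_biaction B B (regular_bimodule (A\<lparr>carrier := B\<rparr>))" (is "additive_biaction B B ?R")
proof (rule additive_biactionI)
  show "lact ?R r (v \<otimes>\<^bsub>?R\<^esub> w) = lact ?R r v \<otimes>\<^bsub>?R\<^esub> lact ?R r w" for r v w
    by (simp add: fun_eq_iff mult_A algebra_simps case_prod_unfold sum.distrib flip: add_A)
      (simp add: fun_eq_iff mult_A algebra_simps case_prod_unfold sum.distrib)
  show "ract ?R (v \<otimes>\<^bsub>?R\<^esub> w) r = ract ?R v r \<otimes>\<^bsub>?R\<^esub> ract ?R w r" for r v w
    by (simp add: fun_eq_iff mult_A algebra_simps case_prod_unfold sum.distrib flip: add_A)
      (simp add: fun_eq_iff mult_A algebra_simps case_prod_unfold sum.distrib)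
qed (simp_all add: group_regular_B mult_B_in del: carrier_B)

text \<open>A depth below 2 n is 1, which compares levels 1 and 0; or 2 m + 1; or 2 m, which
  restriction of scalars reduces to 2 m + 1. In every case the levels compared are
  \<open>Suc m\<close> and \<open>m\<close> with m < n, where \<open>lower\<close> supplies
  characters.\<close>

theorem ordinary_depth_even:
  assumes n: "n \<ge> 1" and cs: "length cs = n - 1" "set cs \<subseteq> \<Omega>"
    and triv: "\<And>h c. h \<in> point_stabilizer \<Longrightarrow> \<forall>c\<in>set cs. h \<bullet> c = c \<Longrightarrow> c \<in> \<Omega> \<Longrightarrow> h \<bullet> c = c"
    and lower: "\<And>m. m < n \<Longrightarrow> \<exists>U \<psi> \<psi>'. linear_character U \<psi> \<and> linear_character U \<psi>' \<and>
      U \<subseteq> point_stabilizer \<and> separates m U \<psi> \<psi>' \<and> \<not> separates (Suc m) U \<psi> \<psi>'"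
  shows "ordinary_depth point_stabilizer G = 2 * n"
proof -
  have no_power: "\<not> iso_direct_summand B B (tensor_power A B (Suc m)) (direct_power a (tensor_power A B m))"
    if m: "m > 0" "m < n" for m a
  proof -
    obtain U \<psi> \<psi>' where U: "linear_character U \<psi>" "linear_character U \<psi>'" "U \<subseteq> point_stabilizer"
      "separates m U \<psi> \<psi>'" "\<not> separates (Suc m) U \<psi> \<psi>'"
      using lower[OF m(2)] by blast
    have act: "additive_biaction B B (chain_bimodule k)" for k
      by (rule additive_biaction_chain_bimodule[OF B_subset_A]) simp
    have iso: "bimodule_iso B B (chain_bimodule k) (tensor_power A B k)" if "k > 0" for k
      by (rule bimodule_iso_subset[OF tensor_power_iso[OF that] B_subset_A order_refl])
    show ?thesis
      by (rule not_direct_summand_power[OF U group_tensor_power group_tensor_power iso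
            bimodule_iso_sym[OF act iso[OF m(1)]] additive_biaction_iso[OF act group_tensor_power iso[OF m(1)]]])
        simp
  qed
  have no_depth_1: "\<not> iso_direct_summand B B (regular_bimodule A)
      (direct_power a (regular_bimodule (A\<lparr>carrier := B\<rparr>)))" for a
  proof -
    obtain U \<psi> \<psi>' where U: "linear_character U \<psi>" "linear_character U \<psi>'" "U \<subseteq> point_stabilizer"
      "separates 0 U \<psi> \<psi>'" "\<not> separates (Suc 0) U \<psi> \<psi>'"
      using lower[of 0] n by auto
    show ?thesis
      using not_direct_summand_power[OF U group_regular_A group_regular_B _ regular_B_iso additive_biaction_regular_B]
        bimodule_iso_sym[OF additive_biaction_regular_A regular_A_iso] by simp
  qed
  have "has_depth A B (2 * n)"
    by (rule has_depth_even[OF n cs triv])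
  moreover have "2 * n \<le> k" if k: "1 \<le> k" "has_depth A B k" for k
  proof (rule ccontr)
    assume less: "\<not> 2 * n \<le> k"
    from k(2) show False
      unfolding has_depth_def
    proof (elim disjE conjE exE)
      fix a assume "iso_direct_summand B B (regular_bimodule A)
        (direct_power a (regular_bimodule (A\<lparr>carrier := B\<rparr>)))"
      then show False
        using no_depth_1 by contradiction
    next
      fix m a assume "1 \<le> m" "k = 2 * m" and summand: "iso_direct_summand (carrier A) B
        (tensor_power A B (m + 1)) (direct_power a (tensor_power A B m))"
      moreover have "iso_direct_summand B B (tensor_power A B (m + 1)) (direct_power a (tensor_power A B m))"
        by (rule iso_direct_summand_subset[OF summand B_subset_A order_refl])
      ultimately show False
        using no_power[of m a] less by simp
    next
      fix m a assume "1 \<le> m" "k = 2 * m + 1" "iso_direct_summand B B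
        (tensor_power A B (m + 1)) (direct_power a (tensor_power A B m))"
      then show False
        using no_power[of m a] less by simp
    qed
  qed
  ultimately show ?thesis
    unfolding ordinary_depth_def using n by (intro Least_equality) auto
qed

end

section \<open>Automorphisms of a rooted tree\<close>

text \<open>The blocks of sizes two and four are the fibers of \<open>x div 2\<close> and \<open>x div 4\<close>.\<close>

definition tree_perms :: "nat \<Rightarrow> (nat \<Rightarrow> nat) set" where
  "tree_perms n = {p. p permutes {..<4 * n} \<and>
     (\<forall>x y. p x div 2 = p y div 2 \<longleftrightarrow> x div 2 = y div 2) \<and>
     (\<forall>x y. p x div 4 = p y div 4 \<longleftrightarrow> x div 4 = y div 4)}"

lemma tree_permsD:
  assumes "p \<in> tree_perms n"
  shows "p permutes {..<4 * n}"
    and "p x div 2 = p y div 2 \<longleftrightarrow> x div 2 = y div 2"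
    and "p x div 4 = p y div 4 \<longleftrightarrow> x div 4 = y div 4"
    and "p x = p y \<longleftrightarrow> x = y"
    and "x < 4 * n \<Longrightarrow> p x < 4 * n"
    and "x \<ge> 4 * n \<Longrightarrow> p x = x"
proof -
  show p: "p permutes {..<4 * n}"
    and "p x div 2 = p y div 2 \<longleftrightarrow> x div 2 = y div 2"
    and "p x div 4 = p y div 4 \<longleftrightarrow> x div 4 = y div 4"
    using assms by (auto simp: tree_perms_def)
  show "p x = p y \<longleftrightarrow> x = y"
    using permutes_inj[OF p] by (auto dest: injD)
  show "x < 4 * n \<Longrightarrow> p x < 4 * n"
    using permutes_in_image[OF p] by simp
  show "x \<ge> 4 * n \<Longrightarrow> p x = x"
    using permutes_not_in[OF p] by simp
qed

lemma tree_perms_id: "id \<in> tree_perms n"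
  by (simp add: tree_perms_def permutes_id)

lemma tree_perms_comp:
  assumes p: "p \<in> tree_perms n" and q: "q \<in> tree_perms n"
  shows "p \<circ> q \<in> tree_perms n"
  using permutes_compose[OF tree_permsD(1)[OF q] tree_permsD(1)[OF p]]
  by (simp add: tree_perms_def tree_permsD(2,3)[OF p] tree_permsD(2,3)[OF q])

lemma tree_perms_inv:
  assumes p: "p \<in> tree_perms n"
  shows "inv_into UNIV p \<in> tree_perms n"
proof -
  have eq: "p (inv_into UNIV p x) = x" for x
    using permutes_inverses(1)[OF tree_permsD(1)[OF p]] .
  show ?thesis
    using permutes_inv[OF tree_permsD(1)[OF p]] tree_permsD(2,3)[OF p, of "inv_into UNIV p _" "inv_into UNIV p _"]
    by (simp add: tree_perms_def eq)
qed

lemma finite_tree_perms: "finite (tree_perms n)"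
  by (rule finite_subset[OF _ finite_permutations[of "{..<4 * n}"]]) (auto simp: tree_perms_def)

text \<open>For an involution each implication yields its converse when applied to
  \<open>p x\<close> and \<open>p y\<close>.\<close>

lemma tree_perms_involution:
  assumes inv: "\<And>x. p (p x) = x" and out: "\<And>x. x \<ge> 4 * n \<Longrightarrow> p x = x"
    and 2: "\<And>x y. x div 2 = y div 2 \<Longrightarrow> p x div 2 = p y div 2"
    and 4: "\<And>x y. x div 4 = y div 4 \<Longrightarrow> p x div 4 = p y div 4"
  shows "p \<in> tree_perms n"
proof -
  have "p permutes {..<4 * n}"
    unfolding permutes_def
  proof (intro conjI allI impI)
    show "p x = x" if "x \<notin> {..<4 * n}" for x
      using that by (intro out) simp
    show "\<exists>!x. p x = y" for y
    proof (rule ex1I)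
      show "p (p y) = y" by (rule inv)
      show "x = p y" if "p x = y" for x
        using inv[of x] that by simp
    qed
  qed
  moreover have "p x div 2 = p y div 2 \<longleftrightarrow> x div 2 = y div 2" for x y
    using 2[of x y] 2[of "p x" "p y"] unfolding inv by blast
  moreover have "p x div 4 = p y div 4 \<longleftrightarrow> x div 4 = y div 4" for x y
    using 4[of x y] 4[of "p x" "p y"] unfolding inv by blast
  ultimately show ?thesis
    by (simp add: tree_perms_def)
qed

section \<open>Explicit tree automorphisms\<close>

definition swap_blocks :: "nat \<Rightarrow> nat \<Rightarrow> nat" where
  "swap_blocks i x = (if x div 4 = i then x mod 4 else if x div 4 = 0 then 4 * i + x else x)"

definition swap_halves :: "nat \<Rightarrow> nat \<Rightarrow> nat" where
  "swap_halves i x = (if x div 4 = i then if x mod 4 < 2 then x + 2 else x - 2 else x)"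

definition swap_points :: "nat \<Rightarrow> nat" where
  "swap_points x = (if x = 0 then 1 else if x = 1 then 0 else x)"

lemma swap_blocks_div_4:
  "swap_blocks i x div 4 = (if x div 4 = i then 0 else if x div 4 = 0 then i else x div 4)"
  by (simp add: swap_blocks_def)

lemma swap_blocks_div_2:
  "swap_blocks i x div 2 = (if x div 4 = i then x div 2 mod 2 else if x div 4 = 0 then 2 * i + x div 2 else x div 2)"
proof -
  have "x mod 4 div 2 = x div 2 mod 2"
    by presburger
  moreover have "(4 * i + x) div 2 = 2 * i + x div 2"
    by presburger
  ultimately show ?thesis
    by (simp add: swap_blocks_def)
qed

lemma div_2_imp_div_4: "x div 2 = y div 2 \<Longrightarrow> x div 4 = y div 4" for x y :: nat
  using div_mult2_eq[of x 2 2] div_mult2_eq[of y 2 2] by simp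

lemma swap_blocks_in:
  assumes i: "i < n"
  shows "swap_blocks i \<in> tree_perms n"
proof (rule tree_perms_involution)
  show "swap_blocks i (swap_blocks i x) = x" for x
  proof (cases "x div 4 = i \<or> x div 4 = 0")
    case True
    then show ?thesis
      using div_mult_mod_eq[of x 4] unfolding swap_blocks_def[of i "swap_blocks i x"] swap_blocks_div_4
      by (auto simp: swap_blocks_def)
  next
    case False
    then show ?thesis
      by (simp add: swap_blocks_def)
  qed
  show "swap_blocks i x = x" if "x \<ge> 4 * n" for x
  proof -
    have "x div 4 \<ge> n"
      using that by (simp add: less_eq_div_iff_mult_less_eq mult.commute)
    then show ?thesis
      using i by (simp add: swap_blocks_def)
  qed
  show "swap_blocks i x div 2 = swap_blocks i y div 2" if "x div 2 = y div 2" for x y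
    using that div_2_imp_div_4[OF that] by (simp add: swap_blocks_div_2)
  show "swap_blocks i x div 4 = swap_blocks i y div 4" if "x div 4 = y div 4" for x y
    using that by (simp add: swap_blocks_div_4)
qed

lemma swap_halves_eq:
  "r < 4 \<Longrightarrow> swap_halves i (4 * a + r) = 4 * a + (if a = i then if r < 2 then r + 2 else r - 2 else r)"
  by (simp add: swap_halves_def)

lemma quotient_remainder_4:
  obtains a r :: nat where "x = 4 * a + r" "r < 4"
  using that[of "x div 4" "x mod 4"] by simp

lemma swap_halves_div_2:
  "swap_halves i x div 2 = (if x div 4 = i then if x div 2 mod 2 = 0 then x div 2 + 1 else x div 2 - 1 else x div 2)"
proof -
  have "x mod 4 < 2 \<longleftrightarrow> x div 2 mod 2 = 0"
    by presburger
  moreover have "(x - 2) div 2 = x div 2 - 1"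
    by presburger
  ultimately show ?thesis
    by (simp add: swap_halves_def)
qed

lemma swap_halves_div_4: "swap_halves i x div 4 = x div 4"
  by (rule quotient_remainder_4[of x]) (simp add: swap_halves_eq)

lemma swap_halves_in:
  assumes i: "i < n"
  shows "swap_halves i \<in> tree_perms n"
proof (rule tree_perms_involution)
  show "swap_halves i (swap_halves i x) = x" for x
  proof (rule quotient_remainder_4[of x])
    fix a r assume x: "x = 4 * a + r" "r < 4"
    then have "\<not> r < 2 \<Longrightarrow> r - 2 < 2 \<and> Suc (Suc (r - 2)) = r"
      by arith
    with x show "swap_halves i (swap_halves i x) = x"
      using swap_halves_eq[of r i a] swap_halves_eq[of "r + 2" i a] swap_halves_eq[of "r - 2" i a]
      by (cases "r < 2"; cases "a = i") simp_all
  qed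
  show "swap_halves i x = x" if "x \<ge> 4 * n" for x
  proof -
    have "x div 4 \<ge> n"
      using that by (simp add: less_eq_div_iff_mult_less_eq mult.commute)
    then show ?thesis
      using i by (simp add: swap_halves_def)
  qed
  show "swap_halves i x div 2 = swap_halves i y div 2" if "x div 2 = y div 2" for x y
    using that div_2_imp_div_4[OF that] by (simp add: swap_halves_div_2)
  show "swap_halves i x div 4 = swap_halves i y div 4" if "x div 4 = y div 4" for x y
    using that by (simp add: swap_halves_div_4)
qed

lemma swap_points_div: "swap_points x div 2 = x div 2"
  unfolding swap_points_def by presburger

lemma swap_points_in: "0 < n \<Longrightarrow> swap_points \<in> tree_perms n"
proof (rule tree_perms_involution)
  assume n: "0 < n"
  show "swap_points (swap_points x) = x" for x
    by (auto simp: swap_points_def)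
  show "swap_points x = x" if "x \<ge> 4 * n" for x
    using that n by (auto simp: swap_points_def)
  show "swap_points x div 2 = swap_points y div 2" if "x div 2 = y div 2" for x y
    using that by (simp add: swap_points_div)
  show "swap_points x div 4 = swap_points y div 4" if "x div 4 = y div 4" for x y
    using div_2_imp_div_4[OF swap_points_div, of x] div_2_imp_div_4[OF swap_points_div, of y] that by simp
qed

section \<open>Signs on the halves and on the points of a block\<close>

definition half_sign :: "nat \<Rightarrow> (nat \<Rightarrow> nat) \<Rightarrow> complex" where
  "half_sign i p = (if p (4 * i) div 2 = 2 * i then 1 else - 1)"

definition point_sign :: "nat \<Rightarrow> (nat \<Rightarrow> nat) \<Rightarrow> complex" where
  "point_sign j p = (if p (2 * j) = 2 * j then 1 else - 1)"

text \<open>A permutation that preserves a block of size four fixes or exchanges its two halves, and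
  the sign of this is multiplicative. The assumptions \<open>pb\<close> and \<open>qb\<close>
  exclude that the value -1 stands for a block that moved away.\<close>

lemma half_sign_comp:
  assumes p: "p \<in> tree_perms n" and q: "q \<in> tree_perms n"
    and pb: "\<And>x. p x div 4 = x div 4" and qb: "\<And>x. q x div 4 = x div 4"
  shows "half_sign i (p \<circ> q) = half_sign i p * half_sign i q"
proof -
  have half: "x div 2 = 2 * i \<or> x div 2 = 2 * i + 1" if "x div 4 = i" for x
    using that by presburger
  have q: "q (4 * i) div 2 = 2 * i \<or> q (4 * i) div 2 = 2 * i + 1"
    by (rule half) (simp add: qb)
  have p0: "p (4 * i) div 2 = 2 * i \<or> p (4 * i) div 2 = 2 * i + 1"
    by (rule half) (simp add: pb)
  have p1: "p (q (4 * i)) div 2 = 2 * i \<or> p (q (4 * i)) div 2 = 2 * i + 1"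
    by (rule half) (simp add: pb qb)
  have "p (q (4 * i)) div 2 = p (4 * i) div 2 \<longleftrightarrow> q (4 * i) div 2 = 2 * i"
    using tree_permsD(2)[OF p, of "q (4 * i)" "4 * i"] by simp
  then show ?thesis
    using q p0 p1 by (auto simp: half_sign_def)
qed

lemma point_sign_comp:
  assumes p: "p \<in> tree_perms n" and q: "q \<in> tree_perms n"
    and pb: "p (2 * j) div 2 = j" and qb: "q (2 * j) div 2 = j"
  shows "point_sign j (p \<circ> q) = point_sign j p * point_sign j q"
proof -
  have pt: "x = 2 * j \<or> x = 2 * j + 1" if "x div 2 = j" for x
    using that by presburger
  have q: "q (2 * j) = 2 * j \<or> q (2 * j) = 2 * j + 1"
    by (rule pt) (simp add: qb)
  have p0: "p (2 * j) = 2 * j \<or> p (2 * j) = 2 * j + 1"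
    by (rule pt) (simp add: pb)
  have "p (q (2 * j)) div 2 = p (2 * j) div 2"
    using tree_permsD(2)[OF p, of "q (2 * j)" "2 * j"] qb by simp
  then have p1: "p (q (2 * j)) = 2 * j \<or> p (q (2 * j)) = 2 * j + 1"
    by (intro pt) (simp add: pb)
  have "p (q (2 * j)) = p (2 * j) \<longleftrightarrow> q (2 * j) = 2 * j"
    by (rule tree_permsD(4)[OF p])
  then show ?thesis
    using q p0 p1 by (auto simp: point_sign_def)
qed

section \<open>The group and its action on the blocks of size two\<close>

locale tree_group = group G for G :: "nat monoid" (structure) +
  fixes \<rho> :: "nat \<Rightarrow> nat \<Rightarrow> nat" and n :: nat
  assumes pos: "n \<ge> 1"
    and bij: "bij_betw \<rho> (carrier G) (tree_perms n)"
    and rho_mult: "x \<in> carrier G \<Longrightarrow> y \<in> carrier G \<Longrightarrow> \<rho> (x \<otimes> y) = \<rho> x \<circ> \<rho> y"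
    and rho_one: "\<rho> \<one> = id"
begin

lemma rho_in: "x \<in> carrier G \<Longrightarrow> \<rho> x \<in> tree_perms n"
  using bij by (rule bij_betw_apply)

lemma rho_surj:
  assumes "p \<in> tree_perms n"
  obtains x where "x \<in> carrier G" "\<rho> x = p"
proof -
  have "p \<in> \<rho> ` carrier G"
    using bij_betw_imp_surj_on[OF bij] assms by simp
  then obtain x where "p = \<rho> x" "x \<in> carrier G"
    by (rule imageE)
  then show ?thesis
    using that[of x] by simp
qed

lemma rho_inv:
  assumes "x \<in> carrier G"
  shows "\<rho> (inv x) (\<rho> x z) = z" "\<rho> x (\<rho> (inv x) z) = z"
proof -
  have "\<rho> (inv x) \<circ> \<rho> x = id" "\<rho> x \<circ> \<rho> (inv x) = id"
    using rho_mult[of "inv x" x] rho_mult[of x "inv x"] rho_one assms by simp_all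
  then show "\<rho> (inv x) (\<rho> x z) = z" "\<rho> x (\<rho> (inv x) z) = z"
    by (simp_all add: fun_eq_iff)
qed

text \<open>A block of size two is named by half its even element, which also serves as its
  representative; preservation of blocks makes the choice immaterial.\<close>

definition act :: "nat \<Rightarrow> nat \<Rightarrow> nat" where "act x c = \<rho> x (2 * c) div 2"

lemma act_mult: "x \<in> carrier G \<Longrightarrow> y \<in> carrier G \<Longrightarrow> act (x \<otimes> y) c = act x (act y c)"
  using tree_permsD(2)[OF rho_in, of x "\<rho> y (2 * c)" "2 * (\<rho> y (2 * c) div 2)"]
  by (simp add: act_def rho_mult)

text \<open>An even \<open>c\<close> is the first half of its block of size four and is reached by
  exchanging that block with block 0. For an odd \<open>c\<close> the halves of block 0 are
  exchanged beforehand.\<close>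

lemma transitive:
  assumes "c < 2 * n"
  shows "\<exists>x\<in>carrier G. act x 0 = c"
proof -
  let ?i = "c div 2"
  have i: "?i < n"
    using assms by auto
  obtain x where x: "x \<in> carrier G" "\<rho> x = swap_blocks ?i"
    using rho_surj[OF swap_blocks_in[OF i]] .
  have "0 < n"
    using pos by simp
  then obtain y where y: "y \<in> carrier G" "\<rho> y = swap_halves 0"
    using rho_surj[OF swap_halves_in] by blast
  show ?thesis
  proof (cases "even c")
    case True
    then have "act x 0 = c"
      by (auto simp: act_def x swap_blocks_def)
    then show ?thesis
      using x by blast
  next
    case False
    then have c: "c = 2 * ?i + 1"
      by simp
    have "swap_halves 0 0 = 2"
      by (simp add: swap_halves_def)
    then have "act (x \<otimes> y) 0 = swap_blocks ?i 2 div 2"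
      by (simp add: act_def x y rho_mult)
    also have "\<dots> = 2 * ?i + 1"
      by (simp add: swap_blocks_div_2)
    finally have "act (x \<otimes> y) 0 = c"
      using c by (rule trans[OF _ sym])
    then show ?thesis
      using x y by blast
  qed
qed

sublocale finite_transitive_action G act "{..<2 * n}" 0
proof unfold_locales
  show "finite (carrier G)"
    using bij_betw_finite[OF bij] finite_tree_perms by blast
  show "act x c \<in> {..<2 * n}" if "x \<in> carrier G" "c \<in> {..<2 * n}" for x c
    using tree_permsD(5)[OF rho_in[OF that(1)], of "2 * c"] that(2) by (auto simp: act_def)
  show "act (x \<otimes> y) c = act x (act y c)" if "x \<in> carrier G" "y \<in> carrier G" for x y c
    by (rule act_mult[OF that])
  show "\<exists>x\<in>carrier G. act x 0 = c" if "c \<in> {..<2 * n}" for c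
    using that by (intro transitive) simp
  show "act \<one> c = c" for c
    by (simp add: act_def rho_one)
  show "0 \<in> {..<2 * n}"
    using pos by simp
qed

lemma in_stabilizer_iff: "x \<in> point_stabilizer \<longleftrightarrow> x \<in> carrier G \<and> \<rho> x 0 div 2 = 0"
  by (simp add: point_stabilizer_def act_def)

text \<open>Every block of size four stays in place, so that all signs on halves are multiplicative.
  Keeping {0, 1} then forces {2, 3} to be kept as well, which makes both point signs
  multiplicative.\<close>

definition block_group :: "nat set" where
  "block_group = {x \<in> carrier G. \<rho> x 0 div 2 = 0 \<and> (\<forall>z. \<rho> x z div 4 = z div 4)}"

lemma block_group_subset: "block_group \<subseteq> point_stabilizer"
  by (auto simp: block_group_def in_stabilizer_iff)

lemma block_groupD:
  assumes "x \<in> block_group"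
  shows "x \<in> carrier G" "\<rho> x \<in> tree_perms n" "\<rho> x 0 div 2 = 0" "\<rho> x z div 4 = z div 4"
    "\<rho> x 2 div 2 = 1"
proof -
  show x: "x \<in> carrier G" "\<rho> x 0 div 2 = 0" and 4: "\<rho> x z div 4 = z div 4" for z
    using assms by (auto simp: block_group_def)
  show p: "\<rho> x \<in> tree_perms n"
    by (rule rho_in[OF x(1)])
  have "\<rho> x 2 div 2 \<noteq> 0"
    using tree_permsD(2)[OF p, of 2 0] x(2) by simp
  moreover have "\<rho> x 2 < 4"
    using 4[of 2] by simp
  ultimately show "\<rho> x 2 div 2 = 1"
    by linarith
qed

lemma subgroup_block_group: "subgroup block_group G"
proof
  show "x \<otimes> y \<in> block_group" if x: "x \<in> block_group" and y: "y \<in> block_group" for x y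
  proof -
    have "\<rho> x (\<rho> y 0) div 2 = \<rho> x 0 div 2"
      using tree_permsD(2)[OF block_groupD(2)[OF x], of "\<rho> y 0" 0] block_groupD(3)[OF y] by simp
    then show ?thesis
      using block_groupD[OF x] block_groupD[OF y] by (simp add: block_group_def rho_mult)
  qed
  show "inv x \<in> block_group" if x: "x \<in> block_group" for x
  proof -
    note X = block_groupD[OF x]
    have "\<rho> (inv x) z div 4 = z div 4" for z
      using X(4)[of "\<rho> (inv x) z"] by (simp add: rho_inv[OF X(1)])
    moreover have "\<rho> (inv x) 0 div 2 = 0"
      using tree_permsD(2)[OF X(2), of "\<rho> (inv x) 0" 0] X(3) by (simp add: rho_inv[OF X(1)])
    ultimately show ?thesis
      using X(1) by (simp add: block_group_def)
  qed
qed (auto simp: block_group_def rho_one)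

text \<open>
  The second character uses the block \<open>{2, 3}\<close> instead of \<open>{0, 1}\<close>, so that the two are
  distinct also for \<open>m = 0\<close>.
\<close>

definition \<psi> :: "nat \<Rightarrow> complex" where "\<psi> x = point_sign 0 (\<rho> x)"

definition \<psi>' :: "nat \<Rightarrow> nat \<Rightarrow> complex" where
  "\<psi>' m x = point_sign 1 (\<rho> x) * (\<Prod>i\<in>{1..m}. half_sign i (\<rho> x))"

lemma linear_character_psi: "linear_character block_group \<psi>"
proof -
  have "\<psi> (x \<otimes> y) = \<psi> x * \<psi> y" if x: "x \<in> block_group" and y: "y \<in> block_group" for x y
    using point_sign_comp[OF block_groupD(2)[OF x] block_groupD(2)[OF y], of 0]
      block_groupD(1,3)[OF x] block_groupD(1,3)[OF y] by (simp add: \<psi>_def rho_mult)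
  then show ?thesis
    using subgroup_block_group by (simp add: linear_character_def \<psi>_def rho_one point_sign_def)
qed

lemma linear_character_psi': "linear_character block_group (\<psi>' m)"
proof -
  have "\<psi>' m (x \<otimes> y) = \<psi>' m x * \<psi>' m y" if x: "x \<in> block_group" and y: "y \<in> block_group" for x y
  proof -
    have "point_sign 1 (\<rho> x \<circ> \<rho> y) = point_sign 1 (\<rho> x) * point_sign 1 (\<rho> y)"
      using point_sign_comp[OF block_groupD(2)[OF x] block_groupD(2)[OF y], of 1]
        block_groupD(5)[OF x] block_groupD(5)[OF y] by simp
    moreover have "half_sign i (\<rho> x \<circ> \<rho> y) = half_sign i (\<rho> x) * half_sign i (\<rho> y)" for i
      by (rule half_sign_comp[OF block_groupD(2)[OF x] block_groupD(2)[OF y]])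
        (rule block_groupD(4)[OF x] block_groupD(4)[OF y])+
    ultimately show ?thesis
      using block_groupD(1)[OF x] block_groupD(1)[OF y]
      by (simp add: \<psi>'_def rho_mult prod.distrib)
  qed
  then show ?thesis
    using subgroup_block_group
    by (simp add: linear_character_def \<psi>'_def rho_one point_sign_def half_sign_def)
qed

lemma rho_conj:
  assumes "g \<in> carrier G" "u \<in> carrier G"
  shows "\<rho> g (\<rho> (inv g \<otimes> u \<otimes> g) z) = \<rho> u (\<rho> g z)"
  using assms by (simp add: rho_mult rho_inv)

text \<open>The point signs leave only those \<open>g\<close> that carry {2, 3} to {0, 1}. For them
  the last entry of \<open>cs\<close> lies in block 0, while the m blocks tested by the second
  character are carried to other blocks. The remaining m - 1 entries miss one of these, and
  exchanging its halves is detected.\<close>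

lemma separates_psi:
  assumes m: "m < n"
  shows "separates m block_group \<psi> (\<psi>' m)"
  unfolding separates_def
proof (clarify)
  fix cs g assume chain: "(cs, g) \<in> chains m"
  then have len: "length cs = m" and g: "g \<in> carrier G" and last: "last (0 # cs) = \<rho> g 0 div 2"
    by (auto simp: chains_def act_def)
  note g2 = tree_permsD(2)[OF rho_in[OF g]] and g4 = tree_permsD(3)[OF rho_in[OF g]]
    and g1 = tree_permsD(4)[OF rho_in[OF g]]
  show "\<exists>u\<in>block_group. map (act u) cs = cs \<and> inv g \<otimes> u \<otimes> g \<in> block_group \<and> \<psi> u \<noteq> \<psi>' m (inv g \<otimes> u \<otimes> g)"
  proof (cases "\<rho> g 2 div 2 = 0")
    \<comment> \<open>Swapping 0 and 1 keeps every block of size two, and its conjugate by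
      \<open>g\<close> swaps two points outside {2, 3}; so only the first character sees it.\<close>
    case False
    obtain u where u: "u \<in> carrier G" "\<rho> u = swap_points"
      using rho_surj swap_points_in[of n] pos by auto
    let ?v = "inv g \<otimes> u \<otimes> g"
    have v: "?v \<in> carrier G" and conj: "\<rho> g (\<rho> ?v z) = swap_points (\<rho> g z)" for z
      using rho_conj[OF g u(1)] u g by simp_all
    have v2: "\<rho> ?v z div 2 = z div 2" for z
      using g2[of "\<rho> ?v z" z] by (simp add: conj swap_points_div)
    have "swap_points (\<rho> g 2) = \<rho> g 2"
      using False by (auto simp: swap_points_def)
    then have "\<rho> ?v 2 = 2"
      using g1[of "\<rho> ?v 2" 2] by (simp add: conj)
    then have "\<psi>' m ?v = 1"
      by (simp add: \<psi>'_def point_sign_def half_sign_def v2)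
    moreover have "\<psi> u = - 1"
      by (simp add: \<psi>_def point_sign_def u swap_points_def)
    moreover have "u \<in> block_group" "?v \<in> block_group"
      using u v by (simp_all add: block_group_def v2 swap_points_div div_2_imp_div_4[OF v2]
          div_2_imp_div_4[OF swap_points_div])
    moreover have "map (act u) cs = cs"
      by (rule map_idI) (simp add: act_def u swap_points_div)
    ultimately show ?thesis
      by (intro bexI[of _ u]) simp_all
  next
    case True
    have g24: "\<rho> g 2 div 4 = 0"
      using True by simp
    then have g04: "\<rho> g 0 div 4 = 0"
      using g4[of 0 2] by simp
    have "\<rho> g 0 div 2 \<noteq> 0"
      using g2[of 0 2] True by simp
    \<comment> \<open>An empty chain would mean that \<open>g\<close> keeps {0, 1}, contrary to the
      image of {2, 3}. This settles m = 0.\<close>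
    then have ne: "cs \<noteq> []"
      using last by auto
    \<comment> \<open>\<open>S\<close> collects the images under \<open>g\<close> of the tested
      blocks of size four, \<open>R\<close> the blocks of size four met by the chain.\<close>
    define S where "S = (\<lambda>i. \<rho> g (4 * i) div 4) ` {1..m}"
    define R where "R = (\<lambda>c. c div 2) ` set cs"
    have "inj_on (\<lambda>i. \<rho> g (4 * i) div 4) {1..m}"
    proof (rule inj_onI)
      fix i j assume "\<rho> g (4 * i) div 4 = \<rho> g (4 * j) div 4"
      then have "4 * i div 4 = 4 * j div 4"
        by (simp only: g4)
      then show "i = j"
        by simp
    qed
    then have card_S: "card S = m"
      by (simp add: S_def card_image)
    have S0: "0 \<notin> S"
    proof
      assume "0 \<in> S"
      then obtain i where i: "0 = \<rho> g (4 * i) div 4" "i \<in> {1..m}"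
        unfolding S_def by (rule imageE)
      then have "\<rho> g (4 * i) div 4 = \<rho> g 0 div 4"
        using g04 by (simp only:)
      then have "4 * i div 4 = 0 div 4"
        by (simp only: g4)
      then show False
        using i(2) by simp
    qed
    have "last cs = \<rho> g 0 div 2"
      using last ne by simp
    then have "last cs div 2 = 0"
      using g04 div_mult2_eq[of "\<rho> g 0" 2 2] by simp
    then have R0: "0 \<in> R"
      unfolding R_def by (intro image_eqI[OF _ last_in_set[OF ne]]) simp
    have card_R: "card R \<le> m"
      unfolding R_def using card_image_le[of "set cs" "\<lambda>c. c div 2"] card_length[of cs] len by simp
    have "\<not> S \<subseteq> R"
    proof
      assume "S \<subseteq> R"
      \<comment> \<open>Block 0 is met by the last entry but is not in \<open>S\<close>, so covering
        \<open>S\<close> would take m + 1 blocks from only m entries.\<close>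
      then have "card (insert 0 S) \<le> card R"
        using R0 by (intro card_mono) (auto simp: R_def)
      then show False
        using card_S S0 card_R by (simp add: S_def)
    qed
    then obtain i where i: "i \<in> {1..m}" and iR: "\<rho> g (4 * i) div 4 \<notin> R"
      unfolding S_def by blast
    define s where "s = \<rho> g (4 * i) div 4"
    have "\<rho> g (4 * i) < 4 * n"
      using i m by (intro tree_permsD(5)[OF rho_in[OF g]]) simp
    then have s_less: "s < n"
      by (simp add: s_def less_mult_imp_div_less mult.commute)
    have sR: "s \<notin> R"
      using iR by (simp only: s_def not_False_eq_True)
    then have s: "s < n" "s \<noteq> 0"
      using R0 s_less by metis+
    obtain u where u: "u \<in> carrier G" "\<rho> u = swap_halves s"
      using rho_surj swap_halves_in[OF s(1)] by auto
    let ?v = "inv g \<otimes> u \<otimes> g"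
    have v: "?v \<in> carrier G" and conj: "\<rho> g (\<rho> ?v z) = swap_halves s (\<rho> g z)" for z
      using rho_conj[OF g u(1)] u g by simp_all
    have v4: "\<rho> ?v z div 4 = z div 4" for z
      using g4[of "\<rho> ?v z" z] by (simp add: conj swap_halves_div_4)
    have v_fix: "\<rho> ?v z = z" if "\<rho> g z div 4 \<noteq> s" for z
      using g1[of "\<rho> ?v z" z] that by (simp add: conj swap_halves_def)
    have v0: "\<rho> ?v 0 = 0" "\<rho> ?v 2 = 2"
      using v_fix g04 g24 s(2) by auto
    have "half_sign j (\<rho> ?v) = (if j = i then - 1 else 1)" for j
    proof (cases "j = i")
      case True
      have "swap_halves s (\<rho> g (4 * i)) div 2 \<noteq> \<rho> g (4 * i) div 2"
        using swap_halves_div_2[of s "\<rho> g (4 * i)"] by (auto simp: s_def split: if_splits)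
      then have "\<rho> ?v (4 * i) div 2 \<noteq> 4 * i div 2"
        using g2[of "\<rho> ?v (4 * i)" "4 * i"] by (simp add: conj)
      then show ?thesis
        using True by (simp add: half_sign_def)
    next
      case False
      then have "\<rho> g (4 * j) div 4 \<noteq> s"
        using g4[of "4 * j" "4 * i"] by (simp add: s_def)
      then show ?thesis
        using False v_fix by (simp add: half_sign_def)
    qed
    then have "\<psi>' m ?v = - 1"
      using i by (simp add: \<psi>'_def point_sign_def v0)
    moreover have "\<psi> u = 1"
      using s(2) by (simp add: \<psi>_def point_sign_def u swap_halves_def)
    moreover have "u \<in> block_group" "?v \<in> block_group"
      using u v v4 v0 s(2) by (simp_all add: block_group_def swap_halves_div_4) (simp add: swap_halves_def)
    moreover have "map (act u) cs = cs"
    proof (rule map_idI)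
      fix c assume "c \<in> set cs"
      then have "c div 2 \<in> R"
        by (simp add: R_def)
      then have "c div 2 \<noteq> s"
        using sR by metis
      then have "(2 * c) div 4 \<noteq> s"
        using div_mult2_eq[of "2 * c" 2 2] by simp
      then show "act u c = c"
        by (simp add: act_def u swap_halves_def)
    qed
    ultimately show ?thesis
      by (intro bexI[of _ u]) simp_all
  qed
qed

text \<open>One more entry protects all m tested blocks: the chain lists their first halves and ends
  in the image of \<omega> under the exchange of halves in block 0. That exchange carries {2, 3} to
  {0, 1}, so the two point signs coincide and the signs on halves are 1.\<close>

lemma not_separates_psi:
  assumes m: "m < n"
  shows "\<not> separates (Suc m) block_group \<psi> (\<psi>' m)"
proof
  assume sep: "separates (Suc m) block_group \<psi> (\<psi>' m)"
  obtain g where g: "g \<in> carrier G" "\<rho> g = swap_halves 0"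
    using rho_surj swap_halves_in[of 0 n] m by auto
  let ?cs = "map (\<lambda>i. 2 * i) [1..<Suc m] @ [1]"
  have gv: "\<rho> g 0 = 2" "\<rho> g 2 = 0" "i \<noteq> 0 \<Longrightarrow> \<rho> g (4 * i) = 4 * i" for i
    by (auto simp: g swap_halves_def)
  have "(?cs, g) \<in> chains (Suc m)"
    using m g(1) by (auto simp: chains_def act_def gv)
  then obtain u where u: "u \<in> block_group" "map (act u) ?cs = ?cs"
    and v: "inv g \<otimes> u \<otimes> g \<in> block_group" and ne: "\<psi> u \<noteq> \<psi>' m (inv g \<otimes> u \<otimes> g)"
    using sep unfolding separates_def by blast
  let ?v = "inv g \<otimes> u \<otimes> g"
  have uc: "u \<in> carrier G"
    using block_groupD(1)[OF u(1)] .
  have conj: "\<rho> g (\<rho> ?v z) = \<rho> u (\<rho> g z)" for z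
    by (rule rho_conj[OF g(1) uc])
  have "\<rho> ?v 2 = 2 \<longleftrightarrow> \<rho> u 0 = 0"
    using tree_permsD(4)[OF rho_in[OF g(1)], of "\<rho> ?v 2" 2] by (simp add: conj gv)
  moreover have "half_sign i (\<rho> ?v) = 1" if i: "i \<in> {1..m}" for i
  proof -
    have "\<forall>c\<in>set ?cs. act u c = c"
      using u(2) by (metis map_eq_conv map_ident)
    moreover have "2 * i \<in> set ?cs"
      using i by (auto simp del: upt_Suc)
    ultimately have "act u (2 * i) = 2 * i"
      by blast
    then have "\<rho> u (4 * i) div 2 = 2 * i"
      by (simp add: act_def)
    then have "\<rho> ?v (4 * i) div 2 = 4 * i div 2"
      using tree_permsD(2)[OF rho_in[OF g(1)], of "\<rho> ?v (4 * i)" "4 * i"] i by (simp add: conj gv)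
    then show ?thesis
      by (simp add: half_sign_def)
  qed
  ultimately show False
    using ne by (simp add: \<psi>_def \<psi>'_def point_sign_def)
qed

text \<open>Whoever keeps one half of a block of size four keeps the block and thus its other half.
  For block 0 the half is \<omega> itself, so n - 1 further points suffice.\<close>

lemma stabilizer_trivial:
  assumes h: "h \<in> point_stabilizer" and fixed: "\<forall>c\<in>set (map (\<lambda>i. 2 * i) [1..<n]). act h c = c"
    and c: "c \<in> {..<2 * n}"
  shows "act h c = c"
proof -
  have hc: "h \<in> carrier G"
    using h by (simp add: in_stabilizer_iff)
  note h2 = tree_permsD(2)[OF rho_in[OF hc]] and h4 = tree_permsD(3)[OF rho_in[OF hc]]
  let ?i = "c div 2"
  have i: "\<rho> h (4 * ?i) div 2 = 2 * ?i"
  proof (cases "?i = 0")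
    case True
    then show ?thesis
      using h by (simp add: in_stabilizer_iff)
  next
    case False
    then have "?i \<in> {1..<n}"
      using c by auto
    then have "act h (2 * ?i) = 2 * ?i"
      using fixed by simp
    then show ?thesis
      by (simp add: act_def)
  qed
  show ?thesis
  proof (cases "even c")
    case True
    then have eq: "4 * ?i = 2 * c"
      by simp
    have "act h c = 2 * ?i"
      using i unfolding act_def eq .
    then show ?thesis
      using True by simp
  next
    case False
    then have c: "c = 2 * ?i + 1"
      by simp
    have "(2 * c) div 4 = ?i"
      using div_mult2_eq[of "2 * c" 2 2] by simp
    then have "\<rho> h (2 * c) div 4 = \<rho> h (4 * ?i) div 4"
      using h4[of "2 * c" "4 * ?i"] by simp
    then have "\<rho> h (2 * c) div 2 div 2 = ?i"
      using i div_mult2_eq[of "\<rho> h (2 * c)" 2 2] div_mult2_eq[of "\<rho> h (4 * ?i)" 2 2] by simp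
    moreover have "\<rho> h (2 * c) div 2 \<noteq> 2 * ?i"
      using h2[of "2 * c" "4 * ?i"] i c by auto
    ultimately have "\<rho> h (2 * c) div 2 = 2 * ?i + 1"
      by linarith
    then show ?thesis
      using c by (simp add: act_def)
  qed
qed

lemma ordinary_depth_stabilizer: "ordinary_depth point_stabilizer G = 2 * n"
proof (rule ordinary_depth_even[OF pos, where cs = "map (\<lambda>i. 2 * i) [1..<n]"])
  show "length (map (\<lambda>i. 2 * i) [1..<n]) = n - 1" "set (map (\<lambda>i. 2 * i) [1..<n]) \<subseteq> {..<2 * n}"
    by auto
  show "act h c = c" if "h \<in> point_stabilizer"
    "\<forall>c\<in>set (map (\<lambda>i. 2 * i) [1..<n]). act h c = c" "c \<in> {..<2 * n}" for h c
    using that by (rule stabilizer_trivial)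
  show "\<exists>U \<psi> \<psi>'. linear_character U \<psi> \<and> linear_character U \<psi>' \<and> U \<subseteq> point_stabilizer \<and>
      separates m U \<psi> \<psi>' \<and> \<not> separates (Suc m) U \<psi> \<psi>'" if "m < n" for m
    using linear_character_psi linear_character_psi' block_group_subset separates_psi[OF that]
      not_separates_psi[OF that] by blast
qed

end

section \<open>Realization on natural numbers\<close>

lemma tree_group_exists:
  assumes "n \<ge> 1"
  obtains G :: "nat monoid" and \<rho> where "tree_group G \<rho> n"
proof -
  let ?T = "tree_perms n"
  \<comment> \<open>The final statement has groups whose elements are natural numbers, so the finite
    permutation group is encoded by an injection, with \<open>\<rho>\<close> as the
    decoding.\<close>
  obtain f :: "(nat \<Rightarrow> nat) \<Rightarrow> nat" where inj: "inj_on f ?T"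
    using finite_imp_inj_to_nat_seg[OF finite_tree_perms[of n]] by blast
  define \<rho> where "\<rho> = inv_into ?T f"
  define G where "G = \<lparr>carrier = f ` ?T, monoid.mult = (\<lambda>x y. f (\<rho> x \<circ> \<rho> y)), one = f id\<rparr>"
  have \<rho>: "\<rho> (f p) = p" if "p \<in> ?T" for p
    unfolding \<rho>_def by (rule inv_into_f_f[OF inj that])
  have bij: "bij_betw \<rho> (carrier G) ?T"
    unfolding G_def \<rho>_def using inj_on_imp_bij_betw[OF inj] by (simp add: bij_betw_inv_into)
  have mult: "\<rho> (x \<otimes>\<^bsub>G\<^esub> y) = \<rho> x \<circ> \<rho> y" if "x \<in> carrier G" "y \<in> carrier G" for x y
    using that by (auto simp: G_def \<rho> tree_perms_comp)
  have one: "\<rho> \<one>\<^bsub>G\<^esub> = id"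
    by (simp add: G_def \<rho> tree_perms_id)
  have "group G"
  proof (rule groupI)
    fix x assume "x \<in> carrier G"
    then obtain p where p: "p \<in> ?T" "x = f p"
      by (auto simp: G_def)
    then have "f (inv_into UNIV p) \<otimes>\<^bsub>G\<^esub> x = \<one>\<^bsub>G\<^esub>"
      using permutes_inv_o(2)[OF tree_permsD(1)[OF p(1)]] by (simp add: G_def \<rho> tree_perms_inv)
    then show "\<exists>y\<in>carrier G. y \<otimes>\<^bsub>G\<^esub> x = \<one>\<^bsub>G\<^esub>"
      using tree_perms_inv[OF p(1)] by (auto simp: G_def)
  qed (auto simp: G_def \<rho> tree_perms_comp tree_perms_id comp_assoc)
  then have "tree_group G \<rho> n"
    using assms bij mult one by (intro tree_group.intro tree_group_axioms.intro)
  then show ?thesis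
    by (rule that)
qed

theorem theorem1p4:
  shows "\<exists>(G :: nat \<Rightarrow> nat monoid) (H :: nat \<Rightarrow> nat set).
           \<forall>n\<ge>1. group (G n) \<and> finite (carrier (G n)) \<and> subgroup (H n) (G n) \<and>
                  ordinary_depth (H n) (G n) = 2 * n"
proof -
  have "\<exists>(G :: nat monoid) H. group G \<and> finite (carrier G) \<and> subgroup H G \<and> ordinary_depth H G = 2 * n"
    if n: "n \<ge> 1" for n
  proof -
    obtain G \<rho> where "tree_group G \<rho> n"
      by (rule tree_group_exists[OF n])
    then interpret tree_group G \<rho> n .
    show ?thesis
      using is_group finite_carrier subgroup_stabilizer ordinary_depth_stabilizer by blast
  qed
  then show ?thesis
    by metis
qed

end
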